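(* Let $\beta\ge 0$ and $q\in\mathbb{N}$. Let $(\Lambda_n)_{n\in\mathbb{N}}$ be a sequence of diluted sets $\Lambda_n\subset\Delta_n^d$ with $\Lambda_n\Rightarrow\rho$ for some Lebesgue density $\rho$ on $\mathbb{T}^d$ with $N_\rho:=\int_{\mathbb{T}^d}\rho(u)\,du>0$. Put $\tilde\rho(u):=N_\rho^{-1}\rho(u)$. Then the measures $\hat\mu_{\Lambda_n}:=\mu_{\Lambda_n,\beta,q}\circ(\pi_{\Lambda_n})^{-1}$ on $\mathcal{P}=\mathcal{P}(\mathbb{T}^d\times\{1,\dots,q\})$ satisfy a large deviation principle with rate (speed) $|\Lambda_n|$ and rate function $I_{\tilde\rho}-\inf_{\nu\in\mathcal{P}}I_{\tilde\rho}(\nu)$, where $$I_{\tilde\rho}(\nu)=\begin{cases}-\beta\sum_{a=1}^q\langle J\ast(\tilde\rho\,\alpha[a]),\tilde\rho\,\alpha[a]\rangle+\int_{\mathbb{T}^d}S(\alpha(u)|\mathrm{eq})\,\tilde\rho(u)\,du & \text{if }\nu[a]=\tilde\rho\,\alpha[a]\lambda\ (a=1,\dots,q)\text{ for some }\alpha\in B,\\ \infty&\text{otherwise.}\end{cases}$$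
   Context: $\mathbb{T}^d=\mathbb{R}^d/\mathbb{Z}^d$ is the unit torus, $\lambda$ (or $du$) Lebesgue measure on it, $\Delta_n^d=\mathbb{Z}^d/n\mathbb{Z}^d$. $0\le J\in C(\mathbb{T}^d)$ is continuous, symmetric ($J(-v)=J(v)$) and $\int J(v)\,dv=1$. For $\Lambda\subset\Delta_n^d$ nonempty, $\mu_{\Lambda,\beta,q}$ is the Kac-Potts model in the subvolume $\Lambda$: the probability measure on $\{1,\dots,q\}^\Lambda$ proportional to $\exp(-\beta H_\Lambda(\sigma))$ with $$H_\Lambda(\sigma)=-\frac1{|\Lambda|}\sum_{x,y\in\Lambda}J\Bigl(\frac{x-y}{n}\Bigr)1_{\sigma(x)=\sigma(y)}.$$ The color profile of $\sigma$ in $\Lambda$ is the probability measure on $\mathbb{T}^d\times\{1,\dots,q\}$ $$\pi_\Lambda^\sigma=\frac1{|\Lambda|}\Bigl(\sum_{x\in\Lambda}1_{\sigma(x)=1}\delta_{x/n},\dots,\sum_{x\in\Lambda}1_{\sigma(x)=q}\delta_{x/n}\Bigr)^T.$$ For $\nu\in\mathcal{P}$, $\nu[a]$ denotes the measure $\nu(\cdot\times\{a\})$ on $\mathbb{T}^d$. $\mathcal{P}$ carries the weak topology. $\Lambda_n\Rightarrow\rho$ (for a nonnegative Lebesgue density $\rho$ on $\mathbb{T}^d$) means: $\frac1{n^d}\sum_{x\in\Lambda_n}f(x/n)\to\int\rho(u)f(u)\,du$ as $n\uparrow\infty$ for all $f\in C(\mathbb{T}^d)$. $B$ is the set of $\alpha=(\alpha[1],\dots,\alpha[q])^T$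 with $0\le\alpha[a]\in L^\infty(\mathbb{T}^d,\lambda)$ and $\sum_{a=1}^q\alpha[a](x)=1$ for $\lambda$-a.a. $x$. For functions $f,g$ on $\mathbb{T}^d$, $\langle J\ast f,g\rangle=\int\int f(u)g(v)J(u-v)\,du\,dv$. $\mathrm{eq}$ is the equidistribution on $\{1,\dots,q\}$ and $S(\alpha(u)|\mathrm{eq})=\sum_{a=1}^q\alpha[a](u)\log(q\,\alpha[a](u))$, with $0\log0=0$. Measures $Q_n$ on $\mathcal{P}$ satisfy a large deviation principle with rate $v_n\to\infty$ and rate function $K$ if $K:\mathcal P\to[0,\infty]$ is lower semicontinuous, $\limsup_n v_n^{-1}\log Q_n(C)\le-\inf_C K$ for closed $C$, and $\liminf_n v_n^{-1}\log Q_n(G)\ge-\inf_G K$ for open $G$. *)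

theory Defs
  imports "HOL-Probability.Probability"
begin

definition torus_rel :: "real ^ 'd \<Rightarrow> real ^ 'd \<Rightarrow> bool" where
  "torus_rel x y \<longleftrightarrow> (\<forall>i. x $ i - y $ i \<in> \<int>)"

lemma equivp_torus_rel: "equivp torus_rel"
proof (rule equivpI)
  show "reflp torus_rel"
    by (simp add: reflp_def torus_rel_def)
  show "symp torus_rel"
    unfolding symp_def torus_rel_def
  proof (intro allI impI)
    fix x y :: "real ^ 'd" and i
    assume "\<forall>i. x $ i - y $ i \<in> \<int>"
    then have "- (x $ i - y $ i) \<in> \<int>" by (intro Ints_minus) auto
    then show "y $ i - x $ i \<in> \<int>" by simp
  qed
  show "transp torus_rel"
    unfolding transp_def torus_rel_def
  proof (intro allI impI)
    fix x y z :: "real ^ 'd" and i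
    assume "\<forall>i. x $ i - y $ i \<in> \<int>" "\<forall>i. y $ i - z $ i \<in> \<int>"
    then have "(x $ i - y $ i) + (y $ i - z $ i) \<in> \<int>" by (intro Ints_add) auto
    then show "x $ i - z $ i \<in> \<int>" by simp
  qed
qed

quotient_type 'd torus = "real ^ 'd" / torus_rel
  by (rule equivp_torus_rel)

lift_definition to_torus :: "real ^ 'd \<Rightarrow> 'd torus" is "\<lambda>x. x" .

instantiation torus :: (finite) ab_group_add
begin

lift_definition zero_torus :: "'a torus" is 0 .

lift_definition plus_torus :: "'a torus \<Rightarrow> 'a torus \<Rightarrow> 'a torus" is "(+)"
proof -
  fix x y z w :: "real ^ 'a"
  assume "torus_rel x y" "torus_rel z w"
  then have *: "x $ i - y $ i \<in> \<int>" "z $ i - w $ i \<in> \<int>" for i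
    by (auto simp: torus_rel_def)
  show "torus_rel (x + z) (y + w)"
    unfolding torus_rel_def
    using Ints_add[OF *] by (simp only: vector_add_component add_diff_add) simp
qed

lift_definition uminus_torus :: "'a torus \<Rightarrow> 'a torus" is uminus
proof -
  fix x y :: "real ^ 'a"
  assume "torus_rel x y"
  then have *: "x $ i - y $ i \<in> \<int>" for i
    by (auto simp: torus_rel_def)
  show "torus_rel (- x) (- y)"
    unfolding torus_rel_def
    using Ints_minus[OF *] by (simp only: vector_uminus_component minus_diff_minus) simp
qed

lift_definition minus_torus :: "'a torus \<Rightarrow> 'a torus \<Rightarrow> 'a torus" is "(-)"
proof -
  fix x y z w :: "real ^ 'a"
  assume "torus_rel x y" "torus_rel z w"
  then have *: "x $ i - y $ i \<in> \<int>" "z $ i - w $ i \<in> \<int>" for i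
    by (auto simp: torus_rel_def)
  have "(x - z) $ i - (y - w) $ i = (x $ i - y $ i) - (z $ i - w $ i)" for i
    by simp
  then show "torus_rel (x - z) (y - w)"
    unfolding torus_rel_def using * by (simp only: Ints_diff) simp
qed

instance
  by (standard; transfer) (simp_all add: torus_rel_def)

end

instantiation torus :: (finite) topological_space
begin

definition open_torus :: "'a torus set \<Rightarrow> bool" where
  "open_torus U \<longleftrightarrow> open (to_torus -` U)"

instance
  by standard (auto simp: open_torus_def vimage_Union)

end

definition torus_lebesgue :: "'d::finite torus measure" where
  "torus_lebesgue = distr (restrict_space lborel {x :: real ^ 'd. \<forall>i. 0 \<le> x $ i \<and> x $ i < 1}) borel to_torus"

text \<open>The elements of \<open>(\<int>/n\<int>)\<^sup>d\<close> are represented by their residues in \<open>{0,\<dots>,n-1}\<^sup>d\<close>.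
  Only the points \<open>x/n\<close> of the torus and their differences are used below, and these do not
  depend on the choice of representatives.\<close>

definition discrete_torus :: "nat \<Rightarrow> (int ^ 'd) set" where
  "discrete_torus n = {x. \<forall>i. 0 \<le> x $ i \<and> x $ i < int n}"

definition site :: "nat \<Rightarrow> int ^ 'd \<Rightarrow> 'd::finite torus" where
  "site n x = to_torus (\<chi> i. real_of_int (x $ i) / real n)"

definition sites_converge :: "(nat \<Rightarrow> (int ^ 'd::finite) set) \<Rightarrow> ('d torus \<Rightarrow> real) \<Rightarrow> bool" where
  "sites_converge \<Lambda> \<rho> \<longleftrightarrow>
    (\<forall>f :: 'd torus \<Rightarrow> real. continuous_on UNIV f \<longrightarrow>
      (\<lambda>n. (1 / real n ^ CARD('d)) * (\<Sum>x\<in>\<Lambda> n. f (site n x)))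
        \<longlonglongrightarrow> (LINT u|torus_lebesgue. \<rho> u * f u))"

text \<open>The colours \<open>{1..q}\<close> are a subset of \<^typ>\<open>nat\<close>, whose topology is discrete.\<close>

definition coloured_torus :: "nat \<Rightarrow> ('d::finite torus \<times> nat) measure" where
  "coloured_torus q = restrict_space borel (UNIV \<times> {1..q})"

definition prob_measures :: "'a measure \<Rightarrow> 'a measure set" where
  "prob_measures M = {\<nu>. prob_space \<nu> \<and> sets \<nu> = sets M}"

text \<open>The test functions are bounded automatically, the torus being compact.\<close>

definition weak_topology :: "nat \<Rightarrow> ('d::finite torus \<times> nat) measure topology" where
  "weak_topology q = topology_generated_by
    {{\<nu> \<in> prob_measures (coloured_torus q). (LINT z|\<nu>. f z) \<in> U} | f U.
      continuous_on (UNIV \<times> {1..q}) f \<and> open (U :: real set)}"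

definition colour_part :: "('d::finite torus \<times> nat) measure \<Rightarrow> nat \<Rightarrow> 'd torus measure" where
  "colour_part \<nu> a = measure_of UNIV (sets borel) (\<lambda>A. emeasure \<nu> (A \<times> {a}))"

definition borel_space_of :: "'a topology \<Rightarrow> 'a measure" where
  "borel_space_of X = sigma (topspace X) {U. openin X U}"

definition log_ext :: "real \<Rightarrow> ereal" where
  "log_ext p = (if p = 0 then -\<infinity> else ereal (ln p))"

definition lower_semicontinuous_in :: "'a topology \<Rightarrow> ('a \<Rightarrow> ereal) \<Rightarrow> bool" where
  "lower_semicontinuous_in X K \<longleftrightarrow> (\<forall>c::real. closedin X {x \<in> topspace X. K x \<le> ereal c})"

definition large_deviation_principle ::
    "'a topology \<Rightarrow> (nat \<Rightarrow> 'a measure) \<Rightarrow> (nat \<Rightarrow> real) \<Rightarrow> ('a \<Rightarrow> ereal) \<Rightarrow> bool" where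
  "large_deviation_principle X Q v K \<longleftrightarrow>
     filterlim v at_top sequentially \<and>
     (\<forall>x\<in>topspace X. 0 \<le> K x) \<and>
     lower_semicontinuous_in X K \<and>
     (\<forall>C. closedin X C \<longrightarrow>
        limsup (\<lambda>n. log_ext (measure (Q n) C) / ereal (v n)) \<le> - (INF x\<in>C. K x)) \<and>
     (\<forall>G. openin X G \<longrightarrow>
        - (INF x\<in>G. K x) \<le> liminf (\<lambda>n. log_ext (measure (Q n) G) / ereal (v n)))"

definition potts_hamiltonian ::
    "('d::finite torus \<Rightarrow> real) \<Rightarrow> nat \<Rightarrow> (int ^ 'd) set \<Rightarrow> (int ^ 'd \<Rightarrow> nat) \<Rightarrow> real" where
  "potts_hamiltonian J n \<Lambda> \<sigma> =
    - (1 / real (card \<Lambda>)) *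
      (\<Sum>x\<in>\<Lambda>. \<Sum>y\<in>\<Lambda>. J (site n x - site n y) * (if \<sigma> x = \<sigma> y then 1 else 0))"

definition kac_potts ::
    "('d::finite torus \<Rightarrow> real) \<Rightarrow> real \<Rightarrow> nat \<Rightarrow> nat \<Rightarrow> (int ^ 'd) set \<Rightarrow> (int ^ 'd \<Rightarrow> nat) measure" where
  "kac_potts J \<beta> q n \<Lambda> = point_measure (\<Lambda> \<rightarrow>\<^sub>E {1..q})
    (\<lambda>\<sigma>. ennreal (exp (- \<beta> * potts_hamiltonian J n \<Lambda> \<sigma>) /
       (\<Sum>\<tau>\<in>\<Lambda> \<rightarrow>\<^sub>E {1..q}. exp (- \<beta> * potts_hamiltonian J n \<Lambda> \<tau>))))"

definition colour_profile ::
    "nat \<Rightarrow> nat \<Rightarrow> (int ^ 'd) set \<Rightarrow> (int ^ 'd \<Rightarrow> nat) \<Rightarrow> ('d::finite torus \<times> nat) measure" where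
  "colour_profile q n \<Lambda> \<sigma> = measure_of (space (coloured_torus q)) (sets (coloured_torus q))
    (\<lambda>A. ennreal ((1 / real (card \<Lambda>)) *
       (\<Sum>a\<in>{1..q}. \<Sum>x\<in>\<Lambda>. if \<sigma> x = a then indicator A (site n x, a) else 0)))"

definition profile_law ::
    "('d::finite torus \<Rightarrow> real) \<Rightarrow> real \<Rightarrow> nat \<Rightarrow> nat \<Rightarrow> (int ^ 'd) set \<Rightarrow> ('d torus \<times> nat) measure measure" where
  "profile_law J \<beta> q n \<Lambda> =
    distr (kac_potts J \<beta> q n \<Lambda>) (borel_space_of (weak_topology q)) (colour_profile q n \<Lambda>)"

definition normalized_density :: "('d::finite torus \<Rightarrow> real) \<Rightarrow> 'd torus \<Rightarrow> real" where
  "normalized_density \<rho> u = \<rho> u / (LINT w|torus_lebesgue. \<rho> w)"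

definition kernel_pairing ::
    "('d::finite torus \<Rightarrow> real) \<Rightarrow> ('d torus \<Rightarrow> real) \<Rightarrow> ('d torus \<Rightarrow> real) \<Rightarrow> real" where
  "kernel_pairing J f g =
    (LINT v|torus_lebesgue. (LINT u|torus_lebesgue. f u * g v * J (u - v)))"

definition entropy_eq :: "nat \<Rightarrow> (nat \<Rightarrow> real) \<Rightarrow> real" where
  "entropy_eq q p = (\<Sum>a\<in>{1..q}. p a * ln (real q * p a))"

text \<open>Elements of \<open>L\<^sup>\<infinity>\<close> are represented by Borel measurable, essentially bounded functions.\<close>

definition local_profiles :: "nat \<Rightarrow> (nat \<Rightarrow> 'd::finite torus \<Rightarrow> real) set" where
  "local_profiles q = {\<alpha>.
     (\<forall>a\<in>{1..q}. \<alpha> a \<in> borel_measurable torus_lebesgue \<and>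
        (AE u in torus_lebesgue. 0 \<le> \<alpha> a u) \<and>
        (\<exists>C. AE u in torus_lebesgue. \<bar>\<alpha> a u\<bar> \<le> C)) \<and>
     (AE u in torus_lebesgue. (\<Sum>a\<in>{1..q}. \<alpha> a u) = 1)}"

definition represents ::
    "nat \<Rightarrow> ('d::finite torus \<Rightarrow> real) \<Rightarrow> ('d torus \<times> nat) measure \<Rightarrow> (nat \<Rightarrow> 'd torus \<Rightarrow> real) \<Rightarrow> bool" where
  "represents q \<rho> \<nu> \<alpha> \<longleftrightarrow> \<alpha> \<in> local_profiles q \<and>
     (\<forall>a\<in>{1..q}. colour_part \<nu> a = density torus_lebesgue (\<lambda>u. ennreal (\<rho> u * \<alpha> a u)))"

text \<open>The choice of \<open>\<alpha>\<close> is immaterial: \<open>\<nu>\<close> determines it almost everywhere on \<open>{\<rho> > 0}\<close>, and both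
  terms only depend on \<open>\<alpha>\<close> through its values there.\<close>

definition rate_function ::
    "('d::finite torus \<Rightarrow> real) \<Rightarrow> real \<Rightarrow> nat \<Rightarrow> ('d torus \<Rightarrow> real) \<Rightarrow>
      ('d torus \<times> nat) measure \<Rightarrow> ereal" where
  "rate_function J \<beta> q \<rho> \<nu> =
    (if \<exists>\<alpha>. represents q \<rho> \<nu> \<alpha> then
       (let \<alpha> = (SOME \<alpha>. represents q \<rho> \<nu> \<alpha>) in
         ereal (- \<beta> * (\<Sum>a\<in>{1..q}. kernel_pairing J (\<lambda>u. \<rho> u * \<alpha> a u) (\<lambda>u. \<rho> u * \<alpha> a u))
                + (LINT u|torus_lebesgue. entropy_eq q (\<lambda>a. \<alpha> a u) * \<rho> u)))
     else \<infinity>)"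

end

theory Submission
  imports Defs
begin

text \<open>
  Up to normalisation, the Gibbs measure has density \<open>exp (\<beta> |\<Lambda>| interaction J \<pi>)\<close> with respect to
  independent uniform colours, and the interaction is a weakly continuous function of the profile
  \<open>\<pi>\<close>. For every continuous \<open>f\<close>, the exponential of \<open>|\<Lambda>|\<close> times the integral of
  \<open>log_likelihood q f\<close> against \<open>\<pi>\<close> has expectation exactly 1 under uniform colours, and the supremum of
  these integrals over \<open>f\<close> is the entropy term of the rate function.

  Upper bound: each of these functionals controls an open set of profiles by Markov's inequality.
  Countably many of them cover the part of a closed set that can carry limits of profiles, namely the
  measures with first marginal \<open>\<rho>\<close> (normalised), and finitely many suffice because every sequence of
  profiles has a weakly convergent subsequence: profiles are images of measures on the line under a
  space-filling curve, and on the line Helly's theorem applies.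

  Lower bound: a represented measure is approximated, together with its entropy, by one with positive
  continuous colour densities. Under independent colours with these densities the profile concentrates
  near the approximation by Chernoff's bound, and the cost of the change of measure is its entropy.
\<close>

section \<open>The torus as a compact metric space\<close>

text \<open>A log-likelihood never exceeds \<open>ln (real q)\<close>, because its exponential is q
  times a colour probability. Exponential tilts therefore cannot see the infinite part of the rate:
  on measures with a wrong first marginal they yield only bounded exponents. What excludes such
  measures is deterministic. The first marginal of a profile is the empirical measure of the sites,
  whatever the colours, and it converges by hypothesis. This is why a closed set itself need not be
  covered and the argument runs through limits of profiles. The passage to the line rests on
  profiles having finite support: curve parameters can be chosen for the atoms without any question
  of measurability, so a continuous surjection from a compact set of reals is enough. Both bounds
  are proved for unnormalised Gibbs weights, compared with q to the power of the number of sites.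
  The whole space is open and closed, so the same bounds apply to the partition function, and this
  produces the subtracted infimum of the rate.\<close>

lemma to_torus_eq_iff: "to_torus x = to_torus y \<longleftrightarrow> (\<forall>i. x $ i - y $ i \<in> \<int>)"
  by (transfer) (simp add: torus_rel_def)

lemma to_torus_diff: "to_torus (x - y) = to_torus x - to_torus y"
  by transfer (simp add: torus_rel_def)

lemma to_torus_fundamental_domain:
  obtains x where "to_torus x = u" "\<And>i. 0 \<le> x $ i" "\<And>i. x $ i < 1"
proof -
  obtain y where y: "u = to_torus y"
    by (transfer) (meson equivp_reflp equivp_torus_rel)
  show ?thesis
  proof (rule that[of "\<chi> i. frac (y $ i)"])
    show "to_torus (\<chi> i. frac (y $ i)) = u"
      by (simp add: y to_torus_eq_iff frac_def)
  qed (auto simp: frac_lt_1)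
qed

lemma continuous_on_to_torus: "continuous_on S to_torus"
proof -
  have "continuous_on UNIV to_torus"
    by (simp add: continuous_on_open_vimage open_torus_def)
  then show ?thesis
    using continuous_on_subset by blast
qed

text \<open>The saturation of an open set is the union of its integer translates. Openness of the
  quotient map later carries bases and product neighbourhoods from \<open>real ^ 'd\<close> to the
  torus.\<close>

lemma open_to_torus_image:
  assumes "open V"
  shows "open (to_torus ` V)"
proof -
  have "to_torus -` to_torus ` V = (\<Union>k\<in>{k. \<forall>i. k $ i \<in> \<int>}. (+) k ` V)" (is "?L = ?R")
  proof (intro equalityI subsetI)
    fix x assume "x \<in> ?L"
    then obtain y where y: "y \<in> V" "to_torus x = to_torus y" by auto
    then have "x - y \<in> {k. \<forall>i. k $ i \<in> \<int>}" by (simp add: to_torus_eq_iff)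
    moreover have "x \<in> (+) (x - y) ` V"
      by (rule image_eqI[where x = y]) (use y in auto)
    ultimately show "x \<in> ?R" by blast
  next
    fix x assume "x \<in> ?R"
    then obtain k y where "\<forall>i. k $ i \<in> \<int>" "y \<in> V" "x = k + y" by auto
    then have "to_torus x = to_torus y" "y \<in> V" by (auto simp: to_torus_eq_iff)
    then show "x \<in> ?L" by auto
  qed
  moreover have "open ?R"
    using assms by (intro open_UN ballI open_translation)
  ultimately show ?thesis
    by (simp add: open_torus_def)
qed

lemma compact_UNIV_torus: "compact (UNIV :: 'd::finite torus set)"
proof -
  have "(UNIV :: 'd torus set) = to_torus ` cbox 0 1"
  proof (intro equalityI subsetI)
    fix u :: "'d torus"
    obtain x where x: "to_torus x = u" "\<And>i. 0 \<le> x $ i" "\<And>i. x $ i < 1"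
      using to_torus_fundamental_domain[of u] by blast
    have "x \<in> cbox 0 1" using x by (auto simp: mem_box_cart intro: less_imp_le)
    with x(1) show "u \<in> to_torus ` cbox 0 1" by blast
  qed auto
  then show ?thesis
    by (metis compact_continuous_image compact_cbox continuous_on_to_torus)
qed

text \<open>The torus as a product of circles. Its chordal distance becomes the metric, so that the
  triangle inequality is inherited from the ambient space.\<close>

lift_definition torus_embedding :: "'d torus \<Rightarrow> complex ^ 'd"
  is "\<lambda>x. \<chi> i. cis (2 * pi * x $ i)"
proof -
  fix x y :: "real ^ 'd"
  assume "torus_rel x y"
  have "cis (2 * pi * x $ i) = cis (2 * pi * y $ i)" for i
  proof -
    from \<open>torus_rel x y\<close> obtain k where "x $ i - y $ i = of_int k"
      unfolding torus_rel_def by (blast elim: Ints_cases)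
    then have "x $ i = y $ i + of_int k"
      by linarith
    then have "2 * pi * x $ i = 2 * pi * y $ i + 2 * pi * of_int k"
      by (simp only: distrib_left)
    then show ?thesis
      by (simp only: cis_mult[symmetric] cis_multiple_2pi Ints_of_int mult_1_right)
  qed
  then show "(\<chi> i. cis (2 * pi * x $ i)) = (\<chi> i. cis (2 * pi * y $ i))"
    by simp
qed

lemma torus_embedding_to_torus: "torus_embedding (to_torus x) = (\<chi> i. cis (2 * pi * x $ i))"
  by transfer simp

lemma inj_torus_embedding: "inj torus_embedding"
proof (rule injI)
  fix u v :: "'a torus"
  assume eq: "torus_embedding u = torus_embedding v"
  obtain x y where xy: "to_torus x = u" "to_torus y = v"
    by (metis to_torus_fundamental_domain)
  have "x $ i - y $ i \<in> \<int>" for i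
  proof -
    have "cis (2 * pi * x $ i) = cis (2 * pi * y $ i)"
      using eq unfolding xy[symmetric] torus_embedding_to_torus by (simp add: vec_eq_iff)
    then have "sin (2 * pi * x $ i) = sin (2 * pi * y $ i) \<and>
        cos (2 * pi * x $ i) = cos (2 * pi * y $ i)"
      by (metis cis.simps)
    then obtain n :: int where "2 * pi * x $ i = 2 * pi * y $ i + 2 * pi * of_int n"
      unfolding sin_cos_eq_iff by auto
    then have "2 * pi * (x $ i - y $ i) = 2 * pi * of_int n"
      by (simp add: algebra_simps)
    then show ?thesis by simp
  qed
  then show "u = v" unfolding xy[symmetric] by (simp add: to_torus_eq_iff)
qed

lemma continuous_on_torus_embedding: "continuous_on UNIV (torus_embedding :: 'd::finite torus \<Rightarrow> _)"
proof -
  have c: "continuous_on UNIV (\<lambda>x :: real ^ 'd. \<chi> i. cis (2 * pi * x $ i))"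
    by (intro continuous_intros)
  have "open (torus_embedding -` W :: 'd torus set)" if "open W" for W
  proof -
    have "to_torus -` torus_embedding -` W = (\<lambda>x :: real ^ 'd. \<chi> i. cis (2 * pi * x $ i)) -` W"
      by (auto simp: torus_embedding_to_torus)
    with c that show ?thesis
      by (simp add: open_torus_def continuous_on_open_vimage)
  qed
  then show ?thesis
    by (simp add: continuous_on_open_vimage)
qed

text \<open>The topology is already fixed as the quotient topology, so the substance of the instance
  is that the metric induces it.\<close>

instantiation torus :: (finite) metric_space
begin

definition dist_torus :: "'a torus \<Rightarrow> 'a torus \<Rightarrow> real" where
  "dist_torus u v = dist (torus_embedding u) (torus_embedding v)"

definition uniformity_torus :: "('a torus \<times> 'a torus) filter" where
  "uniformity_torus = (INF e\<in>{0<..}. principal {(u, v). dist u v < e})"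

instance
proof
  show "(uniformity :: ('a torus \<times> 'a torus) filter) = (INF e\<in>{0<..}. principal {(u, v). dist u v < e})"
    by (rule uniformity_torus_def)
  fix u v w :: "'a torus"
  show "dist u v = 0 \<longleftrightarrow> u = v"
    using injD[OF inj_torus_embedding] by (auto simp: dist_torus_def)
  show "dist u v \<le> dist u w + dist v w"
    unfolding dist_torus_def by (rule dist_triangle2)
next
  fix U :: "'a torus set"
  have ev: "eventually P uniformity \<longleftrightarrow> (\<exists>e>0. \<forall>u v :: 'a torus. dist u v < e \<longrightarrow> P (u, v))" for P
  proof -
    have "\<exists>c\<in>{0<..}. {(u :: 'a torus, v). dist u v < c} \<subseteq> {(u, v). dist u v < a} \<inter> {(u, v). dist u v < b}"
      if "a > 0" "b > 0" for a b :: real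
      using that by (intro bexI[of _ "min a b"]) auto
    then show ?thesis
      unfolding uniformity_torus_def
      by (subst eventually_INF_base) (auto simp: eventually_principal)
  qed
  have "open U \<longleftrightarrow> (\<forall>u\<in>U. \<exists>e>0. \<forall>v. dist u v < e \<longrightarrow> v \<in> U)"
  proof
    \<comment> \<open>A continuous injection of a compact space into a Hausdorff space is a
      homeomorphism onto its image: the complement of \<open>U\<close> is compact, so its image is
      closed, and some ball around the image of \<open>u\<close> misses it.\<close>
    assume "open U"
    then have "compact (- U)"
      using closed_Int_compact[OF _ compact_UNIV_torus, of "- U"] by (simp add: closed_def)
    then have "compact (torus_embedding ` (- U))"
      by (rule compact_continuous_image[rotated])
        (rule continuous_on_subset[OF continuous_on_torus_embedding], simp)
    then have op: "open (- torus_embedding ` (- U))"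
      by (simp add: compact_imp_closed open_closed)
    show "\<forall>u\<in>U. \<exists>e>0. \<forall>v. dist u v < e \<longrightarrow> v \<in> U"
    proof
      fix u assume "u \<in> U"
      then have "torus_embedding u \<in> - torus_embedding ` (- U)"
        by (simp add: inj_image_mem_iff[OF inj_torus_embedding])
      with op obtain e where "e > 0" and sub: "ball (torus_embedding u) e \<subseteq> - torus_embedding ` (- U)"
        by (meson openE)
      then have "v \<in> U" if "dist u v < e" for v
      proof -
        have "torus_embedding v \<in> - torus_embedding ` (- U)"
          using that by (intro subsetD[OF sub]) (simp add: dist_torus_def)
        then show ?thesis by (simp add: inj_image_mem_iff[OF inj_torus_embedding])
      qed
      with \<open>e > 0\<close> show "\<exists>e>0. \<forall>v. dist u v < e \<longrightarrow> v \<in> U"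
        by blast
    qed
  next
    assume R: "\<forall>u\<in>U. \<exists>e>0. \<forall>v. dist u v < e \<longrightarrow> v \<in> U"
    have "\<exists>T. open T \<and> u \<in> T \<and> T \<subseteq> U" if "u \<in> U" for u
    proof -
      from R that obtain e where e: "e > 0" "\<And>v. dist u v < e \<Longrightarrow> v \<in> U" by blast
      have "open (torus_embedding -` ball (torus_embedding u) e :: 'a torus set)"
        by (rule open_vimage[OF open_ball continuous_on_torus_embedding])
      moreover have "torus_embedding -` ball (torus_embedding u) e \<subseteq> U"
        using e(2) by (auto simp: dist_torus_def)
      moreover have "u \<in> torus_embedding -` ball (torus_embedding u) e"
        using e(1) by simp
      ultimately show ?thesis by blast
    qed
    then show "open U" by (subst open_subopen) simp
  qed
  moreover have ev': "(\<forall>\<^sub>F (u', v) in uniformity. u' = u \<longrightarrow> v \<in> U) \<longleftrightarrow>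
      (\<exists>e>0. \<forall>v. dist u v < e \<longrightarrow> v \<in> U)" for u
    by (simp add: ev)
  ultimately show "open U \<longleftrightarrow> (\<forall>u\<in>U. \<forall>\<^sub>F (u', v) in uniformity. u' = u \<longrightarrow> v \<in> U)"
    by (simp only: ev')
qed

end

text \<open>Second countability identifies the Borel sets of a product with the product
  sigma-algebra, which is how measures on the coloured torus are built below.\<close>

instance torus :: (finite) second_countable_topology
proof
  obtain B :: "(real ^ 'a) set set" where B: "countable B" "topological_basis B"
    using ex_countable_basis by blast
  have "topological_basis ((`) to_torus ` B)"
  proof (rule topological_basisI)
    fix U assume "U \<in> (`) to_torus ` B"
    then show "open U"
      using B(2) by (auto intro!: open_to_torus_image topological_basis_open)
  next
    fix U :: "'a torus set" and u
    assume U: "open U" "u \<in> U"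
    obtain x where x: "to_torus x = u"
      using to_torus_fundamental_domain[of u] by blast
    have "open (to_torus -` U)" "x \<in> to_torus -` U"
      using U x by (auto simp: open_torus_def)
    then obtain b where "b \<in> B" "x \<in> b" "b \<subseteq> to_torus -` U"
      using B(2) topological_basisE by blast
    with x show "\<exists>B'\<in>(`) to_torus ` B. u \<in> B' \<and> B' \<subseteq> U"
      by auto
  qed
  with B(1) show "\<exists>B::'a torus set set. countable B \<and> open = generate_topology B"
    using topological_basis_imp_subbasis by blast
qed

text \<open>With this instance the coloured torus lies in a metric space.\<close>

instantiation nat :: metric_space
begin

definition dist_nat :: "nat \<Rightarrow> nat \<Rightarrow> real" where
  "dist_nat a b = dist (real a) (real b)"

definition uniformity_nat :: "(nat \<times> nat) filter" where
  "uniformity_nat = (INF e\<in>{0<..}. principal {(a, b). dist a b < e})"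

instance
proof
  show "(uniformity :: (nat \<times> nat) filter) = (INF e\<in>{0<..}. principal {(a, b). dist a b < e})"
    by (rule uniformity_nat_def)
  fix a b c :: nat
  show "dist a b = 0 \<longleftrightarrow> a = b"
    by (simp add: dist_nat_def)
  show "dist a b \<le> dist a c + dist b c"
    unfolding dist_nat_def by (rule dist_triangle2)
next
  fix U :: "nat set"
  have "{(a :: nat, b :: nat). dist a b < 1} \<subseteq> {(a, b). a = b}"
    by (auto simp: dist_nat_def dist_real_def)
  then have "uniformity \<le> principal {(a :: nat, b :: nat). a = b}"
    unfolding uniformity_nat_def by (intro INF_lower2[of 1]) auto
  then have "\<forall>\<^sub>F (a', b) in uniformity. a' = a \<longrightarrow> b \<in> U" if "a \<in> U" for a
    using that by (auto simp: le_filter_def eventually_principal)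
  then show "open U \<longleftrightarrow> (\<forall>a\<in>U. \<forall>\<^sub>F (a', b) in uniformity. a' = a \<longrightarrow> b \<in> U)"
    by (auto intro: discrete_topology_class.open_discrete)
qed

end

text \<open>Subtraction is continuous before passing to the quotient. Since the quotient map is
  open, the images of two open factors upstairs form a product neighbourhood downstairs.\<close>

lemma continuous_on_torus_diff:
  "continuous_on UNIV (\<lambda>z :: 'd::finite torus \<times> 'd torus. fst z - snd z)"
proof -
  have "open ((\<lambda>z :: 'd torus \<times> 'd torus. fst z - snd z) -` W)" if W: "open W" for W
  proof (rule open_prod_intro)
    fix z :: "'d torus \<times> 'd torus"
    assume z: "z \<in> (\<lambda>z. fst z - snd z) -` W"
    obtain x y where xy: "to_torus x = fst z" "to_torus y = snd z"
      by (metis to_torus_fundamental_domain)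
    have "open (to_torus -` W)" using W by (simp add: open_torus_def)
    then have "open ((\<lambda>p. fst p - snd p) -` to_torus -` W)"
      by (rule open_vimage) (intro continuous_intros)
    moreover have "(x, y) \<in> (\<lambda>p. fst p - snd p) -` to_torus -` W"
      using z xy by (simp add: to_torus_diff)
    ultimately obtain A B where AB: "open A" "open B" "(x, y) \<in> A \<times> B"
      "A \<times> B \<subseteq> (\<lambda>p. fst p - snd p) -` to_torus -` W"
      by (rule open_prod_elim)
    have "z \<in> to_torus ` A \<times> to_torus ` B"
      using AB(3) by (simp add: mem_Times_iff xy[symmetric])
    moreover have "to_torus ` A \<times> to_torus ` B \<subseteq> (\<lambda>z. fst z - snd z) -` W"
      using AB(4) by (auto simp: subset_eq to_torus_diff)
    ultimately show "\<exists>A B. open A \<and> open B \<and> z \<in> A \<times> B \<and> A \<times> B \<subseteq> (\<lambda>z. fst z - snd z) -` W"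
      using AB(1,2) open_to_torus_image by blast
  qed
  then show ?thesis by (simp add: continuous_on_open_vimage)
qed

lemma sets_torus_lebesgue [simp, measurable_cong]: "sets torus_lebesgue = sets borel"
  by (simp add: torus_lebesgue_def)

lemma space_torus_lebesgue [simp]: "space torus_lebesgue = UNIV"
  by (simp add: torus_lebesgue_def)

lemma finite_measure_torus_lebesgue: "finite_measure (torus_lebesgue :: 'd::finite torus measure)"
proof -
  let ?Q = "{x :: real ^ 'd. \<forall>i. 0 \<le> x $ i \<and> x $ i < 1}"
  have [measurable]: "?Q \<in> sets borel" by measurable
  have [measurable]: "to_torus \<in> borel_measurable (borel :: (real ^ 'd) measure)"
    by (rule borel_measurable_continuous_onI[OF continuous_on_to_torus])
  have "emeasure lborel ?Q \<le> emeasure lborel (cbox 0 1 :: (real ^ 'd) set)"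
    by (rule emeasure_mono) (auto simp: mem_box_cart less_imp_le)
  also have "\<dots> < \<infinity>" by (rule emeasure_lborel_cbox_finite)
  finally have "finite_measure (restrict_space lborel ?Q)"
    by (intro finite_measureI) (simp add: space_restrict_space emeasure_restrict_space)
  then show ?thesis
    unfolding torus_lebesgue_def
    by (rule finite_measure.finite_measure_distr) (simp add: measurable_restrict_space1)
qed

section \<open>Continuous functions and measures on compact metric spaces\<close>

text \<open>Tent functions of radius \<open>e\<close> over a finite net, divided by their sum; the
  net property makes the sum positive on \<open>S\<close>. The centres lie in \<open>S\<close>, so
  that functions given only on \<open>S\<close> can be sampled there.\<close>

lemma compact_partition_of_unity:
  fixes S :: "'a::metric_space set"
  assumes "compact S" "e > 0"
  obtains Y and \<phi> :: "'a \<Rightarrow> 'a \<Rightarrow> real" where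
    "finite Y" "Y \<subseteq> S" "\<And>y. continuous_on S (\<phi> y)" "\<And>x y. x \<in> S \<Longrightarrow> 0 \<le> \<phi> y x"
    "\<And>x. x \<in> S \<Longrightarrow> (\<Sum>y\<in>Y. \<phi> y x) = 1" "\<And>x y. x \<in> S \<Longrightarrow> \<phi> y x \<noteq> 0 \<Longrightarrow> dist x y < e"
proof -
  obtain Y where Y: "finite Y" "Y \<subseteq> S" "S \<subseteq> (\<Union>y\<in>Y. ball y e)"
    by (rule compactE_image[OF assms(1), of S "\<lambda>y. ball y e"]) (use assms(2) in auto)
  define D where "D x = (\<Sum>z\<in>Y. max 0 (e - dist x z))" for x
  define \<phi> where "\<phi> y x = max 0 (e - dist x y) / D x" for y x
  have D: "D x > 0" if x: "x \<in> S" for x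
  proof -
    obtain z where z: "z \<in> Y" "dist z x < e" using Y(3) x by auto
    have "0 < max 0 (e - dist x z)" using z by (simp add: dist_commute)
    also have "\<dots> \<le> D x"
      unfolding D_def using Y(1) z by (intro member_le_sum) auto
    finally show ?thesis .
  qed
  show ?thesis
  proof (rule that[OF Y(1,2), of \<phi>])
    show "continuous_on S (\<phi> y)" for y
    proof -
      have "continuous_on S D" unfolding D_def by (intro continuous_intros)
      moreover have "D x \<noteq> 0" if "x \<in> S" for x
        using D[OF that] by simp
      ultimately show ?thesis
        unfolding \<phi>_def by (intro continuous_intros) auto
    qed
    show "0 \<le> \<phi> y x" if "x \<in> S" for x y
      using D[OF that] by (simp add: \<phi>_def)
    show "(\<Sum>y\<in>Y. \<phi> y x) = 1" if "x \<in> S" for x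
      using D[OF that] by (simp add: \<phi>_def D_def flip: sum_divide_distrib)
    show "dist x y < e" if "x \<in> S" "\<phi> y x \<noteq> 0" for x y
      using that by (auto simp: \<phi>_def max_def split: if_splits)
  qed
qed

lemma partition_of_unity_average:
  fixes w :: "'a \<Rightarrow> real"
  assumes "finite Y" "\<And>y. y \<in> Y \<Longrightarrow> 0 \<le> w y" "(\<Sum>y\<in>Y. w y) = 1"
    "\<And>y. y \<in> Y \<Longrightarrow> w y \<noteq> 0 \<Longrightarrow> \<bar>c - r y\<bar> \<le> e"
  shows "\<bar>c - (\<Sum>y\<in>Y. w y * r y)\<bar> \<le> e"
proof -
  have "c - (\<Sum>y\<in>Y. w y * r y) = (\<Sum>y\<in>Y. w y * (c - r y))"
    using assms(3) by (simp add: right_diff_distrib sum_subtractf flip: sum_distrib_right)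
  also have "\<bar>\<dots>\<bar> \<le> (\<Sum>y\<in>Y. \<bar>w y * (c - r y)\<bar>)" by (rule sum_abs)
  also have "\<dots> \<le> (\<Sum>y\<in>Y. w y * e)"
  proof (rule sum_mono)
    fix y assume y: "y \<in> Y"
    show "\<bar>w y * (c - r y)\<bar> \<le> w y * e"
      using assms(2)[OF y] assms(4)[OF y]
      by (cases "w y = 0") (auto simp: abs_mult intro: mult_left_mono)
  qed
  also have "\<dots> = e" using assms(3) by (simp flip: sum_distrib_right)
  finally show ?thesis .
qed

text \<open>This separates the variables: once \<open>w\<close> is replaced by nearby net points, an
  integral of \<open>K\<close> becomes a finite sum of products of integrals in one variable. The
  error is controlled by uniform continuity.\<close>

lemma kernel_finite_rank_approx:
  fixes K :: "'a::metric_space \<times> 'a \<Rightarrow> real"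
  assumes S: "compact S" and K: "continuous_on (S \<times> S) K" and e: "e > 0"
  obtains Y \<phi> where "finite Y" "Y \<subseteq> S" "\<And>y. continuous_on S (\<phi> y :: 'a \<Rightarrow> real)"
    "\<And>z w. z \<in> S \<Longrightarrow> w \<in> S \<Longrightarrow> \<bar>K (z, w) - (\<Sum>y\<in>Y. \<phi> y w * K (z, y))\<bar> \<le> e"
proof -
  have "uniformly_continuous_on (S \<times> S) K"
    using S K by (intro compact_uniformly_continuous compact_Times)
  then obtain d where d: "d > 0"
    "\<And>p r. p \<in> S \<times> S \<Longrightarrow> r \<in> S \<times> S \<Longrightarrow> dist r p < d \<Longrightarrow> dist (K r) (K p) < e"
    using e by (rule uniformly_continuous_onE) blast
  obtain Y \<phi> where P: "finite Y" "Y \<subseteq> S" "\<And>y. continuous_on S (\<phi> y :: 'a \<Rightarrow> real)"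
    "\<And>x y. x \<in> S \<Longrightarrow> 0 \<le> \<phi> y x" "\<And>x. x \<in> S \<Longrightarrow> (\<Sum>y\<in>Y. \<phi> y x) = 1"
    "\<And>x y. x \<in> S \<Longrightarrow> \<phi> y x \<noteq> 0 \<Longrightarrow> dist x y < d"
    using compact_partition_of_unity[OF S d(1)] by blast
  show ?thesis
  proof (rule that[OF P(1-3)])
    fix z w assume zw: "z \<in> S" "w \<in> S"
    show "\<bar>K (z, w) - (\<Sum>y\<in>Y. \<phi> y w * K (z, y))\<bar> \<le> e"
    proof (rule partition_of_unity_average)
      fix y assume "y \<in> Y" "\<phi> y w \<noteq> 0"
      then have "dist w y < d" "y \<in> S" using P zw by auto
      then have "dist (K (z, w)) (K (z, y)) < e"
        using zw by (intro d(2)) (auto simp: dist_Pair_Pair)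
      then show "\<bar>K (z, w) - K (z, y)\<bar> \<le> e" by (simp add: dist_real_def)
    qed (use P zw in auto)
  qed
qed

text \<open>One net for each scale 1/(k+1), with rational values averaged over it. This lets the
  upper bound work with a sequence of test functions.\<close>

lemma countable_dense_continuous_functions:
  fixes S :: "'a::metric_space set"
  assumes S: "compact S"
  obtains D :: "('a \<Rightarrow> real) set" where "countable D" "\<And>g. g \<in> D \<Longrightarrow> continuous_on S g"
    "\<And>f e. continuous_on S f \<Longrightarrow> e > 0 \<Longrightarrow> \<exists>g\<in>D. \<forall>x\<in>S. \<bar>f x - g x\<bar> \<le> e"
proof -
  \<comment> \<open>All properties of the partition are packed into one predicate, so that a single
    choice over k yields the whole sequence.\<close>
  define Q where "Q k p \<longleftrightarrow> finite (fst p) \<and> fst p \<subseteq> S \<and>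
      (\<forall>y. continuous_on S (snd p y :: 'a \<Rightarrow> real)) \<and>
      (\<forall>x\<in>S. \<forall>y. 0 \<le> snd p y x) \<and> (\<forall>x\<in>S. (\<Sum>y\<in>fst p. snd p y x) = 1) \<and>
      (\<forall>x\<in>S. \<forall>y. snd p y x \<noteq> 0 \<longrightarrow> dist x y < inverse (real (Suc k)))" for k p
  have "\<exists>p. Q k p" for k
  proof -
    have "inverse (real (Suc k)) > 0" by simp
    from compact_partition_of_unity[OF S this] obtain Y and \<phi> :: "'a \<Rightarrow> 'a \<Rightarrow> real" where P:
      "finite Y" "Y \<subseteq> S" "\<And>y. continuous_on S (\<phi> y)" "\<And>x y. x \<in> S \<Longrightarrow> 0 \<le> \<phi> y x"
      "\<And>x. x \<in> S \<Longrightarrow> (\<Sum>y\<in>Y. \<phi> y x) = 1"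
      "\<And>x y. x \<in> S \<Longrightarrow> \<phi> y x \<noteq> 0 \<Longrightarrow> dist x y < inverse (real (Suc k))"
      by blast
    then have "Q k (Y, \<phi>)" unfolding Q_def by simp
    then show ?thesis ..
  qed
  then obtain p where p: "\<And>k. Q k (p k)" by metis
  define Y where "Y k = fst (p k)" for k
  define \<phi> where "\<phi> k = snd (p k)" for k
  have P: "finite (Y k)" "Y k \<subseteq> S" "continuous_on S (\<phi> k y)"
    "x \<in> S \<Longrightarrow> 0 \<le> \<phi> k y x" "x \<in> S \<Longrightarrow> (\<Sum>y\<in>Y k. \<phi> k y x) = 1"
    "x \<in> S \<Longrightarrow> \<phi> k y x \<noteq> 0 \<Longrightarrow> dist x y < inverse (real (Suc k))" for k x y
    using p[of k] unfolding Q_def Y_def \<phi>_def by blast+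
  \<comment> \<open>Extensional functions on a finite net with rational values form a countable set;
    hence the \<open>restrict\<close> below.\<close>
  define D where "D = (\<Union>k. (\<lambda>r x. \<Sum>y\<in>Y k. \<phi> k y x * r y) ` (Y k \<rightarrow>\<^sub>E \<rat>))"
  show ?thesis
  proof (rule that[of D])
    show "countable D"
      unfolding D_def using P(1) by (intro countable_UN countable_image countable_PiE countable_rat) auto
    show "continuous_on S g" if "g \<in> D" for g
      using that P(3) unfolding D_def by (auto intro!: continuous_intros)
    fix f :: "'a \<Rightarrow> real" and e :: real
    assume f: "continuous_on S f" and e: "e > 0"
    have "uniformly_continuous_on S f"
      using S f by (rule compact_uniformly_continuous[rotated])
    then obtain d where d: "d > 0"
      "\<And>p r. p \<in> S \<Longrightarrow> r \<in> S \<Longrightarrow> dist r p < d \<Longrightarrow> dist (f r) (f p) < e / 2"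
      using half_gt_zero[OF e] by (rule uniformly_continuous_onE) blast
    obtain k where k: "inverse (real (Suc k)) < d"
      using reals_Archimedean[OF d(1)] by auto
    have "\<exists>r\<in>\<rat>. \<bar>f y - r\<bar> < e / 2" for y
    proof -
      obtain r where "r \<in> \<rat>" "f y - e / 2 < r" "r < f y"
        using Rats_dense_in_real[of "f y - e / 2" "f y"] e by auto
      then show ?thesis by (intro bexI[of _ r]) auto
    qed
    then obtain r where r: "\<And>y. r y \<in> \<rat>" "\<And>y. \<bar>f y - r y\<bar> < e / 2" by metis
    let ?g = "\<lambda>x. \<Sum>y\<in>Y k. \<phi> k y x * restrict r (Y k) y"
    have "?g \<in> D"
    proof -
      have "restrict r (Y k) \<in> Y k \<rightarrow>\<^sub>E \<rat>" using r(1) by auto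
      then show ?thesis unfolding D_def by blast
    qed
    moreover have "\<bar>f x - ?g x\<bar> \<le> e" if x: "x \<in> S" for x
    proof (rule partition_of_unity_average)
      fix y assume y: "y \<in> Y k" "\<phi> k y x \<noteq> 0"
      have "y \<in> S" by (rule subsetD[OF P(2) y(1)])
      moreover have "dist x y < d" using P(6)[OF x y(2)] k by (rule less_trans)
      ultimately have "dist (f x) (f y) < e / 2" by (intro d(2)[OF _ x])
      then have "\<bar>f x - f y\<bar> + \<bar>f y - r y\<bar> < e / 2 + e / 2"
        unfolding dist_real_def by (rule add_strict_mono[OF _ r(2)])
      moreover have "\<bar>f x - r y\<bar> \<le> \<bar>f x - f y\<bar> + \<bar>f y - r y\<bar>"
        by (rule order_trans[OF _ abs_triangle_ineq]) simp
      ultimately have "\<bar>f x - r y\<bar> \<le> e" by simp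
      then show "\<bar>f x - restrict r (Y k) y\<bar> \<le> e" using y(1) by simp
    qed (rule P(1) P(4)[OF x] P(5)[OF x])+
    ultimately show "\<exists>g\<in>D. \<forall>x\<in>S. \<bar>f x - g x\<bar> \<le> e"
      by (intro bexI[of _ ?g] ballI)
  qed
qed

section \<open>Continuous functions as tests for finite measures and their density in L1\<close>

lemma indicator_open_limit_continuous:
  fixes U :: "'a::metric_space set"
  assumes "open U"
  obtains f :: "nat \<Rightarrow> 'a \<Rightarrow> real" where "\<And>k. continuous_on UNIV (f k)"
    "\<And>k x. 0 \<le> f k x" "\<And>k x. f k x \<le> 1" "\<And>x. (\<lambda>k. f k x) \<longlonglongrightarrow> indicator U x"
\<comment> \<open>\<open>infdist\<close> to the empty set is 0, so the formula of the second case
  would produce 0 instead of 1 on the whole space.\<close>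
proof (cases "U = UNIV")
  case True
  show ?thesis by (rule that[of "\<lambda>_ _. 1"]) (auto simp: True)
next
  case False
  define f where "f k x = min 1 (real k * infdist x (- U))" for k x
  show ?thesis
  proof (rule that[of f])
    show "continuous_on UNIV (f k)" for k unfolding f_def by (intro continuous_intros)
    show "0 \<le> f k x" "f k x \<le> 1" for k x by (auto simp: f_def infdist_nonneg)
    show "(\<lambda>k. f k x) \<longlonglongrightarrow> indicator U x" for x
    proof (cases "x \<in> U")
      case True
      have "infdist x (- U) > 0"
        using True False assms by (intro infdist_pos_not_in_closed) auto
      then obtain n where n: "1 \<le> real n * infdist x (- U)"
        by (metis ex_less_of_nat_mult less_imp_le)
      have "\<forall>\<^sub>F k in sequentially. f k x = 1"
        using eventually_ge_at_top[of n]
      proof eventually_elim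
        case (elim k)
        have "real n * infdist x (- U) \<le> real k * infdist x (- U)"
          using elim by (intro mult_right_mono) (auto simp: infdist_nonneg)
        then show ?case using n by (simp add: f_def)
      qed
      then show ?thesis using True by (simp add: tendsto_eventually)
    next
      case False
      then show ?thesis by (simp add: f_def)
    qed
  qed
qed

lemma integrable_continuous_compact_UNIV:
  fixes f :: "'a::metric_space \<Rightarrow> real"
  assumes "finite_measure M" "sets M = sets borel" "compact (UNIV :: 'a set)" "continuous_on UNIV f"
  shows "integrable M f"
proof -
  have "bounded (range f)"
    using assms by (intro compact_imp_bounded compact_continuous_image)
  then obtain B where "\<And>x. \<bar>f x\<bar> \<le> B" by (auto simp: bounded_iff)
  moreover have "f \<in> borel_measurable M"
    using borel_measurable_continuous_onI[OF assms(4)] assms(2) by (simp cong: measurable_cong_sets)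
  ultimately show ?thesis
    using assms(1) by (intro finite_measure.integrable_const_bound[of _ _ B]) auto
qed

text \<open>Dominated convergence gives equal masses of open sets, and these form an
  intersection-stable generator of the Borel sets.\<close>

lemma finite_measure_eqI_continuous:
  fixes M N :: "'a::metric_space measure"
  assumes M: "finite_measure M" "sets M = sets borel" and N: "finite_measure N" "sets N = sets borel"
    and eq: "\<And>f :: 'a \<Rightarrow> real. continuous_on UNIV f \<Longrightarrow> bounded (range f) \<Longrightarrow> (LINT x|M. f x) = (LINT x|N. f x)"
  shows "M = N"
proof -
  interpret M: finite_measure M by fact
  interpret N: finite_measure N by fact
  have sp: "space M = UNIV" "space N = UNIV"
    using sets_eq_imp_space_eq[OF M(2)] sets_eq_imp_space_eq[OF N(2)] by auto
  have *: "emeasure M U = emeasure N U" if U: "open U" for U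
  proof -
    obtain f :: "nat \<Rightarrow> 'a \<Rightarrow> real" where f: "\<And>k. continuous_on UNIV (f k)"
      "\<And>k x. 0 \<le> f k x" "\<And>k x. f k x \<le> 1" "\<And>x. (\<lambda>k. f k x) \<longlonglongrightarrow> indicator U x"
      using indicator_open_limit_continuous[OF U] by blast
    have m: "f k \<in> borel_measurable borel" for k
      using f(1) by (rule borel_measurable_continuous_onI)
    have "(\<lambda>k. LINT x|M. f k x) \<longlonglongrightarrow> (LINT x|M. indicator U x)"
      using f U m M(2) by (intro integral_dominated_convergence[where w = "\<lambda>_. 1"])
        (auto cong: measurable_cong_sets)
    moreover have "(\<lambda>k. LINT x|N. f k x) \<longlonglongrightarrow> (LINT x|N. indicator U x)"
      using f U m N(2) by (intro integral_dominated_convergence[where w = "\<lambda>_. 1"])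
        (auto cong: measurable_cong_sets)
    moreover have "(LINT x|M. f k x) = (LINT x|N. f k x)" for k
      using f by (intro eq boundedI[where B = 1]) auto
    ultimately have "(LINT x|M. indicator U x :: real) = (LINT x|N. indicator U x)"
      by (simp add: LIMSEQ_unique)
    then show ?thesis
      using U sp by (simp add: M.emeasure_eq_measure N.emeasure_eq_measure)
  qed
  show ?thesis
  proof (rule measure_eqI_generator_eq[where E = "{U. open U}" and \<Omega> = UNIV and A = "\<lambda>_. UNIV"])
    show "Int_stable {U :: 'a set. open U}" by (auto simp: Int_stable_def)
    show "sets M = sigma_sets UNIV {U. open U}" "sets N = sigma_sets UNIV {U. open U}"
      by (simp_all add: M N borel_def)
  qed (use * in \<open>auto simp: M.emeasure_eq_measure\<close>)
qed

text \<open>Dynkin induction from the open sets: the approximable sets are closed under complements,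
  with \<open>1 - f\<close> as approximation, and under countable disjoint unions.\<close>

lemma continuous_L1_dense_indicator:
  fixes M :: "'a::metric_space measure"
  assumes M: "finite_measure M" "sets M = sets borel" and c: "compact (UNIV :: 'a set)"
    and A: "A \<in> sets borel"
  shows "e > 0 \<Longrightarrow> \<exists>f :: 'a \<Rightarrow> real. continuous_on UNIV f \<and> (LINT x|M. \<bar>indicator A x - f x\<bar>) < e"
proof -
  interpret M: finite_measure M by fact
  have sp: "space M = UNIV"
    using sets_eq_imp_space_eq[OF M(2)] by auto
  note int = integrable_continuous_compact_UNIV[OF M c]
  have A': "A \<in> sigma_sets UNIV {U. open U}" using A by (simp add: borel_def)
  have Int: "Int_stable {U :: 'a set. open U}" by (auto simp: Int_stable_def)
  have P: "{U :: 'a set. open U} \<subseteq> Pow UNIV" by simp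
  have sg: "sigma_sets UNIV {U :: 'a set. open U} = sets M" by (simp add: M borel_def)
  show "e > 0 \<Longrightarrow> \<exists>f :: 'a \<Rightarrow> real. continuous_on UNIV f \<and> (LINT x|M. \<bar>indicator A x - f x\<bar>) < e"
    using Int P A'
  proof (induction A arbitrary: e rule: sigma_sets_induct_disjoint)
    case (basic U)
    then have U: "open U" by simp
    obtain f :: "nat \<Rightarrow> 'a \<Rightarrow> real" where f: "\<And>k. continuous_on UNIV (f k)"
      "\<And>k x. 0 \<le> f k x" "\<And>k x. f k x \<le> 1" "\<And>x. (\<lambda>k. f k x) \<longlonglongrightarrow> indicator U x"
      using indicator_open_limit_continuous[OF U] by blast
    have m: "f k \<in> borel_measurable M" for k
      using borel_measurable_continuous_onI[OF f(1)] M by (simp cong: measurable_cong_sets)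
    have "(\<lambda>k. LINT x|M. \<bar>indicator U x - f k x\<bar>) \<longlonglongrightarrow> (LINT x|M. (0::real))"
    proof (rule integral_dominated_convergence[where w = "\<lambda>_. 1"])
      show "(\<lambda>x. \<bar>indicator U x - f k x\<bar>) \<in> borel_measurable M" for k
        using U M(2) by (intro borel_measurable_abs borel_measurable_diff m borel_measurable_indicator) simp
      have "(\<lambda>k. \<bar>indicator U x - f k x\<bar>) \<longlonglongrightarrow> \<bar>indicator U x - indicator U x\<bar>" for x
        using f(4) by (intro tendsto_intros)
      then show "AE x in M. (\<lambda>k. \<bar>indicator U x - f k x\<bar>) \<longlonglongrightarrow> 0" by simp
      show "AE x in M. norm \<bar>indicator U x - f k x\<bar> \<le> 1" for k
      proof (rule AE_I2)
        fix x
        show "norm \<bar>indicator U x - f k x\<bar> \<le> 1"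
          using f(2,3)[of k x] by (cases "x \<in> U") auto
      qed
    qed auto
    then have "\<forall>\<^sub>F k in sequentially. (LINT x|M. \<bar>indicator U x - f k x\<bar>) < e"
      using basic(2) by (intro order_tendstoD(2)[of _ 0]) auto
    then obtain k where "(LINT x|M. \<bar>indicator U x - f k x\<bar>) < e"
      using eventually_happens'[OF sequentially_bot] by blast
    then show ?case using f(1) by blast
  next
    case empty
    then show ?case by (intro exI[of _ "\<lambda>_. 0"]) auto
  next
    case (compl A)
    then obtain f :: "'a \<Rightarrow> real" where "continuous_on UNIV f" "(LINT x|M. \<bar>indicator A x - f x\<bar>) < e"
      by blast
    moreover have "\<bar>indicator (UNIV - A) x - (1 - f x)\<bar> = \<bar>indicator A x - f x\<bar>" for x
      by (auto simp: indicator_def)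
    ultimately show ?case
      by (intro exI[of _ "\<lambda>x. 1 - f x"]) (auto intro!: continuous_intros)
  next
    case (union A)
    have AM: "A i \<in> sets M" for i using union(2) sg by auto
    then have UM: "(\<Union>i\<in>I. A i) \<in> sets M" for I :: "nat set" by auto
    \<comment> \<open>Only the first \<open>n\<close> sets are approximated; the others together
      have mass below \<open>e / 2\<close>.\<close>
    have "(\<lambda>n. \<Sum>i<n. measure M (A i)) \<longlonglongrightarrow> measure M (\<Union>i. A i)"
      using M.finite_measure_UNION[of A] AM union(1) by (simp add: sums_def image_subset_iff)
    then have "\<forall>\<^sub>F n in sequentially. (\<Sum>i<n. measure M (A i)) > measure M (\<Union>i. A i) - e / 2"
      using union(4) by (intro order_tendstoD) auto
    then obtain n where n: "(\<Sum>i<n. measure M (A i)) > measure M (\<Union>i. A i) - e / 2"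
      using eventually_happens'[OF sequentially_bot] by blast
    \<comment> \<open>The \<open>n\<close> errors add up to at most \<open>e / 2\<close>;
      \<open>Suc\<close> keeps the denominator positive when \<open>n\<close> is 0.\<close>
    have "\<forall>i. \<exists>f :: 'a \<Rightarrow> real. continuous_on UNIV f \<and>
        (LINT x|M. \<bar>indicator (A i) x - f x\<bar>) < e / (2 * real (Suc n))"
      using union(3,4) by auto
    then obtain f :: "nat \<Rightarrow> 'a \<Rightarrow> real" where f: "\<And>i. continuous_on UNIV (f i)"
      "\<And>i. (LINT x|M. \<bar>indicator (A i) x - f i x\<bar>) < e / (2 * real (Suc n))" by metis
    let ?g = "\<lambda>x. \<Sum>i<n. f i x"
    let ?R = "(\<Union>i. A i) - (\<Union>i<n. A i)"
    have i1: "integrable M (\<lambda>x. \<bar>indicator (A i) x - f i x\<bar>)" for i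
      using int[OF f(1)] AM by (auto simp: M.emeasure_eq_measure)
    have g: "continuous_on UNIV ?g" using f(1) by (intro continuous_intros)
    have le: "\<bar>indicator (\<Union>i. A i) x - ?g x\<bar> \<le>
        indicator ?R x + (\<Sum>i<n. \<bar>indicator (A i) x - f i x\<bar>)" for x
    proof -
      have "indicator (\<Union>i<n. A i) x = (\<Sum>i<n. indicator (A i) x :: real)"
        using union(1) by (intro indicator_UN_disjoint) (auto intro: disjoint_family_on_mono)
      moreover have "indicator (\<Union>i. A i) x = (indicator ?R x + indicator (\<Union>i<n. A i) x :: real)"
        by (auto simp: indicator_def)
      ultimately have "indicator (\<Union>i. A i) x - ?g x =
          indicator ?R x + (\<Sum>i<n. indicator (A i) x - f i x)"
        by (simp only: sum_subtractf)
      moreover have "\<bar>indicator ?R x + (\<Sum>i<n. indicator (A i) x - f i x)\<bar> \<le>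
          indicator ?R x + \<bar>\<Sum>i<n. indicator (A i) x - f i x\<bar>"
        by (cases "x \<in> ?R") simp_all
      ultimately show ?thesis
        using sum_abs[of "\<lambda>i. indicator (A i) x - f i x" "{..<n}"] by linarith
    qed
    have "(LINT x|M. \<bar>indicator (\<Union>i. A i) x - ?g x\<bar>) \<le>
        (LINT x|M. indicator ?R x + (\<Sum>i<n. \<bar>indicator (A i) x - f i x\<bar>))"
      using le i1 int[OF g] UM UM[of UNIV]
      by (intro integral_mono) (auto simp: M.emeasure_eq_measure)
    also have "\<dots> = measure M ?R + (\<Sum>i<n. LINT x|M. \<bar>indicator (A i) x - f i x\<bar>)"
    proof -
      have "?R \<in> sets M" using UM[of UNIV] UM by auto
      then show ?thesis
        using i1 by (subst Bochner_Integration.integral_add)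
          (auto simp: M.emeasure_eq_measure sp intro!: Bochner_Integration.integral_sum)
    qed
    also have "measure M ?R = measure M (\<Union>i. A i) - measure M (\<Union>i<n. A i)"
      using UM[of UNIV] UM by (intro M.finite_measure_Diff) auto
    also have "measure M (\<Union>i<n. A i) = (\<Sum>i<n. measure M (A i))"
      using union(1) AM by (intro M.finite_measure_finite_Union) (auto intro: disjoint_family_on_mono)
    also have "(\<Sum>i<n. LINT x|M. \<bar>indicator (A i) x - f i x\<bar>) \<le> (\<Sum>i<n. e / (2 * real (Suc n)))"
      using f(2) by (intro sum_mono less_imp_le)
    also have "\<dots> \<le> e / 2" using union(4) by (simp add: field_simps)
    finally have "(LINT x|M. \<bar>indicator (\<Union>i. A i) x - ?g x\<bar>) < e"
      using n by simp
    then show ?case using g by blast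
  qed
qed

lemma continuous_L1_dense:
  fixes M :: "'a::metric_space measure" and f :: "'a \<Rightarrow> real"
  assumes M: "finite_measure M" "sets M = sets borel" and c: "compact (UNIV :: 'a set)"
    and f: "integrable M f" and e: "e > 0"
  shows "\<exists>g. continuous_on UNIV g \<and> (LINT x|M. \<bar>f x - g x\<bar>) < e"
  using f e
proof (induction arbitrary: e rule: integrable_induct)
  case (base A c)
  \<comment> \<open>The summand 1 keeps the denominator positive when the scalar is 0.\<close>
  obtain g :: "'a \<Rightarrow> real" where g: "continuous_on UNIV g" "(LINT x|M. \<bar>indicator A x - g x\<bar>) < e / (\<bar>c\<bar> + 1)"
    using continuous_L1_dense_indicator[OF M assms(3), of A "e / (\<bar>c\<bar> + 1)"] base M by auto
  have "(LINT x|M. \<bar>indicator A x *\<^sub>R c - g x * c\<bar>) = (LINT x|M. \<bar>indicator A x - g x\<bar> * \<bar>c\<bar>)"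
    by (intro Bochner_Integration.integral_cong) (auto simp: abs_mult[symmetric] algebra_simps)
  also have "\<dots> = (LINT x|M. \<bar>indicator A x - g x\<bar>) * \<bar>c\<bar>" by simp
  also have "\<dots> \<le> (LINT x|M. \<bar>indicator A x - g x\<bar>) * (\<bar>c\<bar> + 1)"
    by (intro mult_left_mono) auto
  also have "\<dots> < e" using g(2) by (simp add: field_simps)
  finally show ?case
    using g(1) by (intro exI[of _ "\<lambda>x. g x * c"]) (auto intro!: continuous_intros)
next
  case (add f h)
  obtain g1 where g1: "continuous_on UNIV g1" "(LINT x|M. \<bar>f x - g1 x\<bar>) < e / 2"
    using add.IH(1)[of "e / 2"] add.prems by auto
  obtain g2 where g2: "continuous_on UNIV g2" "(LINT x|M. \<bar>h x - g2 x\<bar>) < e / 2"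
    using add.IH(2)[of "e / 2"] add.prems by auto
  note int = integrable_continuous_compact_UNIV[OF M c]
  have "(LINT x|M. \<bar>f x + h x - (g1 x + g2 x)\<bar>) \<le> (LINT x|M. \<bar>f x - g1 x\<bar> + \<bar>h x - g2 x\<bar>)"
    using add.hyps int[OF g1(1)] int[OF g2(1)] by (intro integral_mono) auto
  also have "\<dots> = (LINT x|M. \<bar>f x - g1 x\<bar>) + (LINT x|M. \<bar>h x - g2 x\<bar>)"
    using add.hyps int[OF g1(1)] int[OF g2(1)] by (intro Bochner_Integration.integral_add) auto
  also have "\<dots> < e" using g1 g2 by simp
  finally show ?case
    using g1 g2 by (intro exI[of _ "\<lambda>x. g1 x + g2 x"]) (auto intro!: continuous_intros)
next
  case (lim f s)
  note int = integrable_continuous_compact_UNIV[OF M c]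
  have "(\<lambda>i. LINT x|M. \<bar>f x - s i x\<bar>) \<longlonglongrightarrow> (LINT x|M. (0::real))"
  \<comment> \<open>The approximants satisfy \<open>norm (s i x) \<le> 2 * norm (f x)\<close>,
    whence the factor 3.\<close>
  proof (rule integral_dominated_convergence[where w = "\<lambda>x. 3 * \<bar>f x\<bar>"])
    show "AE x in M. (\<lambda>i. \<bar>f x - s i x\<bar>) \<longlonglongrightarrow> 0"
    proof (rule AE_I2)
      fix x assume "x \<in> space M"
      then have "(\<lambda>i. \<bar>f x - s i x\<bar>) \<longlonglongrightarrow> \<bar>f x - f x\<bar>"
        using lim.hyps by (intro tendsto_intros) auto
      then show "(\<lambda>i. \<bar>f x - s i x\<bar>) \<longlonglongrightarrow> 0" by simp
    qed
    show "AE x in M. norm \<bar>f x - s i x\<bar> \<le> 3 * \<bar>f x\<bar>" for i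
    proof (rule AE_I2)
      fix x assume "x \<in> space M"
      then have "norm (s i x) \<le> 2 * norm (f x)" using lim.hyps by blast
      then show "norm \<bar>f x - s i x\<bar> \<le> 3 * \<bar>f x\<bar>" by simp
    qed
    show "integrable M (\<lambda>x. 3 * \<bar>f x\<bar>)" using lim.hyps by auto
    show "(\<lambda>x. \<bar>f x - s i x\<bar>) \<in> borel_measurable M" for i
      using lim.hyps by (intro borel_measurable_abs borel_measurable_diff borel_measurable_integrable) auto
  qed auto
  then have "\<forall>\<^sub>F i in sequentially. (LINT x|M. \<bar>f x - s i x\<bar>) < e / 2"
    using lim.prems by (intro order_tendstoD(2)[of _ 0]) auto
  then obtain i where i: "(LINT x|M. \<bar>f x - s i x\<bar>) < e / 2"
    using eventually_happens'[OF sequentially_bot] by blast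
  obtain g where g: "continuous_on UNIV g" "(LINT x|M. \<bar>s i x - g x\<bar>) < e / 2"
    using lim.IH[of "e / 2" i] lim.prems by auto
  have "(LINT x|M. \<bar>f x - g x\<bar>) \<le> (LINT x|M. \<bar>f x - s i x\<bar> + \<bar>s i x - g x\<bar>)"
    using lim.hyps int[OF g(1)] by (intro integral_mono) auto
  also have "\<dots> = (LINT x|M. \<bar>f x - s i x\<bar>) + (LINT x|M. \<bar>s i x - g x\<bar>)"
    using lim.hyps int[OF g(1)] by (intro Bochner_Integration.integral_add) auto
  also have "\<dots> < e" using i g by simp
  finally show ?case using g by blast
qed

section \<open>Weak sequential compactness along a space-filling curve\<close>

text \<open>A clipped cosine in place of the usual piecewise linear function: continuity and period
  2 come from the cosine, and the value 1/2 of the cosine at 60 degrees puts the plateaus exactly on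
  [0, 1/3] and [2/3, 1].\<close>

definition schoenberg_tooth :: "real \<Rightarrow> real" where
  "schoenberg_tooth t = max 0 (min 1 (1 / 2 - cos (pi * t)))"

lemma schoenberg_tooth_bounds: "0 \<le> schoenberg_tooth t" "schoenberg_tooth t \<le> 1"
  by (auto simp: schoenberg_tooth_def)

lemma schoenberg_tooth_periodic: "schoenberg_tooth (2 * of_int m + t) = schoenberg_tooth t"
proof -
  have "pi * (2 * of_int m + t) = 2 * pi * of_int m + pi * t" by (simp add: algebra_simps)
  then show ?thesis
    unfolding schoenberg_tooth_def by (simp only: cos_add sin_int_2pin cos_int_2pin mult_zero_left mult_1_left diff_zero)
qed

lemma schoenberg_tooth_low: "0 \<le> t \<Longrightarrow> t \<le> 1 / 3 \<Longrightarrow> schoenberg_tooth t = 0"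
proof -
  assume t: "0 \<le> t" "t \<le> 1 / 3"
  have "pi * t \<le> pi * (1 / 3)" using t by (intro mult_left_mono) auto
  then have "cos (pi / 3) \<le> cos (pi * t)"
    using t by (intro cos_monotone_0_pi_le) auto
  then show ?thesis by (simp add: schoenberg_tooth_def cos_60)
qed

lemma schoenberg_tooth_high: "2 / 3 \<le> t \<Longrightarrow> t \<le> 1 \<Longrightarrow> schoenberg_tooth t = 1"
proof -
  assume t: "2 / 3 \<le> t" "t \<le> 1"
  have "pi * (1 - t) \<le> pi * (1 / 3)" using t by (intro mult_left_mono) auto
  then have "cos (pi / 3) \<le> cos (pi * (1 - t))"
    using t by (intro cos_monotone_0_pi_le) auto
  moreover have "cos (pi * (1 - t)) = - cos (pi * t)"
    by (simp add: right_diff_distrib cos_diff)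
  ultimately show ?thesis by (simp add: schoenberg_tooth_def cos_60)
qed

lemma ternary_summable:
  assumes "\<And>j. b j \<in> {0, 1 :: real}"
  shows "summable (\<lambda>j. 2 * b j / 3 ^ Suc j)"
proof (rule summable_comparison_test')
  show "summable (\<lambda>j. (1 / 3 :: real) ^ j)" by (rule summable_geometric) simp
  show "norm (2 * b j / 3 ^ Suc j) \<le> (1 / 3) ^ j" if "0 \<le> j" for j
    using assms[of j] by (auto simp: power_one_over field_simps)
qed

lemma ternary_tail_bounds:
  assumes b: "\<And>j. b j \<in> {0, 1 :: real}"
  shows "0 \<le> (\<Sum>j. 2 * b (j + k) / 3 ^ Suc (j + k))" "(\<Sum>j. 2 * b (j + k) / 3 ^ Suc (j + k)) \<le> 1 / 3 ^ k"
proof -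
  have pos: "0 \<le> b j" for j using b[of j] by auto
  have s: "summable (\<lambda>j. 2 * b (j + k) / 3 ^ Suc (j + k))"
    using ternary_summable[OF b] by (subst summable_iff_shift)
  show "0 \<le> (\<Sum>j. 2 * b (j + k) / 3 ^ Suc (j + k))"
    by (intro suminf_nonneg s) (simp add: pos)
  have g: "(\<lambda>j. 2 / (3 * 3 ^ k) * (1 / 3 :: real) ^ j) sums (2 / (3 * 3 ^ k) * (1 / (1 - 1 / 3)))"
    by (intro sums_mult geometric_sums) simp
  have "(\<Sum>j. 2 * b (j + k) / 3 ^ Suc (j + k)) \<le> (\<Sum>j. 2 / (3 * 3 ^ k) * (1 / 3 :: real) ^ j)"
  proof (rule suminf_le[OF _ s sums_summable[OF g]])
    fix j show "2 * b (j + k) / 3 ^ Suc (j + k) \<le> 2 / (3 * 3 ^ k) * (1 / 3) ^ j"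
      using b[of "j + k"] by (auto simp: power_add power_one_over field_simps)
  qed
  also have "\<dots> = 1 / 3 ^ k" using sums_unique[OF g] by simp
  finally show "(\<Sum>j. 2 * b (j + k) / 3 ^ Suc (j + k)) \<le> 1 / 3 ^ k" .
qed

text \<open>Multiplication by \<open>3 ^ k\<close> turns the digits before position k into an even
  integer, which the period 2 absorbs. What remains is \<open>2 * b k / 3\<close> plus a tail
  between 0 and 1/3, so it lies on the plateau with value \<open>b k\<close>.\<close>

lemma schoenberg_tooth_digit:
  assumes b: "\<And>j. b j \<in> {0, 1 :: real}"
  shows "schoenberg_tooth (3 ^ k * (\<Sum>j. 2 * b j / 3 ^ Suc j)) = b k"
proof -
  define r where "r = 3 ^ k * (\<Sum>j. 2 * b (j + Suc k) / 3 ^ Suc (j + Suc k))"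
  have r: "0 \<le> r" "r \<le> 1 / 3"
  proof -
    show "0 \<le> r" unfolding r_def by (intro mult_nonneg_nonneg ternary_tail_bounds(1)[OF b]) auto
    have "r \<le> 3 ^ k * (1 / 3 ^ Suc k)"
      unfolding r_def by (intro mult_left_mono ternary_tail_bounds(2)[OF b]) auto
    then show "r \<le> 1 / 3" by simp
  qed
  have "3 ^ k * (\<Sum>j<k. 2 * b j / 3 ^ Suc j) = 2 * (\<Sum>j<k. b j * 3 ^ (k - Suc j))"
    unfolding sum_distrib_left
    by (intro sum.cong) (auto simp: power_diff field_simps)
  moreover have "(\<Sum>j<k. b j * 3 ^ (k - Suc j)) \<in> \<int>"
  proof (intro Ints_sum Ints_mult)
    show "b j \<in> \<int>" for j using b[of j] by auto
  qed auto
  then obtain m where "(\<Sum>j<k. b j * 3 ^ (k - Suc j)) = of_int m" by (elim Ints_cases)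
  ultimately have m: "3 ^ k * (\<Sum>j<k. 2 * b j / 3 ^ Suc j) = 2 * of_int m" by simp
  have "(\<Sum>j. 2 * b j / 3 ^ Suc j) =
      (\<Sum>j. 2 * b (j + Suc k) / 3 ^ Suc (j + Suc k)) + (\<Sum>j<Suc k. 2 * b j / 3 ^ Suc j)"
    by (rule suminf_split_initial_segment[OF ternary_summable[OF b]])
  then have "3 ^ k * (\<Sum>j. 2 * b j / 3 ^ Suc j) =
      r + (3 ^ k * (\<Sum>j<k. 2 * b j / 3 ^ Suc j) + 3 ^ k * (2 * b k / 3 ^ Suc k))"
    by (simp only: r_def distrib_left sum.lessThan_Suc)
  also have "\<dots> = 2 * of_int m + (2 * b k / 3 + r)" unfolding m by simp
  finally have "3 ^ k * (\<Sum>j. 2 * b j / 3 ^ Suc j) = 2 * of_int m + (2 * b k / 3 + r)" .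
  moreover have "schoenberg_tooth (2 * b k / 3 + r) = b k"
    using b[of k] r by (auto intro!: schoenberg_tooth_low schoenberg_tooth_high)
  ultimately show ?thesis by (simp only: schoenberg_tooth_periodic)
qed

text \<open>For x in [0, 1) the two floors are the integers formed by the first k+1 and the first k
  binary digits of x.\<close>

definition binary_digit :: "real \<Rightarrow> nat \<Rightarrow> real" where
  "binary_digit x k = of_int (\<lfloor>2 ^ Suc k * x\<rfloor> - 2 * \<lfloor>2 ^ k * x\<rfloor>)"

lemma binary_digit_range: "binary_digit x k \<in> {0, 1}"
proof -
  have "2 ^ Suc k * x = 2 * (2 ^ k * x)" by simp
  then have "\<lfloor>2 ^ Suc k * x\<rfloor> - 2 * \<lfloor>2 ^ k * x\<rfloor> = 0 \<or> \<lfloor>2 ^ Suc k * x\<rfloor> - 2 * \<lfloor>2 ^ k * x\<rfloor> = 1"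
    by linarith
  then show ?thesis unfolding binary_digit_def by auto
qed

text \<open>The partial sums telescope to the truncations
  \<open>of_int \<lfloor>2 ^ n * x\<rfloor> / 2 ^ n\<close>.\<close>

lemma binary_digits_sums:
  assumes "0 \<le> x" "x < 1"
  shows "(\<lambda>k. binary_digit x k / 2 ^ Suc k) sums x"
proof -
  have eq: "(\<Sum>k<n. binary_digit x k / 2 ^ Suc k) = of_int \<lfloor>2 ^ n * x\<rfloor> / 2 ^ n" for n
  proof (induction n)
    case 0
    have "\<lfloor>x\<rfloor> = 0" using assms by (simp add: floor_eq_iff)
    then show ?case by simp
  next
    case (Suc n)
    have "binary_digit x n / 2 ^ Suc n =
        of_int \<lfloor>2 ^ Suc n * x\<rfloor> / 2 ^ Suc n - of_int \<lfloor>2 ^ n * x\<rfloor> / 2 ^ n"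
      unfolding binary_digit_def by (simp add: diff_divide_distrib)
    with Suc show ?case by (simp only: sum.lessThan_Suc)
  qed
  have "(\<lambda>n. of_int \<lfloor>2 ^ n * x\<rfloor> / 2 ^ n) \<longlonglongrightarrow> x"
  proof (rule tendsto_sandwich)
    have "x - (1 / 2) ^ n \<le> of_int \<lfloor>2 ^ n * x\<rfloor> / 2 ^ n" for n
    proof -
      have "2 ^ n * x - 1 \<le> of_int \<lfloor>2 ^ n * x\<rfloor>" by linarith
      then have "(2 ^ n * x - 1) / 2 ^ n \<le> of_int \<lfloor>2 ^ n * x\<rfloor> / 2 ^ n"
        by (intro divide_right_mono) auto
      then show ?thesis by (simp add: diff_divide_distrib power_one_over)
    qed
    then show "\<forall>\<^sub>F n in sequentially. x - (1 / 2) ^ n \<le> of_int \<lfloor>2 ^ n * x\<rfloor> / 2 ^ n"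
      by (intro always_eventually allI)
    have "of_int \<lfloor>2 ^ n * x\<rfloor> / 2 ^ n \<le> x" for n
      using of_int_floor_le[of "2 ^ n * x"] by (simp add: divide_le_eq mult.commute)
    then show "\<forall>\<^sub>F n in sequentially. of_int \<lfloor>2 ^ n * x\<rfloor> / 2 ^ n \<le> x"
      by (intro always_eventually allI)
    have "(\<lambda>n. x - (1 / 2) ^ n) \<longlonglongrightarrow> x - 0"
      by (intro tendsto_diff tendsto_const LIMSEQ_power_zero) simp
    then show "(\<lambda>n. x - (1 / 2) ^ n) \<longlonglongrightarrow> x" by simp
    show "(\<lambda>_. x) \<longlonglongrightarrow> x" by simp
  qed
  then show ?thesis unfolding sums_def eq .
qed

text \<open>Schoenberg's space-filling curve: the ternary digits of the parameter, all 0 or 2, list the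
  binary digits of all coordinates, interleaved by a pairing function.\<close>

lemma torus_space_filling_curve:
  obtains \<psi> :: "real \<Rightarrow> 'd::finite torus" where "continuous_on UNIV \<psi>" "\<And>u. \<exists>t\<in>{0..1}. \<psi> t = u"
proof -
  obtain e :: "'d \<Rightarrow> nat" where e: "inj e"
    using finite_imp_inj_to_nat_seg[of "UNIV :: 'd set"] by auto
  define S where "S i t = (\<Sum>k. schoenberg_tooth (3 ^ prod_encode (k, e i) * t) / 2 ^ Suc k)" for i t
  have cont: "continuous_on UNIV (S i)" for i
  proof (rule uniform_limit_theorem)
    show "uniform_limit UNIV (\<lambda>n t. \<Sum>k<n. schoenberg_tooth (3 ^ prod_encode (k, e i) * t) / 2 ^ Suc k)
        (S i) sequentially"
      unfolding S_def
    proof (rule Weierstrass_m_test)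
      show "summable (\<lambda>k. (1 / 2 :: real) ^ k)" by (rule summable_geometric) simp
      show "norm (schoenberg_tooth (3 ^ prod_encode (k, e i) * t) / 2 ^ Suc k) \<le> (1 / 2) ^ k" for k t
        using schoenberg_tooth_bounds[of "3 ^ prod_encode (k, e i) * t"]
        by (simp add: power_one_over field_simps)
    qed
    show "\<forall>\<^sub>F n in sequentially. continuous_on UNIV
        (\<lambda>t. \<Sum>k<n. schoenberg_tooth (3 ^ prod_encode (k, e i) * t) / 2 ^ Suc k)"
      unfolding schoenberg_tooth_def by (intro always_eventually allI continuous_intros) auto
  qed simp
  show ?thesis
  proof (rule that[of "\<lambda>t. to_torus (\<chi> i. S i t)"])
    show "continuous_on UNIV (\<lambda>t. to_torus (\<chi> i. S i t))"
      by (rule continuous_on_compose2[OF continuous_on_to_torus[of UNIV]])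
        (auto intro!: continuous_intros cont)
    show "\<exists>t\<in>{0..1}. to_torus (\<chi> i. S i t) = u" for u
    proof -
      obtain x where x: "to_torus x = u" "\<And>i. 0 \<le> x $ i" "\<And>i. x $ i < 1"
        using to_torus_fundamental_domain[of u] by blast
      \<comment> \<open>At positions whose second component is no code of a coordinate,
        \<open>inv e\<close> takes an arbitrary value. The digit is still 0 or 1 there, and no
        coordinate reads it.\<close>
      define b where "b j = (case prod_decode j of (k, i) \<Rightarrow> binary_digit (x $ inv e i) k)" for j
      have b: "b j \<in> {0, 1}" for j
        unfolding b_def using binary_digit_range by (auto split: prod.split)
      let ?t = "\<Sum>j. 2 * b j / 3 ^ Suc j"
      have "S i ?t = x $ i" for i
      proof -
        have "S i ?t = (\<Sum>k. binary_digit (x $ i) k / 2 ^ Suc k)"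
          unfolding S_def schoenberg_tooth_digit[OF b] by (simp add: b_def inv_f_f[OF e])
        then show ?thesis
          using sums_unique[OF binary_digits_sums[OF x(2,3)]] by simp
      qed
      then have "to_torus (\<chi> i. S i ?t) = u"
        using x(1) by simp
      moreover have "?t \<in> {0..1}"
        using ternary_tail_bounds[OF b, where k = 0] by simp
      ultimately show ?thesis by blast
    qed
  qed
qed

text \<open>One copy of the torus curve for each colour, on the intervals from 2a to 2a+1. The gaps
  between the intervals allow the colour to jump without breaking continuity on
  \<open>K\<close>.\<close>

lemma coloured_torus_curve:
  obtains K :: "real set" and \<Psi> :: "real \<Rightarrow> 'd::finite torus \<times> nat" where
    "compact K" "continuous_on K \<Psi>" "\<Psi> ` K = UNIV \<times> {1..q}"
proof -
  obtain \<psi> :: "real \<Rightarrow> 'd torus" where \<psi>: "continuous_on UNIV \<psi>" "\<And>u. \<exists>t\<in>{0..1}. \<psi> t = u"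
    using torus_space_filling_curve by blast
  \<comment> \<open>The colour is read off from the interval: half of a parameter in
    \<open>I a\<close> has floor a.\<close>
  define col where "col t = nat \<lfloor>t / 2\<rfloor>" for t :: real
  define \<Psi> where "\<Psi> t = (\<psi> (t - 2 * real (col t)), col t)" for t
  define I where "I a = {2 * real a..2 * real a + 1}" for a :: nat
  have col: "col t = a" if "t \<in> I a" for t a
  proof -
    have "\<lfloor>t / 2\<rfloor> = int a" using that by (auto simp: floor_eq_iff I_def)
    then show ?thesis by (simp add: col_def)
  qed
  have cont: "continuous_on (I a) \<Psi>" for a
  proof -
    have "continuous_on (I a) (\<lambda>t. (\<psi> (t - 2 * real a), a))"
      by (intro continuous_intros continuous_on_compose2[OF \<psi>(1)]) auto
    then show ?thesis
      by (rule continuous_on_eq) (simp add: \<Psi>_def col)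
  qed
  show ?thesis
  proof (rule that[of "\<Union>a\<in>{1..q}. I a" \<Psi>])
    show "compact (\<Union>a\<in>{1..q}. I a)" by (intro compact_UN) (auto simp: I_def)
    show "continuous_on (\<Union>a\<in>{1..q}. I a) \<Psi>"
      using cont by (intro continuous_on_closed_Union) (auto simp: I_def)
    show "\<Psi> ` (\<Union>a\<in>{1..q}. I a) = UNIV \<times> {1..q}"
    proof (intro equalityI subsetI)
      fix z assume "z \<in> \<Psi> ` (\<Union>a\<in>{1..q}. I a)"
      then show "z \<in> UNIV \<times> {1..q}" using col by (auto simp: \<Psi>_def)
    next
      fix z :: "'d torus \<times> nat" assume z: "z \<in> UNIV \<times> {1..q}"
      obtain t where t: "t \<in> {0..1}" "\<psi> t = fst z" using \<psi>(2) by blast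
      have I: "2 * real (snd z) + t \<in> I (snd z)" using t by (auto simp: I_def)
      then have "\<Psi> (2 * real (snd z) + t) = z" using t by (simp add: \<Psi>_def col)
      moreover have "2 * real (snd z) + t \<in> (\<Union>a\<in>{1..q}. I a)" using I z by auto
      ultimately show "z \<in> \<Psi> ` (\<Union>a\<in>{1..q}. I a)" by (metis imageI)
    qed
  qed
qed

text \<open>The measures are pulled back to the compact set \<open>K\<close>, where they are tight,
  and the limit on the line is pushed forward again. The pull-back uses an arbitrary right inverse
  of the curve, which is measurable because every set is measurable for a pmf.\<close>

lemma weak_limit_along_curve:
  fixes \<Psi> :: "real \<Rightarrow> 'z::topological_space" and p :: "nat \<Rightarrow> 'z pmf"
  assumes K: "compact K" and \<Psi>: "continuous_on K \<Psi>" and p: "\<And>k. set_pmf (p k) \<subseteq> \<Psi> ` K"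
  obtains r :: "nat \<Rightarrow> nat" and \<nu> where "strict_mono r" "prob_space \<nu>"
    "sets \<nu> = sets (restrict_space borel (\<Psi> ` K))"
    "\<And>f :: 'z \<Rightarrow> real. continuous_on (\<Psi> ` K) f \<Longrightarrow>
      (\<lambda>k. measure_pmf.expectation (p (r k)) f) \<longlonglongrightarrow> (LINT z|\<nu>. f z)"
proof -
  define \<theta> where "\<theta> z = (SOME t. t \<in> K \<and> \<Psi> t = z)" for z
  have \<theta>: "\<theta> z \<in> K \<and> \<Psi> (\<theta> z) = z" if "z \<in> \<Psi> ` K" for z
    unfolding \<theta>_def by (rule someI_ex) (use that in auto)
  define \<mu> where "\<mu> k = distr (measure_pmf (p k)) borel \<theta>" for k
  have \<mu>_int: "(LINT t|\<mu> k. g t) = measure_pmf.expectation (p k) (\<lambda>z. g (\<theta> z))"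
    if "continuous_on UNIV g" for k and g :: "real \<Rightarrow> real"
    unfolding \<mu>_def using borel_measurable_continuous_onI[OF that] by (intro integral_distr) auto
  have rd: "real_distribution (\<mu> k)" for k
    unfolding real_distribution_def real_distribution_axioms_def \<mu>_def
    by (auto intro!: measure_pmf.prob_space_distr)
  obtain B where B: "\<And>t. t \<in> K \<Longrightarrow> \<bar>t\<bar> \<le> B" "B > 0"
    using compact_imp_bounded[OF K] by (auto simp: bounded_pos)
  have "tight \<mu>"
    unfolding tight_def
  proof (intro conjI allI impI exI)
    show "- B - 1 < B + 1" using B by simp
    fix e :: real and k assume e: "e > 0"
    have "AE z in measure_pmf (p k). \<theta> z \<in> {- B - 1<..B + 1}"
      using p[of k] \<theta> B(1) by (force simp: AE_measure_pmf_iff abs_le_iff)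
    then have "measure (measure_pmf (p k)) (\<theta> -` {- B - 1<..B + 1}) = 1"
      by (intro measure_pmf.prob_eq_1[THEN iffD2]) auto
    then show "1 - e < measure (\<mu> k) {- B - 1<..B + 1}"
      using e by (simp add: \<mu>_def measure_distr)
  qed (rule rd)
  then obtain r M where r: "strict_mono r" and M: "real_distribution M" and wc: "weak_conv_m (\<mu> \<circ> r) M"
    using tight_imp_convergent_subsubsequence[of \<mu> id] by (auto simp: strict_mono_id)
  interpret M: real_distribution M by fact
  have conv: "(\<lambda>k. measure_pmf.expectation (p (r k)) (\<lambda>z. g (\<theta> z))) \<longlonglongrightarrow> (LINT t|M. g t)"
    if g: "continuous_on UNIV g" "\<And>t. \<bar>g t\<bar> \<le> C" for g and C :: real
  proof -
    have "isCont g t" for t using g(1) by (simp add: continuous_on_eq_continuous_at)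
    then have "(\<lambda>k. LINT t|(\<mu> \<circ> r) k. g t) \<longlonglongrightarrow> (LINT t|M. g t)"
      using g(2) rd by (intro weak_conv_imp_integral_bdd_continuous_conv[OF _ M wc]) auto
    then show ?thesis by (simp add: \<mu>_int[OF g(1)])
  qed
  have K': "closed K" "K \<noteq> {}" "K \<in> sets borel"
  proof -
    show "closed K" using K by (rule compact_imp_closed)
    then show "K \<in> sets borel" by simp
    show "K \<noteq> {}" using p[of 0] set_pmf_not_empty[of "p 0"] by auto
  qed
  \<comment> \<open>The truncated distance to \<open>K\<close> is bounded and continuous with
    integral 0 along the sequence, hence also in the limit. As \<open>K\<close> is closed, distance
    0 means membership.\<close>
  have AEK: "AE t in M. t \<in> K"
  proof -
    let ?g = "\<lambda>t. min 1 (infdist t K)"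
    have g: "continuous_on UNIV ?g" by (intro continuous_intros)
    have "measure_pmf.expectation (p (r k)) (\<lambda>z. ?g (\<theta> z)) = 0" for k
    proof -
      have "AE z in measure_pmf (p (r k)). ?g (\<theta> z) = 0"
        using p[of "r k"] \<theta> by (force simp: AE_measure_pmf_iff)
      then show ?thesis by (intro integral_eq_zero_AE)
    qed
    then have "(LINT t|M. ?g t) = 0"
      using conv[OF g, of 1] LIMSEQ_unique[OF tendsto_const] by (force simp: infdist_nonneg)
    moreover have "integrable M ?g"
      using borel_measurable_continuous_onI[OF g]
      by (intro M.integrable_const_bound[of _ 1]) (auto simp: infdist_nonneg)
    ultimately have "AE t in M. ?g t = 0"
      by (subst (asm) integral_nonneg_eq_0_iff_AE) (auto simp: infdist_nonneg)
    then show ?thesis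
    proof eventually_elim
      case (elim t)
      then have "infdist t K = 0" by (auto simp: min_def split: if_splits)
      then show ?case using in_closed_iff_infdist_zero[OF K'(1,2)] by simp
    qed
  qed
  define \<nu> where "\<nu> = distr (restrict_space M K) (restrict_space borel (\<Psi> ` K)) \<Psi>"
  have "emeasure M K = 1"
    using AEK K' by (intro M.emeasure_eq_1_AE) auto
  then have pr: "prob_space (restrict_space M K)"
    using K' by (intro prob_space_restrict_space) auto
  have "\<Psi> \<in> borel_measurable (restrict_space borel K)"
    using \<Psi> by (rule borel_measurable_continuous_on_restrict)
  then have "\<Psi> \<in> borel_measurable (restrict_space M K)"
    by (simp cong: measurable_cong_sets sets_restrict_space_cong)
  then have m: "\<Psi> \<in> restrict_space M K \<rightarrow>\<^sub>M restrict_space borel (\<Psi> ` K)"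
    by (rule measurable_restrict_space2[rotated]) (auto simp: space_restrict_space)
  show ?thesis
  proof (rule that[OF r, of \<nu>])
    show "prob_space \<nu>" unfolding \<nu>_def by (rule prob_space.prob_space_distr[OF pr m])
    show "sets \<nu> = sets (restrict_space borel (\<Psi> ` K))" by (simp add: \<nu>_def)
    fix f :: "'z \<Rightarrow> real" assume f: "continuous_on (\<Psi> ` K) f"
    have "bounded (f ` \<Psi> ` K)"
      using K \<Psi> f by (intro compact_imp_bounded compact_continuous_image)
    then obtain C where C: "C > 0" "\<And>t. t \<in> K \<Longrightarrow> \<bar>f (\<Psi> t)\<bar> \<le> C" by (auto simp: bounded_pos)
    \<comment> \<open>Convergence on the line is tested by bounded functions continuous on the whole
      line; Tietze's theorem extends the composition from \<open>K\<close> with the same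
      bound.\<close>
    have "continuous_on K (\<lambda>t. f (\<Psi> t))"
      using continuous_on_compose[OF \<Psi> f] by (simp add: o_def)
    moreover have "closedin (top_of_set UNIV) K" using K' by simp
    ultimately obtain g where g: "continuous_on UNIV g" "\<And>t. t \<in> K \<Longrightarrow> g t = f (\<Psi> t)" "\<And>t. \<bar>g t\<bar> \<le> C"
      using Tietze[of K "\<lambda>t. f (\<Psi> t)" UNIV C] C by auto
    have "measure_pmf.expectation (p (r k)) (\<lambda>z. g (\<theta> z)) = measure_pmf.expectation (p (r k)) f" for k
      using p[of "r k"] \<theta> g(2) by (intro integral_cong_AE) (force simp: AE_measure_pmf_iff)+
    moreover have "(LINT z|\<nu>. f z) = (LINT t|M. g t)"
    proof -
      have "(LINT z|\<nu>. f z) = (LINT t|restrict_space M K. f (\<Psi> t))"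
        unfolding \<nu>_def using f by (intro integral_distr m borel_measurable_continuous_on_restrict)
      also have "\<dots> = (LINT t|restrict_space M K. g t)"
        using g(2) by (intro Bochner_Integration.integral_cong) (auto simp: space_restrict_space)
      also have "\<dots> = (LINT t|M. indicator K t *\<^sub>R g t)"
        using K' by (intro integral_restrict_space) auto
      also have "\<dots> = (LINT t|M. g t)"
        using AEK K' borel_measurable_continuous_onI[OF g(1)] by (intro integral_cong_AE) auto
      finally show ?thesis .
    qed
    ultimately show "(\<lambda>k. measure_pmf.expectation (p (r k)) f) \<longlonglongrightarrow> (LINT z|\<nu>. f z)"
      using conv[OF g(1,3)] by simp
  qed
qed

section \<open>The weak topology and the interaction\<close>

lemma continuous_map_real_uniform_approx:
  fixes G :: "'a \<Rightarrow> real"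
  assumes "\<And>e. e > 0 \<Longrightarrow> \<exists>h. continuous_map X euclideanreal h \<and> (\<forall>x\<in>topspace X. \<bar>G x - h x\<bar> \<le> e)"
  shows "continuous_map X euclideanreal G"
proof -
  have "\<forall>n. \<exists>h. continuous_map X euclideanreal h \<and> (\<forall>x\<in>topspace X. \<bar>G x - h x\<bar> \<le> inverse (real (Suc n)))"
    using assms by simp
  then obtain h where h: "\<And>n. continuous_map X euclideanreal (h n)"
    "\<And>n x. x \<in> topspace X \<Longrightarrow> \<bar>G x - h n x\<bar> \<le> inverse (real (Suc n))" by metis
  have "continuous_map X Met_TC.mtopology G"
  proof (rule Met_TC.continuous_map_uniform_limit)
    show "\<forall>\<^sub>F n in sequentially. continuous_map X Met_TC.mtopology (h n)"
      using h(1) by simp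
    show "\<forall>\<^sub>F n in sequentially. \<forall>x\<in>topspace X. G x \<in> UNIV \<and> dist (h n x) (G x) < e" if "0 < e" for e
    proof -
      have "\<forall>\<^sub>F n in sequentially. inverse (real (Suc n)) < e"
        using LIMSEQ_inverse_real_of_nat that by (rule order_tendstoD)
      then show ?thesis
      proof eventually_elim
        case (elim n)
        show ?case
        proof
          fix x assume "x \<in> topspace X"
          then have "\<bar>G x - h n x\<bar> < e" using h(2)[of x n] elim by linarith
          then show "G x \<in> UNIV \<and> dist (h n x) (G x) < e" by (simp add: dist_real_def abs_minus_commute)
        qed
      qed
    qed
  qed simp
  then show ?thesis by simp
qed

lemma compact_coloured: "compact (UNIV \<times> {1..q} :: ('d::finite torus \<times> nat) set)"
  by (intro compact_Times compact_UNIV_torus finite_imp_compact) simp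

lemma space_coloured_torus: "space (coloured_torus q) = UNIV \<times> {1..q}"
  by (simp add: coloured_torus_def space_restrict_space)

lemma measurable_coloured_continuous:
  "continuous_on (UNIV \<times> {1..q}) f \<Longrightarrow> f \<in> borel_measurable (coloured_torus q)"
  unfolding coloured_torus_def by (rule borel_measurable_continuous_on_restrict)

lemma continuous_on_coloured_compose_fst:
  "continuous_on UNIV g \<Longrightarrow> continuous_on S (\<lambda>z. g (fst z))"
  by (rule continuous_on_compose2[of UNIV g]) (auto intro: continuous_on_fst continuous_on_id)

lemma continuous_on_coloured_compose_snd:
  "continuous_on S (\<lambda>z :: 'a::topological_space \<times> nat. g (snd z))"
  by (rule continuous_on_compose2[of UNIV g]) (auto intro: continuous_on_snd continuous_on_id)

lemma continuous_on_coloured_slice: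
  "continuous_on (UNIV \<times> {1..q}) f \<Longrightarrow> a \<in> {1..q} \<Longrightarrow> continuous_on UNIV (\<lambda>u. f (u, a))"
  by (rule continuous_on_compose2[of "UNIV \<times> {1..q}" f]) (auto intro!: continuous_intros)

lemma bounded_coloured_continuous:
  fixes f :: "'d::finite torus \<times> nat \<Rightarrow> real"
  assumes "continuous_on (UNIV \<times> {1..q}) f"
  obtains C where "C > 0" "\<And>z. z \<in> UNIV \<times> {1..q} \<Longrightarrow> \<bar>f z\<bar> \<le> C"
proof -
  have "bounded (f ` (UNIV \<times> {1..q}))"
    using assms by (intro compact_imp_bounded compact_continuous_image compact_coloured)
  then show ?thesis using that by (auto simp: bounded_pos)
qed

lemma prob_measuresD:
  assumes "\<nu> \<in> prob_measures (coloured_torus q)"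
  shows "prob_space \<nu>" "sets \<nu> = sets (coloured_torus q)" "space \<nu> = UNIV \<times> {1..q}"
  using assms sets_eq_imp_space_eq[of \<nu> "coloured_torus q"]
  by (auto simp: prob_measures_def space_coloured_torus)

lemma borel_measurable_prob_measures:
  assumes "\<nu> \<in> prob_measures (coloured_torus q)" "continuous_on (UNIV \<times> {1..q}) f"
  shows "f \<in> borel_measurable \<nu>"
  using measurable_coloured_continuous[OF assms(2)] prob_measuresD(2)[OF assms(1)]
  by (simp cong: measurable_cong_sets)

lemma integrable_prob_measures:
  fixes f :: "'d::finite torus \<times> nat \<Rightarrow> real"
  assumes \<nu>: "\<nu> \<in> prob_measures (coloured_torus q)" and f: "continuous_on (UNIV \<times> {1..q}) f"
  shows "integrable \<nu> f"
proof -
  interpret prob_space \<nu> using prob_measuresD(1)[OF \<nu>] .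
  obtain C where "C > 0" "\<And>z. z \<in> UNIV \<times> {1..q} \<Longrightarrow> \<bar>f z\<bar> \<le> C"
    using bounded_coloured_continuous[OF f] by blast
  then show ?thesis
    using borel_measurable_prob_measures[OF \<nu> f] prob_measuresD(3)[OF \<nu>]
    by (intro integrable_const_bound[of _ C]) auto
qed

lemma integral_prob_measures_close:
  fixes f g :: "'d::finite torus \<times> nat \<Rightarrow> real"
  assumes \<nu>: "\<nu> \<in> prob_measures (coloured_torus q)"
    and f: "continuous_on (UNIV \<times> {1..q}) f" and g: "continuous_on (UNIV \<times> {1..q}) g"
    and fg: "\<And>z. z \<in> UNIV \<times> {1..q} \<Longrightarrow> \<bar>f z - g z\<bar> \<le> e"
  shows "\<bar>(LINT z|\<nu>. f z) - (LINT z|\<nu>. g z)\<bar> \<le> e"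
proof -
  interpret prob_space \<nu> using prob_measuresD(1)[OF \<nu>] .
  note int = integrable_prob_measures[OF \<nu>]
  have "\<bar>(LINT z|\<nu>. f z) - (LINT z|\<nu>. g z)\<bar> = \<bar>LINT z|\<nu>. f z - g z\<bar>"
    using int f g by simp
  also have "\<dots> \<le> (LINT z|\<nu>. \<bar>f z - g z\<bar>)" by (rule integral_abs_bound)
  also have "\<dots> \<le> (LINT z|\<nu>. e)"
    using int f g fg prob_measuresD(3)[OF \<nu>] by (intro integral_mono) auto
  finally show ?thesis by (simp add: prob_space)
qed

lemma topspace_weak_topology: "topspace (weak_topology q) = prob_measures (coloured_torus q)"
proof -
  have "prob_measures (coloured_torus q) \<in> {{\<nu> \<in> prob_measures (coloured_torus q :: ('a torus \<times> nat) measure). (LINT z|\<nu>. f z) \<in> U} | f U.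
      continuous_on (UNIV \<times> {1..q}) f \<and> open (U :: real set)}"
    by (rule CollectI, intro exI[of _ "\<lambda>_. 0"] exI[of _ UNIV]) auto
  then show ?thesis
    unfolding weak_topology_def topology_generated_by_topspace by blast
qed

lemma continuous_map_weak_integral:
  assumes "continuous_on (UNIV \<times> {1..q}) f"
  shows "continuous_map (weak_topology q) euclideanreal (\<lambda>\<nu>. LINT z|\<nu>. f z)"
proof -
  have "openin (weak_topology q) {\<nu> \<in> prob_measures (coloured_torus q). (LINT z|\<nu>. f z) \<in> U}" if "open U" for U
    unfolding weak_topology_def using assms that by (intro topology_generated_by_Basis) blast
  then show ?thesis
    by (simp add: continuous_map topspace_weak_topology)
qed

text \<open>Properties of open sets are proved along the generation of the topology, so that only
  subbasic sets, given by one integral, need an analytic argument.\<close>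

lemma weak_topology_generated_induct [consumes 1, case_names empty inter union basic]:
  fixes G :: "('d::finite torus \<times> nat) measure set"
  assumes "openin (weak_topology q) G" "P {}"
    "\<And>A B. openin (weak_topology q) A \<Longrightarrow> openin (weak_topology q) B \<Longrightarrow> P A \<Longrightarrow> P B \<Longrightarrow> P (A \<inter> B)"
    "\<And>\<A>. (\<And>A. A \<in> \<A> \<Longrightarrow> P A) \<Longrightarrow> P (\<Union>\<A>)"
    "\<And>(f :: 'd torus \<times> nat \<Rightarrow> real) U. continuous_on (UNIV \<times> {1..q}) f \<Longrightarrow> open U \<Longrightarrow>
      P {\<nu> \<in> prob_measures (coloured_torus q). (LINT z|\<nu>. f z) \<in> (U :: real set)}"
  shows "P G"
proof -
  let ?S = "{{\<nu> \<in> prob_measures (coloured_torus q). (LINT z|\<nu>. f z) \<in> U} | f U.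
      continuous_on (UNIV \<times> {1..q}) f \<and> open (U :: real set)}"
  have "generate_topology_on ?S G"
    using assms(1) unfolding weak_topology_def by (rule openin_topology_generated_by)
  then have "openin (weak_topology q) G \<and> P G"
  proof induction
    case (UN K)
    then show ?case using assms(4)[of K] by (auto intro: openin_Union)
  next
    case (Basis s)
    then show ?case using assms(5) unfolding weak_topology_def
      by (auto intro!: topology_generated_by_Basis)
  qed (use assms(2,3) in auto)
  then show ?thesis ..
qed

lemma limitin_weak_topology:
  assumes "\<nu> \<in> prob_measures (coloured_torus q)"
    and "\<And>k. \<pi> k \<in> prob_measures (coloured_torus q :: ('d::finite torus \<times> nat) measure)"
    and "\<And>f :: 'd torus \<times> nat \<Rightarrow> real. continuous_on (UNIV \<times> {1..q}) f \<Longrightarrow> (\<lambda>k. LINT z|\<pi> k. f z) \<longlonglongrightarrow> (LINT z|\<nu>. f z)"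
  shows "limitin (weak_topology q) \<pi> \<nu> sequentially"
  unfolding limitin_def topspace_weak_topology
proof (intro conjI allI impI assms(1))
  fix G assume G: "openin (weak_topology q) G \<and> \<nu> \<in> G"
  then have "openin (weak_topology q) G" "\<nu> \<in> G" by auto
  then show "\<forall>\<^sub>F k in sequentially. \<pi> k \<in> G"
  proof (induction rule: weak_topology_generated_induct)
    case (inter A B)
    then show ?case by (auto intro: eventually_conj)
  next
    case (union \<A>)
    then obtain A where A: "A \<in> \<A>" "\<nu> \<in> A" by blast
    with union have "\<forall>\<^sub>F k in sequentially. \<pi> k \<in> A" by blast
    then show ?case using A by (auto elim: eventually_mono)
  next
    case (basic f U)
    then have "\<forall>\<^sub>F k in sequentially. (LINT z|\<pi> k. f z) \<in> U"
      using assms(3)[of f] by (intro topological_tendstoD) auto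
    then show ?case using assms(2) by simp
  qed simp
qed

section \<open>The interaction as a quadratic functional of coloured measures\<close>

definition colour_kernel :: "('d::finite torus \<Rightarrow> real) \<Rightarrow> ('d torus \<times> nat) \<times> ('d torus \<times> nat) \<Rightarrow> real" where
  "colour_kernel J p = J (fst (fst p) - fst (snd p)) * of_bool (snd (fst p) = snd (snd p))"

definition interaction :: "('d::finite torus \<Rightarrow> real) \<Rightarrow> ('d torus \<times> nat) measure \<Rightarrow> real" where
  "interaction J \<nu> = (LINT w|\<nu>. LINT z|\<nu>. colour_kernel J (z, w))"

lemma continuous_on_colour_kernel:
  assumes "continuous_on UNIV J"
  shows "continuous_on S (colour_kernel J)"
proof -
  have J: "continuous_on S (\<lambda>p :: ('a torus \<times> nat) \<times> ('a torus \<times> nat). J (fst (fst p) - fst (snd p)))"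
  proof (rule continuous_on_compose2[OF assms])
    show "continuous_on S (\<lambda>p :: ('a torus \<times> nat) \<times> ('a torus \<times> nat). fst (fst p) - fst (snd p))"
    proof -
      have "continuous_on S (\<lambda>p :: ('a torus \<times> nat) \<times> ('a torus \<times> nat). (fst (fst p), fst (snd p)))"
        by (intro continuous_intros)
      from continuous_on_compose2[OF continuous_on_torus_diff this] show ?thesis by simp
    qed
  qed simp
  have r: "continuous_on S (\<lambda>p. real (snd (h p)))" if "continuous_on S h" for h :: "_ \<Rightarrow> 'a torus \<times> nat"
    by (rule continuous_on_compose2[OF continuous_on_coloured_compose_snd[of UNIV real] that]) auto
  \<comment> \<open>The indicator of equal colours is written as a tent function of the difference;
    on integers the two agree, and the tent is continuous by rule.\<close>
  have "continuous_on S (\<lambda>p :: ('a torus \<times> nat) \<times> ('a torus \<times> nat).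
      J (fst (fst p) - fst (snd p)) * max 0 (1 - \<bar>real (snd (fst p)) - real (snd (snd p))\<bar>))"
    by (intro continuous_intros J r)
  then show ?thesis
    by (rule continuous_on_eq) (auto simp: colour_kernel_def max_def)
qed

text \<open>Continuity in \<open>w\<close> makes the inner integral of \<open>interaction\<close>
  bounded and measurable, so that it is itself an admissible test function for the outer
  integral.\<close>

lemma continuous_on_kernel_integral:
  fixes K :: "('d::finite torus \<times> nat) \<times> ('d torus \<times> nat) \<Rightarrow> real"
  assumes \<nu>: "\<nu> \<in> prob_measures (coloured_torus q)"
    and K: "continuous_on ((UNIV \<times> {1..q}) \<times> (UNIV \<times> {1..q})) K"
  shows "continuous_on (UNIV \<times> {1..q}) (\<lambda>w. LINT z|\<nu>. K (z, w))"
proof -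
  let ?Y = "UNIV \<times> {1..q} :: ('d torus \<times> nat) set"
  have Kc: "continuous_on ?Y (\<lambda>z. K (z, w))" if "w \<in> ?Y" for w
    using that by (intro continuous_on_compose2[OF K]) (auto intro!: continuous_intros)
  have "continuous_map (top_of_set ?Y) euclideanreal (\<lambda>w. LINT z|\<nu>. K (z, w))"
  proof (rule continuous_map_real_uniform_approx)
    fix e :: real assume "e > 0"
    then obtain Y \<phi> where Y: "finite Y" "Y \<subseteq> ?Y" "\<And>y. continuous_on ?Y (\<phi> y :: _ \<Rightarrow> real)"
      "\<And>z w. z \<in> ?Y \<Longrightarrow> w \<in> ?Y \<Longrightarrow> \<bar>K (z, w) - (\<Sum>y\<in>Y. \<phi> y w * K (z, y))\<bar> \<le> e"
      using kernel_finite_rank_approx[OF compact_coloured K] by blast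
    have "\<bar>(LINT z|\<nu>. K (z, w)) - (\<Sum>y\<in>Y. \<phi> y w * (LINT z|\<nu>. K (z, y)))\<bar> \<le> e" if w: "w \<in> ?Y" for w
    proof -
      have "\<bar>(LINT z|\<nu>. K (z, w)) - (LINT z|\<nu>. (\<Sum>y\<in>Y. \<phi> y w * K (z, y)))\<bar> \<le> e"
      proof (rule integral_prob_measures_close[OF \<nu>])
        show "continuous_on ?Y (\<lambda>z. \<Sum>y\<in>Y. \<phi> y w * K (z, y))"
          using Y(2) by (intro continuous_on_sum continuous_on_mult continuous_on_const Kc) auto
      qed (use Y(4) w Kc in auto)
      moreover have "(LINT z|\<nu>. (\<Sum>y\<in>Y. \<phi> y w * K (z, y))) = (\<Sum>y\<in>Y. \<phi> y w * (LINT z|\<nu>. K (z, y)))"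
        using integrable_prob_measures[OF \<nu> Kc] Y(2)
        by (subst Bochner_Integration.integral_sum) auto
      ultimately show ?thesis by simp
    qed
    moreover have "continuous_on ?Y (\<lambda>w. \<Sum>y\<in>Y. \<phi> y w * (LINT z|\<nu>. K (z, y)))"
      using Y(3) by (intro continuous_intros)
    ultimately show "\<exists>h. continuous_map (top_of_set ?Y) euclideanreal h \<and>
        (\<forall>w\<in>topspace (top_of_set ?Y). \<bar>(LINT z|\<nu>. K (z, w)) - h w\<bar> \<le> e)"
      by (intro exI[of _ "\<lambda>w. \<Sum>y\<in>Y. \<phi> y w * (LINT z|\<nu>. K (z, y))"]) auto
  qed
  then show ?thesis by simp
qed

text \<open>The weak topology controls linear functionals, whereas the interaction is quadratic. A
  finite-rank kernel gives finite sums of products of linear functionals, and the error is at most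
  \<open>e\<close> for all probability measures at once.\<close>

lemma continuous_map_interaction:
  assumes J: "continuous_on UNIV J"
  shows "continuous_map (weak_topology q) euclideanreal (interaction J)"
proof (rule continuous_map_real_uniform_approx)
  fix e :: real assume "e > 0"
  let ?Y = "UNIV \<times> {1..q} :: ('a torus \<times> nat) set"
  note K = continuous_on_colour_kernel[OF J]
  have Kc: "continuous_on ?Y (\<lambda>z. colour_kernel J (z, w))" for w
    by (intro continuous_on_compose2[OF K[of UNIV]]) (auto intro!: continuous_intros)
  obtain Y \<phi> where Y: "finite Y" "Y \<subseteq> ?Y" "\<And>y. continuous_on ?Y (\<phi> y :: _ \<Rightarrow> real)"
    "\<And>z w. z \<in> ?Y \<Longrightarrow> w \<in> ?Y \<Longrightarrow> \<bar>colour_kernel J (z, w) - (\<Sum>y\<in>Y. \<phi> y w * colour_kernel J (z, y))\<bar> \<le> e"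
    using kernel_finite_rank_approx[OF compact_coloured K \<open>e > 0\<close>] by blast
  let ?h = "\<lambda>\<nu>. \<Sum>y\<in>Y. (LINT w|\<nu>. \<phi> y w) * (LINT z|\<nu>. colour_kernel J (z, y))"
  have "\<bar>interaction J \<nu> - ?h \<nu>\<bar> \<le> e" if \<nu>: "\<nu> \<in> prob_measures (coloured_torus q)" for \<nu>
  proof -
    have "\<bar>interaction J \<nu> - (LINT w|\<nu>. (\<Sum>y\<in>Y. \<phi> y w * (LINT z|\<nu>. colour_kernel J (z, y))))\<bar> \<le> e"
      unfolding interaction_def
    proof (rule integral_prob_measures_close[OF \<nu>])
      show "continuous_on ?Y (\<lambda>w. LINT z|\<nu>. colour_kernel J (z, w))"
        by (rule continuous_on_kernel_integral[OF \<nu> K])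
      show "continuous_on ?Y (\<lambda>w. \<Sum>y\<in>Y. \<phi> y w * (LINT z|\<nu>. colour_kernel J (z, y)))"
        using Y(3) by (intro continuous_intros)
      fix w :: "'a torus \<times> nat" assume w: "w \<in> ?Y"
      have "\<bar>(LINT z|\<nu>. colour_kernel J (z, w)) - (LINT z|\<nu>. (\<Sum>y\<in>Y. \<phi> y w * colour_kernel J (z, y)))\<bar> \<le> e"
      proof (rule integral_prob_measures_close[OF \<nu>])
        show "continuous_on ?Y (\<lambda>z. \<Sum>y\<in>Y. \<phi> y w * colour_kernel J (z, y))"
          using Y(2) by (intro continuous_on_sum continuous_on_mult continuous_on_const Kc)
      qed (use Y(4) w Kc in auto)
      moreover have "(LINT z|\<nu>. (\<Sum>y\<in>Y. \<phi> y w * colour_kernel J (z, y))) =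
          (\<Sum>y\<in>Y. \<phi> y w * (LINT z|\<nu>. colour_kernel J (z, y)))"
        using integrable_prob_measures[OF \<nu> Kc]
        by (subst Bochner_Integration.integral_sum) auto
      ultimately show "\<bar>(LINT z|\<nu>. colour_kernel J (z, w)) -
          (\<Sum>y\<in>Y. \<phi> y w * (LINT z|\<nu>. colour_kernel J (z, y)))\<bar> \<le> e" by simp
    qed
    moreover have "(LINT w|\<nu>. (\<Sum>y\<in>Y. \<phi> y w * (LINT z|\<nu>. colour_kernel J (z, y)))) = ?h \<nu>"
      using integrable_prob_measures[OF \<nu> Y(3)]
      by (subst Bochner_Integration.integral_sum) auto
    ultimately show ?thesis by simp
  qed
  moreover have "continuous_map (weak_topology q) euclideanreal ?h"
    using Y(1) by (intro continuous_map_sum continuous_map_real_mult continuous_map_weak_integral Y(3) Kc)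
  ultimately show "\<exists>h. continuous_map (weak_topology q) euclideanreal h \<and>
      (\<forall>\<nu>\<in>topspace (weak_topology q). \<bar>interaction J \<nu> - h \<nu>\<bar> \<le> e)"
    by (intro exI[of _ ?h]) (auto simp: topspace_weak_topology)
qed

section \<open>Colour parts and integration over them\<close>

lemma sets_colour_part [simp]: "sets (colour_part \<nu> a) = sets borel"
  and space_colour_part [simp]: "space (colour_part \<nu> a) = UNIV"
  using sets.space_closed[of borel] sets.sigma_sets_eq[of borel]
  by (auto simp: colour_part_def sets_measure_of_conv space_measure_of_conv)

lemma measurable_fst_prob_measures:
  assumes \<nu>: "\<nu> \<in> prob_measures (coloured_torus q)"
  shows "fst \<in> \<nu> \<rightarrow>\<^sub>M borel" "(\<lambda>z. of_bool (snd z = a) :: real) \<in> borel_measurable \<nu>"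
  using \<nu> by (auto intro!: borel_measurable_prob_measures continuous_on_fst continuous_on_id
      continuous_on_coloured_compose_snd)

text \<open>A measure given through \<open>measure_of\<close> carries its values only once countable
  additivity is known. Writing it as an image of a density provides this, together with the change
  of variables for integrals.\<close>

lemma colour_part_eq_distr:
  assumes \<nu>: "\<nu> \<in> prob_measures (coloured_torus q)" and a: "a \<in> {1..q}"
  shows "colour_part \<nu> a = distr (density \<nu> (\<lambda>z. ennreal (of_bool (snd z = a)))) borel fst"
proof -
  note m [measurable] = measurable_fst_prob_measures[OF \<nu>]
  have "emeasure \<nu> (A \<times> {a}) = emeasure (density \<nu> (\<lambda>z. ennreal (of_bool (snd z = a)))) (fst -` A \<inter> space \<nu>)"
    if A: "A \<in> sets borel" for A
  proof -
    have [measurable]: "fst -` A \<inter> space \<nu> \<in> sets \<nu>" using A by measurable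
    have "A \<times> {a} = (fst -` A \<inter> space \<nu>) \<inter> {z \<in> space \<nu>. of_bool (snd z = a) = (1::real)}"
      using a by (auto simp: prob_measuresD(3)[OF \<nu>])
    moreover have "\<dots> \<in> sets \<nu>" by measurable
    ultimately have "emeasure \<nu> (A \<times> {a}) = (\<integral>\<^sup>+z. indicator (A \<times> {a}) z \<partial>\<nu>)" by simp
    also have "\<dots> = (\<integral>\<^sup>+z. ennreal (of_bool (snd z = a)) * indicator (fst -` A \<inter> space \<nu>) z \<partial>\<nu>)"
      by (intro nn_integral_cong) (auto simp: indicator_def)
    finally show ?thesis by (simp add: emeasure_density)
  qed
  then show ?thesis
    unfolding colour_part_def distr_def using sets.sigma_sets_eq[of borel]
    by (simp only: space_borel) (rule measure_of_eq, auto)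
qed

lemma integral_colour_part:
  fixes g :: "'d::finite torus \<Rightarrow> real"
  assumes \<nu>: "\<nu> \<in> prob_measures (coloured_torus q)" and a: "a \<in> {1..q}"
    and g: "g \<in> borel_measurable borel"
  shows "(LINT u|colour_part \<nu> a. g u) = (LINT z|\<nu>. of_bool (snd z = a) * g (fst z))"
proof -
  note m [measurable] = measurable_fst_prob_measures[OF \<nu>]
  note g [measurable]
  have "(LINT u|colour_part \<nu> a. g u) = (LINT z|density \<nu> (\<lambda>z. ennreal (of_bool (snd z = a))). g (fst z))"
    unfolding colour_part_eq_distr[OF \<nu> a] by (intro integral_distr) simp_all
  also have "\<dots> = (LINT z|\<nu>. of_bool (snd z = a) *\<^sub>R g (fst z))"
    by (intro integral_density) auto
  finally show ?thesis by simp
qed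

lemma integral_coloured_sum:
  fixes f :: "'d::finite torus \<times> nat \<Rightarrow> real"
  assumes \<nu>: "\<nu> \<in> prob_measures (coloured_torus q)" and f: "continuous_on (UNIV \<times> {1..q}) f"
  shows "(LINT z|\<nu>. f z) = (\<Sum>a\<in>{1..q}. LINT u|colour_part \<nu> a. f (u, a))"
proof -
  have fa: "continuous_on UNIV (\<lambda>u. f (u, a))" if "a \<in> {1..q}" for a
    using continuous_on_coloured_slice[OF f that] .
  have "(\<Sum>a\<in>{1..q}. LINT u|colour_part \<nu> a. f (u, a)) =
      (\<Sum>a\<in>{1..q}. LINT z|\<nu>. of_bool (snd z = a) * f (fst z, a))"
    using fa by (intro sum.cong refl integral_colour_part[OF \<nu>] borel_measurable_continuous_onI)
  also have "\<dots> = (LINT z|\<nu>. (\<Sum>a\<in>{1..q}. of_bool (snd z = a) * f (fst z, a)))"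
    using fa by (intro Bochner_Integration.integral_sum[symmetric] integrable_prob_measures[OF \<nu>]
        continuous_on_mult continuous_on_coloured_compose_snd continuous_on_coloured_compose_fst)
  also have "\<dots> = (LINT z|\<nu>. f z)"
  proof (rule Bochner_Integration.integral_cong[OF refl])
    fix z assume "z \<in> space \<nu>"
    then have "snd z \<in> {1..q}" by (auto simp: prob_measuresD(3)[OF \<nu>])
    then show "(\<Sum>a\<in>{1..q}. of_bool (snd z = a) * f (fst z, a)) = f z"
      by (simp add: of_bool_def if_distrib[of "\<lambda>x. x * _"] cong: if_cong)
  qed
  finally show ?thesis ..
qed

lemma borel_measurable_torus_translate:
  fixes J :: "'d::finite torus \<Rightarrow> real"
  assumes "continuous_on UNIV J"
  shows "(\<lambda>u. J (u - v)) \<in> borel_measurable borel"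
proof -
  have "continuous_on UNIV (\<lambda>u. (u, v))" by (intro continuous_intros)
  from continuous_on_compose2[OF continuous_on_torus_diff this] have "continuous_on UNIV (\<lambda>u. u - v)"
    by simp
  from continuous_on_compose2[OF assms this] show ?thesis
    by (intro borel_measurable_continuous_onI) simp
qed

lemma integral_colour_kernel:
  assumes "continuous_on UNIV J" "\<nu> \<in> prob_measures (coloured_torus q)" "a \<in> {1..q}"
  shows "(LINT z|\<nu>. colour_kernel J (z, (v, a))) = (LINT u|colour_part \<nu> a. J (u - v))"
  unfolding integral_colour_part[OF assms(2,3) borel_measurable_torus_translate[OF assms(1)]]
  by (simp add: colour_kernel_def mult.commute)

lemma interaction_colour_part:
  assumes J: "continuous_on UNIV J" and \<nu>: "\<nu> \<in> prob_measures (coloured_torus q)"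
  shows "interaction J \<nu> = (\<Sum>a\<in>{1..q}. LINT v|colour_part \<nu> a. LINT u|colour_part \<nu> a. J (u - v))"
  unfolding interaction_def
  by (subst integral_coloured_sum[OF \<nu> continuous_on_kernel_integral[OF \<nu> continuous_on_colour_kernel[OF J]]])
    (simp add: integral_colour_kernel[OF J \<nu>])

section \<open>Entropy as a supremum of log-likelihoods\<close>

text \<open>The log-density, relative to the equidistribution on the colours, of the colour distribution
  proportional to \<open>exp (f (u, \<cdot>))\<close>.\<close>

definition log_likelihood :: "nat \<Rightarrow> ('d::finite torus \<times> nat \<Rightarrow> real) \<Rightarrow> 'd torus \<times> nat \<Rightarrow> real" where
  "log_likelihood q f z = f z - ln ((\<Sum>b\<in>{1..q}. exp (f (fst z, b))) / real q)"

lemma sum_exp_pos: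
  fixes q :: nat
  shows "q \<ge> 1 \<Longrightarrow> 0 < (\<Sum>b\<in>{1..q}. exp (g b :: real))"
  by (intro sum_pos) auto

lemma continuous_on_log_likelihood:
  assumes q: "q \<ge> 1" and f: "continuous_on (UNIV \<times> {1..q}) f"
  shows "continuous_on (UNIV \<times> {1..q}) (log_likelihood q f)"
proof -
  have "continuous_on (UNIV \<times> {1..q}) (\<lambda>z :: 'a torus \<times> nat. f (fst z, b))" if "b \<in> {1..q}" for b
    by (rule continuous_on_coloured_compose_fst[OF continuous_on_coloured_slice[OF f that]])
  moreover have "(\<Sum>b\<in>{1..q}. exp (f (fst z, b))) / real q \<noteq> 0" for z
    using sum_exp_pos[OF q, of "\<lambda>b. f (fst z, b)"] q by simp
  ultimately show ?thesis
    unfolding log_likelihood_def[abs_def] using f q by (intro continuous_intros) auto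
qed

lemma sum_exp_log_likelihood:
  assumes q: "q \<ge> 1"
  shows "(\<Sum>a\<in>{1..q}. exp (log_likelihood q f (u, a))) = real q"
proof -
  let ?S = "\<Sum>b\<in>{1..q}. exp (f (u, b))"
  have S: "?S > 0" using q by (rule sum_exp_pos)
  have "exp (log_likelihood q f (u, a)) = exp (f (u, a)) * (real q / ?S)" for a
    using S q by (simp add: log_likelihood_def exp_diff)
  then have "(\<Sum>a\<in>{1..q}. exp (log_likelihood q f (u, a))) = ?S * (real q / ?S)"
    by (simp only: sum_distrib_right)
  then show ?thesis using S by simp
qed

lemma log_likelihood_ln:
  assumes "q \<ge> 1" "\<And>a. a \<in> {1..q} \<Longrightarrow> 0 < w (u, a)" "(\<Sum>a\<in>{1..q}. w (u, a)) = 1" "a \<in> {1..q}"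
  shows "log_likelihood q (\<lambda>z. ln (w z)) (u, a) = ln (real q * w (u, a))"
proof -
  have "(\<Sum>b\<in>{1..q}. exp (ln (w (u, b)))) = (\<Sum>b\<in>{1..q}. w (u, b))"
    using assms(2) by (intro sum.cong) auto
  then show ?thesis
    using assms(1,3) assms(2)[OF assms(4)] by (simp add: log_likelihood_def ln_mult ln_div)
qed

text \<open>One \<open>e\<close> comes from the functions themselves and one from the logarithm of
  the normalising sum. This permits replacing a test function by a member of a countable dense
  family.\<close>

lemma log_likelihood_close:
  assumes q: "q \<ge> 1" and fg: "\<And>z. z \<in> UNIV \<times> {1..q} \<Longrightarrow> \<bar>f z - g z\<bar> \<le> e" and z: "z \<in> UNIV \<times> {1..q}"
  shows "\<bar>log_likelihood q f z - log_likelihood q g z\<bar> \<le> 2 * e"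
proof -
  have le: "ln ((\<Sum>b\<in>{1..q}. exp (f (fst z, b))) / real q) \<le> e + ln ((\<Sum>b\<in>{1..q}. exp (g (fst z, b))) / real q)"
    if fg: "\<And>z. z \<in> UNIV \<times> {1..q} \<Longrightarrow> \<bar>f z - g z\<bar> \<le> e" for f g :: "'a torus \<times> nat \<Rightarrow> real"
  proof -
    let ?F = "\<Sum>b\<in>{1..q}. exp (f (fst z, b))" and ?G = "\<Sum>b\<in>{1..q}. exp (g (fst z, b))"
    have "?F \<le> (\<Sum>b\<in>{1..q}. exp e * exp (g (fst z, b)))"
    proof (rule sum_mono)
      fix b assume "b \<in> {1..q}"
      then have "\<bar>f (fst z, b) - g (fst z, b)\<bar> \<le> e" by (intro fg) auto
      then show "exp (f (fst z, b)) \<le> exp e * exp (g (fst z, b))"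
        unfolding exp_add[symmetric] by simp
    qed
    then have "?F / real q \<le> exp e * (?G / real q)"
      using q by (simp add: sum_distrib_left divide_right_mono)
    moreover have "?F / real q > 0" "?G / real q > 0"
      using sum_exp_pos[OF q] q by auto
    ultimately have "ln (?F / real q) \<le> ln (exp e * (?G / real q))" by (subst ln_le_cancel_iff) auto
    also have "\<dots> = e + ln (?G / real q)"
      using \<open>?G / real q > 0\<close> by (subst ln_mult) auto
    finally show ?thesis .
  qed
  have "\<bar>f z - g z\<bar> \<le> e" using fg z .
  moreover have "\<bar>g y - f y\<bar> \<le> e" if "y \<in> UNIV \<times> {1..q}" for y using fg[OF that] by (simp add: abs_minus_commute)
  ultimately show ?thesis
    using le[of f g, OF fg] le[of g f] unfolding log_likelihood_def by (simp add: abs_le_iff)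
qed

text \<open>Gibbs' variational inequality, with equality at the tilted distribution
  \<^term>\<open>\<lambda>a. exp (log_likelihood q f (u, a)) / real q\<close>.\<close>

lemma log_likelihood_le_entropy:
  assumes q: "q \<ge> 1" and p: "\<And>a. a \<in> {1..q} \<Longrightarrow> 0 \<le> p a" "(\<Sum>a\<in>{1..q}. p a) = 1"
  shows "(\<Sum>a\<in>{1..q}. p a * log_likelihood q f (u, a)) \<le> entropy_eq q p"
proof -
  \<comment> \<open>This is \<open>ln y \<le> y - 1\<close>, colour by colour; the right-hand sides
    sum to 1 - 1. Colours with \<open>p a = 0\<close> are treated apart because the argument divides
    by \<open>p a\<close>.\<close>
  have "p a * log_likelihood q f (u, a) - p a * ln (real q * p a) \<le> exp (log_likelihood q f (u, a)) / real q - p a"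
    if a: "a \<in> {1..q}" for a
  proof (cases "p a = 0")
    case False
    then have pos: "p a > 0" "real q * p a > 0" using p(1)[OF a] q by auto
    let ?L = "log_likelihood q f (u, a)"
    have "?L - ln (real q * p a) = ln (exp ?L / (real q * p a))"
      using pos q by (simp add: ln_div)
    also have "\<dots> \<le> exp ?L / (real q * p a) - 1"
      using pos by (intro ln_le_minus_one) auto
    finally have "p a * (?L - ln (real q * p a)) \<le> p a * (exp ?L / (real q * p a) - 1)"
      using pos by (intro mult_left_mono) auto
    also have "\<dots> = exp ?L / real q - p a" using pos by (simp add: field_simps)
    finally show ?thesis by (simp add: right_diff_distrib)
  qed (use q in auto)
  then have "(\<Sum>a\<in>{1..q}. p a * log_likelihood q f (u, a) - p a * ln (real q * p a)) \<le>
      (\<Sum>a\<in>{1..q}. exp (log_likelihood q f (u, a)) / real q - p a)"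
    by (rule sum_mono)
  also have "\<dots> = 0"
    using sum_exp_log_likelihood[OF q, of f u] p(2) q by (simp add: sum_subtractf flip: sum_divide_distrib)
  finally show ?thesis by (simp add: sum_subtractf entropy_eq_def)
qed

text \<open>With y = q x, the inequality \<open>ln y \<le> y - 1\<close> bounds the term from above
  and, applied to 1/y, from below. The result is a dominating constant for entropy
  integrals.\<close>

lemma abs_xlogx_le:
  assumes "0 \<le> x" "x \<le> 1" "q \<ge> 1"
  shows "\<bar>x * ln (real q * x)\<bar> \<le> real q"
proof (cases "x = 0")
  case False
  then have x: "x > 0" "real q * x > 0" using assms by auto
  have "ln (real q * x) \<le> real q * x - 1" using x by (intro ln_le_minus_one) auto
  also have "\<dots> \<le> real q * x" by simp
  also have "\<dots> \<le> real q" using assms by (simp add: mult_left_le)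
  finally have "x * ln (real q * x) \<le> x * real q" using x by (intro mult_left_mono) auto
  moreover have "x * real q \<le> real q" using assms by (simp add: mult_left_le_one_le)
  moreover have "- ln (real q * x) \<le> 1 / (real q * x) - 1"
  proof -
    have "0 < inverse (real q * x)" using x(2) by (rule positive_imp_inverse_positive)
    from ln_le_minus_one[OF this] show ?thesis by (simp only: ln_inverse divide_inverse mult_1_left)
  qed
  then have "x * (- ln (real q * x)) \<le> x * (1 / (real q * x))"
    using x by (intro mult_left_mono) auto
  moreover have "x * (1 / (real q * x)) \<le> real q"
  proof -
    have "x * (1 / (real q * x)) = 1 / real q" using x by simp
    also have "\<dots> \<le> 1" using assms by simp
    also have "\<dots> \<le> real q" using assms by simp
    finally show ?thesis .
  qed
  ultimately show ?thesis by (simp add: abs_le_iff)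
qed simp

text \<open>Continuity of the logarithm settles every limit except \<open>l = 0\<close>, where the
  substitution s = 1/(q x) reduces the claim to ln s / s tending to 0.\<close>

lemma tendsto_xlogx:
  assumes q: "q \<ge> 1" and x: "x \<longlonglongrightarrow> l" and nn: "\<And>k. 0 < x k"
  shows "(\<lambda>k. x k * ln (real q * x k)) \<longlonglongrightarrow> l * ln (real q * l)"
proof (cases "l = 0")
  case True
  have "((\<lambda>t :: real. - (ln (inverse t) / inverse t)) \<longlongrightarrow> - 0) (at_right 0)"
    by (intro tendsto_minus filterlim_compose[OF ln_x_over_x_tendsto_0 filterlim_inverse_at_top_right])
  moreover have "filterlim (\<lambda>k. real q * x k) (at_right 0) sequentially"
    using tendsto_mult_left[OF x, of "real q"] nn q True by (auto simp: filterlim_at less_imp_neq[OF nn, symmetric])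
  ultimately have "(\<lambda>k. - (ln (inverse (real q * x k)) / inverse (real q * x k))) \<longlonglongrightarrow> - 0"
    by (rule filterlim_compose)
  then have "(\<lambda>k. inverse (real q) * - (ln (inverse (real q * x k)) / inverse (real q * x k))) \<longlonglongrightarrow>
      inverse (real q) * - 0"
    by (rule tendsto_mult_left)
  moreover have "inverse (real q) * - (ln (inverse (real q * x k)) / inverse (real q * x k)) =
      x k * ln (real q * x k)" for k
    unfolding ln_inverse using nn[of k] q by (simp add: field_simps)
  ultimately show ?thesis using True by simp
next
  case False
  moreover have "0 \<le> l" using nn by (intro LIMSEQ_le_const[OF x]) (auto intro: less_imp_le)
  ultimately show ?thesis using q by (intro tendsto_intros x) auto
qed

section \<open>Measures with prescribed first marginal, and the duality between entropy and
  log-likelihoods\<close>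

lemma measurable_torus_lebesgue: "measurable torus_lebesgue N = measurable borel N"
  by (rule measurable_cong_sets) simp_all

locale torus_density =
  fixes r :: "'d::finite torus \<Rightarrow> real" and q :: nat
  assumes r_int: "integrable torus_lebesgue r" and r_nn: "AE u in torus_lebesgue. 0 \<le> r u"
    and r_one: "(LINT u|torus_lebesgue. r u) = 1" and q: "q \<ge> 1"
begin

text \<open>The first marginal of every represented measure. As \<open>base\<close> is a probability
  measure, bounded functions are integrable and constants can dominate.\<close>

definition base :: "'d torus measure" where
  "base = density torus_lebesgue (\<lambda>u. ennreal (r u))"

lemma r_meas [measurable]: "r \<in> borel_measurable borel"
  using borel_measurable_integrable[OF r_int] by (simp only: measurable_torus_lebesgue)

lemma sets_base [simp, measurable_cong]: "sets base = sets borel"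
  and space_base [simp]: "space base = UNIV"
  by (simp_all add: base_def)

lemma measurable_base: "measurable base N = measurable borel N"
  by (rule measurable_cong_sets) simp_all

lemma prob_space_base: "prob_space base"
proof
  have "emeasure base UNIV = (\<integral>\<^sup>+u. ennreal (r u) \<partial>torus_lebesgue)"
    by (simp add: base_def emeasure_density)
  also have "\<dots> = 1" using nn_integral_eq_integral[OF r_int r_nn] r_one by simp
  finally show "emeasure base (space base) = 1" by simp
qed

lemma integral_base:
  assumes g: "g \<in> borel_measurable borel"
  shows "(LINT u|base. g u) = (LINT u|torus_lebesgue. r u * (g u :: real))"
  unfolding base_def
  using integral_density[of g torus_lebesgue r] g r_nn r_meas
  by (simp add: measurable_torus_lebesgue)

lemma AE_baseI: "AE u in torus_lebesgue. P u \<Longrightarrow> AE u in base. P u"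
  unfolding base_def by (subst AE_density) (auto simp: measurable_torus_lebesgue elim: eventually_mono)

lemma integrable_base_bounded:
  assumes "g \<in> borel_measurable borel" "AE u in base. \<bar>g u\<bar> \<le> (C :: real)"
  shows "integrable base g"
  by (rule finite_measure.integrable_const_bound[OF prob_space.finite_measure[OF prob_space_base], of _ C])
    (use assms in \<open>simp_all add: measurable_base\<close>)

lemma integral_base_tendsto:
  fixes g :: "nat \<Rightarrow> 'd torus \<Rightarrow> real"
  assumes "\<And>k. g k \<in> borel_measurable borel" "h \<in> borel_measurable borel"
    "AE u in base. (\<lambda>k. g k u) \<longlonglongrightarrow> h u" "\<And>k. AE u in base. \<bar>g k u\<bar> \<le> C"
  shows "(\<lambda>k. LINT u|base. g k u) \<longlonglongrightarrow> (LINT u|base. h u)"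
proof -
  interpret prob_space base by (rule prob_space_base)
  show ?thesis
    using assms by (intro integral_dominated_convergence[where w = "\<lambda>_. C"]) (auto simp: measurable_base)
qed

lemma local_profilesD:
  assumes "\<alpha> \<in> local_profiles q"
  shows "a \<in> {1..q} \<Longrightarrow> \<alpha> a \<in> borel_measurable borel"
    and "AE u in torus_lebesgue. (\<forall>a\<in>{1..q}. 0 \<le> \<alpha> a u \<and> \<alpha> a u \<le> 1) \<and> (\<Sum>a\<in>{1..q}. \<alpha> a u) = 1"
proof -
  show "a \<in> {1..q} \<Longrightarrow> \<alpha> a \<in> borel_measurable borel"
    using assms by (auto simp: local_profiles_def measurable_torus_lebesgue)
  have "AE u in torus_lebesgue. \<forall>a\<in>{1..q}. 0 \<le> \<alpha> a u"
    using assms by (intro AE_finite_allI) (auto simp: local_profiles_def)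
  moreover have "AE u in torus_lebesgue. (\<Sum>a\<in>{1..q}. \<alpha> a u) = 1"
    using assms by (auto simp: local_profiles_def)
  ultimately show "AE u in torus_lebesgue. (\<forall>a\<in>{1..q}. 0 \<le> \<alpha> a u \<and> \<alpha> a u \<le> 1) \<and> (\<Sum>a\<in>{1..q}. \<alpha> a u) = 1"
  proof eventually_elim
    case (elim u)
    have "\<alpha> a u \<le> 1" if "a \<in> {1..q}" for a
      using member_le_sum[of a "{1..q}" "\<lambda>a. \<alpha> a u"] elim that by auto
    then show ?case using elim by blast
  qed
qed

lemma represents_integral:
  assumes \<nu>: "\<nu> \<in> prob_measures (coloured_torus q)" and rep: "represents q r \<nu> \<alpha>"
    and f: "continuous_on (UNIV \<times> {1..q}) f"
  shows "(LINT z|\<nu>. f z) = (LINT u|base. (\<Sum>a\<in>{1..q}. \<alpha> a u * f (u, a)))"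
proof -
  have \<alpha>: "\<alpha> \<in> local_profiles q" using rep by (simp add: represents_def)
  note m [measurable] = local_profilesD(1)[OF \<alpha>]
  note AE = local_profilesD(2)[OF \<alpha>]
  have fa [measurable]: "(\<lambda>u. f (u, a)) \<in> borel_measurable borel" if "a \<in> {1..q}" for a
    using continuous_on_coloured_slice[OF f that] by (rule borel_measurable_continuous_onI)
  obtain C where C: "C > 0" "\<And>z. z \<in> UNIV \<times> {1..q} \<Longrightarrow> \<bar>f z\<bar> \<le> C"
    using bounded_coloured_continuous[OF f] by blast
  have int: "integrable base (\<lambda>u. \<alpha> a u * f (u, a))" if a: "a \<in> {1..q}" for a
  proof (rule integrable_base_bounded[where C = C])
    show "(\<lambda>u. \<alpha> a u * f (u, a)) \<in> borel_measurable borel" using a by measurable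
    show "AE u in base. \<bar>\<alpha> a u * f (u, a)\<bar> \<le> C"
      using AE_baseI[OF AE]
    proof eventually_elim
      case (elim u)
      then have "\<bar>\<alpha> a u\<bar> * \<bar>f (u, a)\<bar> \<le> 1 * C" using a C by (intro mult_mono) auto
      then show ?case by (simp add: abs_mult)
    qed
  qed
  have "(LINT z|\<nu>. f z) = (\<Sum>a\<in>{1..q}. LINT u|colour_part \<nu> a. f (u, a))"
    by (rule integral_coloured_sum[OF \<nu> f])
  also have "\<dots> = (\<Sum>a\<in>{1..q}. LINT u|base. \<alpha> a u * f (u, a))"
  proof (rule sum.cong[OF refl])
    fix a assume a: "a \<in> {1..q}"
    have "AE u in torus_lebesgue. 0 \<le> r u * \<alpha> a u"
      using r_nn AE by eventually_elim (use a in auto)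
    then have "(LINT u|colour_part \<nu> a. f (u, a)) = (LINT u|torus_lebesgue. (r u * \<alpha> a u) *\<^sub>R f (u, a))"
      using rep a m[OF a] fa[OF a] unfolding represents_def
      by (simp add: integral_density measurable_torus_lebesgue)
    also have "\<dots> = (LINT u|base. \<alpha> a u * f (u, a))"
      using m[OF a] fa[OF a] by (subst integral_base) (auto simp: mult.assoc)
    finally show "(LINT u|colour_part \<nu> a. f (u, a)) = (LINT u|base. \<alpha> a u * f (u, a))" .
  qed
  also have "\<dots> = (LINT u|base. (\<Sum>a\<in>{1..q}. \<alpha> a u * f (u, a)))"
    using int by (intro Bochner_Integration.integral_sum[symmetric]) auto
  finally show ?thesis .
qed

lemma integral_entropy_base:
  assumes "\<alpha> \<in> local_profiles q"
  shows "(LINT u|torus_lebesgue. entropy_eq q (\<lambda>a. \<alpha> a u) * r u) = (LINT u|base. entropy_eq q (\<lambda>a. \<alpha> a u))"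
    and "integrable base (\<lambda>u. entropy_eq q (\<lambda>a. \<alpha> a u))"
    and "(\<lambda>u. entropy_eq q (\<lambda>a. \<alpha> a u)) \<in> borel_measurable borel"
proof -
  note [measurable] = local_profilesD(1)[OF assms]
  show m: "(\<lambda>u. entropy_eq q (\<lambda>a. \<alpha> a u)) \<in> borel_measurable borel"
    unfolding entropy_eq_def by measurable
  then show "(LINT u|torus_lebesgue. entropy_eq q (\<lambda>a. \<alpha> a u) * r u) = (LINT u|base. entropy_eq q (\<lambda>a. \<alpha> a u))"
    by (simp add: integral_base mult.commute)
  show "integrable base (\<lambda>u. entropy_eq q (\<lambda>a. \<alpha> a u))"
  proof (rule integrable_base_bounded[OF m, where C = "real q * real q"])
    show "AE u in base. \<bar>entropy_eq q (\<lambda>a. \<alpha> a u)\<bar> \<le> real q * real q"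
      using AE_baseI[OF local_profilesD(2)[OF assms]]
    proof eventually_elim
      case (elim u)
      have "\<bar>entropy_eq q (\<lambda>a. \<alpha> a u)\<bar> \<le> (\<Sum>a\<in>{1..q}. real q)"
        unfolding entropy_eq_def using elim q
        by (intro order_trans[OF sum_abs] sum_mono abs_xlogx_le) auto
      then show ?case by simp
    qed
  qed
qed

lemma log_likelihood_integral_le:
  assumes \<nu>: "\<nu> \<in> prob_measures (coloured_torus q)" and rep: "represents q r \<nu> \<alpha>"
    and f: "continuous_on (UNIV \<times> {1..q}) f"
  shows "(LINT z|\<nu>. log_likelihood q f z) \<le> (LINT u|torus_lebesgue. entropy_eq q (\<lambda>a. \<alpha> a u) * r u)"
proof -
  have \<alpha>: "\<alpha> \<in> local_profiles q" using rep by (simp add: represents_def)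
  note m [measurable] = local_profilesD(1)[OF \<alpha>]
  note c = continuous_on_log_likelihood[OF q f]
  have fa [measurable]: "(\<lambda>u. log_likelihood q f (u, a)) \<in> borel_measurable borel" if "a \<in> {1..q}" for a
    using continuous_on_coloured_slice[OF c that] by (rule borel_measurable_continuous_onI)
  obtain C where C: "C > 0" "\<And>z. z \<in> UNIV \<times> {1..q} \<Longrightarrow> \<bar>log_likelihood q f z\<bar> \<le> C"
    using bounded_coloured_continuous[OF c] by blast
  have "integrable base (\<lambda>u. \<Sum>a\<in>{1..q}. \<alpha> a u * log_likelihood q f (u, a))"
  proof (intro Bochner_Integration.integrable_sum integrable_base_bounded[where C = C])
    fix a assume a: "a \<in> {1..q}"
    show "(\<lambda>u. \<alpha> a u * log_likelihood q f (u, a)) \<in> borel_measurable borel" using a by measurable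
    show "AE u in base. \<bar>\<alpha> a u * log_likelihood q f (u, a)\<bar> \<le> C"
      using AE_baseI[OF local_profilesD(2)[OF \<alpha>]]
    proof eventually_elim
      case (elim u)
      then have "\<bar>\<alpha> a u\<bar> * \<bar>log_likelihood q f (u, a)\<bar> \<le> 1 * C" using a C by (intro mult_mono) auto
      then show ?case by (simp add: abs_mult)
    qed
  qed
  then have "(LINT u|base. (\<Sum>a\<in>{1..q}. \<alpha> a u * log_likelihood q f (u, a))) \<le>
      (LINT u|base. entropy_eq q (\<lambda>a. \<alpha> a u))"
  proof (rule integral_mono_AE[OF _ integral_entropy_base(2)[OF \<alpha>]])
    show "AE u in base. (\<Sum>a\<in>{1..q}. \<alpha> a u * log_likelihood q f (u, a)) \<le> entropy_eq q (\<lambda>a. \<alpha> a u)"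
      using AE_baseI[OF local_profilesD(2)[OF \<alpha>]]
      by eventually_elim (intro log_likelihood_le_entropy[OF q], auto)
  qed
  then show ?thesis
    by (simp only: represents_integral[OF \<nu> rep c] integral_entropy_base(1)[OF \<alpha>])
qed

text \<open>The colour parts add up to \<open>base\<close>, so each is absolutely continuous and has
  a Radon-Nikodym density; these densities add up to \<open>r\<close>, and dividing by
  \<open>r\<close> gives the local profile. Only the first marginal is assumed, which makes
  representability checkable in limits.\<close>

lemma represents_if_marginal:
  assumes \<nu>: "\<nu> \<in> prob_measures (coloured_torus q)"
    and marg: "\<And>g :: 'd torus \<Rightarrow> real. continuous_on UNIV g \<Longrightarrow> (LINT z|\<nu>. g (fst z)) = (LINT u|base. g u)"
  obtains \<alpha> where "represents q r \<nu> \<alpha>"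
proof -
  interpret L: finite_measure "torus_lebesgue :: 'd torus measure" by (rule finite_measure_torus_lebesgue)
  interpret N: prob_space \<nu> by (rule prob_measuresD(1)[OF \<nu>])
  note m [measurable] = measurable_fst_prob_measures(1)[OF \<nu>]
  have dm: "distr \<nu> borel fst = base"
  proof (rule finite_measure_eqI_continuous)
    show "finite_measure (distr \<nu> borel fst)" by (rule N.finite_measure_distr[OF m])
    show "finite_measure base" using prob_space_base by (rule prob_space.finite_measure)
    fix g :: "'d torus \<Rightarrow> real" assume g: "continuous_on UNIV g"
    show "(LINT u|distr \<nu> borel fst. g u) = (LINT u|base. g u)"
      using marg[OF g] borel_measurable_continuous_onI[OF g] m by (simp add: integral_distr)
  qed simp_all
  have sum_cp: "(\<Sum>a\<in>{1..q}. emeasure (colour_part \<nu> a) A) = emeasure base A" if A: "A \<in> sets borel" for A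
  proof -
    note [measurable] = measurable_fst_prob_measures(2)[OF \<nu>]
    have [measurable]: "fst -` A \<inter> space \<nu> \<in> sets \<nu>" using A by measurable
    have "(\<Sum>a\<in>{1..q}. emeasure (colour_part \<nu> a) A) =
        (\<Sum>a\<in>{1..q}. \<integral>\<^sup>+z. ennreal (of_bool (snd z = a)) * indicator (fst -` A \<inter> space \<nu>) z \<partial>\<nu>)"
      using A by (intro sum.cong refl) (simp add: colour_part_eq_distr[OF \<nu>] emeasure_distr emeasure_density)
    also have "\<dots> = (\<integral>\<^sup>+z. (\<Sum>a\<in>{1..q}. ennreal (of_bool (snd z = a)) * indicator (fst -` A \<inter> space \<nu>) z) \<partial>\<nu>)"
      by (intro nn_integral_sum[symmetric]) measurable
    also have "\<dots> = (\<integral>\<^sup>+z. indicator (fst -` A \<inter> space \<nu>) z \<partial>\<nu>)"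
    proof (rule nn_integral_cong)
      fix z assume "z \<in> space \<nu>"
      then have "snd z \<in> {1..q}" by (auto simp: prob_measuresD(3)[OF \<nu>])
      then show "(\<Sum>a\<in>{1..q}. ennreal (of_bool (snd z = a)) * indicator (fst -` A \<inter> space \<nu>) z) =
          indicator (fst -` A \<inter> space \<nu>) z"
        by (subst sum.remove[of _ "snd z"]) (auto intro!: sum.neutral)
    qed
    also have "\<dots> = emeasure \<nu> (fst -` A \<inter> space \<nu>)" by simp
    also have "\<dots> = emeasure base A" using A by (simp add: emeasure_distr flip: dm)
    finally show ?thesis .
  qed
  have "\<exists>F\<in>borel_measurable torus_lebesgue. density torus_lebesgue F = colour_part \<nu> a" if a: "a \<in> {1..q}" for a
  proof (rule L.Radon_Nikodym)
    show "absolutely_continuous torus_lebesgue (colour_part \<nu> a)"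
      unfolding absolutely_continuous_def
    proof
      fix A assume A: "A \<in> null_sets (torus_lebesgue :: 'd torus measure)"
      then have As: "A \<in> sets borel" by auto
      have "emeasure (colour_part \<nu> a) A \<le> (\<Sum>a\<in>{1..q}. emeasure (colour_part \<nu> a) A)"
        using a by (intro member_le_sum) auto
      also have "\<dots> = emeasure base A" by (rule sum_cp[OF As])
      also have "\<dots> = 0"
      proof -
        have "AE u in torus_lebesgue. u \<notin> A" using A by (rule AE_not_in)
        then have "(\<integral>\<^sup>+u. ennreal (r u) * indicator A u \<partial>torus_lebesgue) = (\<integral>\<^sup>+u. 0 \<partial>(torus_lebesgue :: 'd torus measure))"
          by (intro nn_integral_cong_AE) (auto elim!: eventually_mono)
        then show ?thesis using As unfolding base_def
          by (subst emeasure_density) (auto simp: measurable_torus_lebesgue)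
      qed
      finally show "A \<in> null_sets (colour_part \<nu> a)" using As by (auto intro: null_setsI)
    qed
  qed simp
  then obtain F where F: "\<And>a. a \<in> {1..q} \<Longrightarrow> F a \<in> borel_measurable torus_lebesgue"
    "\<And>a. a \<in> {1..q} \<Longrightarrow> density torus_lebesgue (F a) = colour_part \<nu> a"
    by metis
  have Fm [measurable]: "F a \<in> borel_measurable borel" if "a \<in> {1..q}" for a
    using F(1)[OF that] by (simp only: measurable_torus_lebesgue)
  have "density torus_lebesgue (\<lambda>u. \<Sum>a\<in>{1..q}. F a u) = density torus_lebesgue (\<lambda>u. ennreal (r u))"
  proof (rule measure_eqI)
    fix A assume "A \<in> sets (density torus_lebesgue (\<lambda>u. \<Sum>a\<in>{1..q}. F a u))"
    then have A [measurable]: "A \<in> sets borel" by simp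
    have "emeasure (density torus_lebesgue (\<lambda>u. \<Sum>a\<in>{1..q}. F a u)) A =
        (\<integral>\<^sup>+u. (\<Sum>a\<in>{1..q}. F a u) * indicator A u \<partial>torus_lebesgue)"
      using F(1) by (intro emeasure_density) auto
    also have "\<dots> = (\<integral>\<^sup>+u. (\<Sum>a\<in>{1..q}. F a u * indicator A u) \<partial>torus_lebesgue)"
      by (simp only: sum_distrib_right)
    also have "\<dots> = (\<Sum>a\<in>{1..q}. \<integral>\<^sup>+u. F a u * indicator A u \<partial>torus_lebesgue)"
      using F(1) A by (intro nn_integral_sum) (auto intro!: borel_measurable_times_ennreal simp: measurable_torus_lebesgue)
    also have "\<dots> = (\<Sum>a\<in>{1..q}. emeasure (colour_part \<nu> a) A)"
      using F A by (intro sum.cong refl) (simp flip: F(2) add: emeasure_density)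
    also have "\<dots> = emeasure base A" using sum_cp A by simp
    finally show "emeasure (density torus_lebesgue (\<lambda>u. \<Sum>a\<in>{1..q}. F a u)) A =
        emeasure (density torus_lebesgue (\<lambda>u. ennreal (r u))) A" by (simp add: base_def)
  qed simp
  then have sumF: "AE u in torus_lebesgue. (\<Sum>a\<in>{1..q}. F a u) = ennreal (r u)"
    using F(1) by (intro L.density_unique) (auto simp: measurable_torus_lebesgue)
  \<comment> \<open>Where \<open>r\<close> vanishes the product with \<open>r\<close> is 0 for any
    value, and the uniform vector keeps the sum equal to 1.\<close>
  define \<alpha> where "\<alpha> a u = (if 0 < r u then enn2real (F a u) / r u else 1 / real q)" for a u
  have am [measurable]: "\<alpha> a \<in> borel_measurable borel" if a: "a \<in> {1..q}" for a
  proof -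
    have [measurable]: "F a \<in> borel_measurable borel" by (rule Fm[OF a])
    show ?thesis unfolding \<alpha>_def by measurable
  qed
  have AE: "AE u in torus_lebesgue. (\<forall>a\<in>{1..q}. 0 \<le> \<alpha> a u \<and> ennreal (r u * \<alpha> a u) = F a u) \<and>
      (\<Sum>a\<in>{1..q}. \<alpha> a u) = 1"
    using sumF r_nn
  proof eventually_elim
    case (elim u)
    have fin: "F a u < \<infinity>" if "a \<in> {1..q}" for a
    proof -
      have "F a u \<le> (\<Sum>a\<in>{1..q}. F a u)" using that by (intro member_le_sum) auto
      then show ?thesis using elim(1) by (simp add: order_le_less_trans)
    qed
    have sum: "(\<Sum>a\<in>{1..q}. enn2real (F a u)) = r u"
    proof -
      have "ennreal (\<Sum>a\<in>{1..q}. enn2real (F a u)) = (\<Sum>a\<in>{1..q}. ennreal (enn2real (F a u)))"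
        by (rule sum_ennreal[symmetric]) simp
      also have "\<dots> = (\<Sum>a\<in>{1..q}. F a u)"
        using fin by (intro sum.cong) auto
      finally show ?thesis using elim by (subst (asm) elim(1)) (simp add: sum_nonneg)
    qed
    show ?case
    proof (cases "0 < r u")
      case True
      have "(\<Sum>a\<in>{1..q}. \<alpha> a u) = (\<Sum>a\<in>{1..q}. enn2real (F a u)) / r u"
        using True by (simp add: \<alpha>_def sum_divide_distrib)
      then show ?thesis using True fin sum by (auto simp: \<alpha>_def)
    next
      case False
      with elim have r0: "r u = 0" by simp
      with elim(1) have "F a u = 0" if "a \<in> {1..q}" for a using that by (simp add: sum_eq_0_iff)
      then show ?thesis using r0 q by (simp add: \<alpha>_def)
    qed
  qed
  show ?thesis
  proof (rule that[of \<alpha>])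
    have "\<alpha> \<in> local_profiles q"
      unfolding local_profiles_def
    proof (intro CollectI conjI ballI)
      fix a assume a: "a \<in> {1..q}"
      show "\<alpha> a \<in> borel_measurable torus_lebesgue" using am[OF a] by (simp only: measurable_torus_lebesgue)
      show "AE u in torus_lebesgue. 0 \<le> \<alpha> a u" using AE by eventually_elim (use a in auto)
      have "AE u in torus_lebesgue. \<bar>\<alpha> a u\<bar> \<le> 1"
        using AE
      proof eventually_elim
        case (elim u)
        have "\<alpha> a u \<le> (\<Sum>a\<in>{1..q}. \<alpha> a u)" using elim a by (intro member_le_sum) auto
        then show ?case using elim a by auto
      qed
      then show "\<exists>C. AE u in torus_lebesgue. \<bar>\<alpha> a u\<bar> \<le> C" by blast
    next
      show "AE u in torus_lebesgue. (\<Sum>a\<in>{1..q}. \<alpha> a u) = 1" using AE by eventually_elim simp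
    qed
    moreover have "colour_part \<nu> a = density torus_lebesgue (\<lambda>u. ennreal (r u * \<alpha> a u))" if a: "a \<in> {1..q}" for a
    proof -
      have "density torus_lebesgue (\<lambda>u. ennreal (r u * \<alpha> a u)) = density torus_lebesgue (F a)"
      proof (rule density_cong)
        show "AE u in torus_lebesgue. ennreal (r u * \<alpha> a u) = F a u" using AE by eventually_elim (use a in auto)
      qed (use am[OF a] Fm[OF a] in \<open>auto simp: measurable_torus_lebesgue\<close>)
      then show ?thesis using F(2)[OF a] by simp
    qed
    ultimately show "represents q r \<nu> \<alpha>" by (simp add: represents_def)
  qed
qed

text \<open>With the preceding lemma, representability means agreement of the first marginal with
  \<open>base\<close>. It is thus a family of closed conditions for the weak topology.\<close>

lemma represents_marginal:
  assumes \<nu>: "\<nu> \<in> prob_measures (coloured_torus q)" and rep: "represents q r \<nu> \<alpha>"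
    and g: "continuous_on UNIV (g :: 'd torus \<Rightarrow> real)"
  shows "(LINT z|\<nu>. g (fst z)) = (LINT u|base. g u)"
proof -
  have \<alpha>: "\<alpha> \<in> local_profiles q" using rep by (simp add: represents_def)
  note m [measurable] = local_profilesD(1)[OF \<alpha>] borel_measurable_continuous_onI[OF g]
  have "(LINT z|\<nu>. g (fst z)) = (LINT u|base. (\<Sum>a\<in>{1..q}. \<alpha> a u * g u))"
    using represents_integral[OF \<nu> rep continuous_on_coloured_compose_fst[OF g]] by simp
  also have "\<dots> = (LINT u|base. g u)"
  proof (rule integral_cong_AE)
    show "AE u in base. (\<Sum>a\<in>{1..q}. \<alpha> a u * g u) = g u"
      using AE_baseI[OF local_profilesD(2)[OF \<alpha>]]
      by eventually_elim (simp flip: sum_distrib_right)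
  qed (simp_all add: measurable_base)
  finally show ?thesis .
qed

text \<open>L1 approximation converges almost everywhere along a subsequence. Truncation from below
  and division by the sum then restore positivity and normalisation; the limit is unaffected, being
  almost everywhere a probability vector already.\<close>

lemma continuous_profile_approx:
  assumes \<alpha>: "\<alpha> \<in> local_profiles q"
  obtains w :: "nat \<Rightarrow> 'd torus \<times> nat \<Rightarrow> real" where
    "\<And>k. continuous_on (UNIV \<times> {1..q}) (w k)"
    "\<And>k z. z \<in> UNIV \<times> {1..q} \<Longrightarrow> 0 < w k z" "\<And>k u. (\<Sum>a\<in>{1..q}. w k (u, a)) = 1"
    "AE u in base. \<forall>a\<in>{1..q}. (\<lambda>k. w k (u, a)) \<longlonglongrightarrow> \<alpha> a u"
proof -
  interpret B: prob_space base by (rule prob_space_base)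
  note m [measurable] = local_profilesD(1)[OF \<alpha>]
  have int: "integrable base (\<alpha> a)" if a: "a \<in> {1..q}" for a
  proof (rule integrable_base_bounded[where C = 1])
    show "AE u in base. \<bar>\<alpha> a u\<bar> \<le> 1"
      using AE_baseI[OF local_profilesD(2)[OF \<alpha>]] by eventually_elim (use a in auto)
  qed (rule m[OF a])
  have "\<exists>g. continuous_on UNIV g \<and> (LINT u|base. \<bar>\<alpha> a u - g u\<bar>) < inverse (real (Suc n))"
    if a: "a \<in> {1..q}" for a and n :: nat
    using B.finite_measure_axioms int[OF a] by (intro continuous_L1_dense compact_UNIV_torus) simp_all
  then obtain g where g: "\<And>a n. a \<in> {1..q} \<Longrightarrow> continuous_on UNIV (g a n)"
    "\<And>a n. a \<in> {1..q} \<Longrightarrow> (LINT u|base. \<bar>\<alpha> a u - g a n u\<bar>) < inverse (real (Suc n))"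
    by metis
  have gi: "integrable base (g a n)" if "a \<in> {1..q}" for a n
    using B.finite_measure_axioms g(1)[OF that] by (intro integrable_continuous_compact_UNIV compact_UNIV_torus) simp_all
  \<comment> \<open>The errors of all colours are added, so that one subsequence serves them
    all.\<close>
  define U where "U n u = (\<Sum>a\<in>{1..q}. \<bar>\<alpha> a u - g a n u\<bar>)" for n u
  have Ui: "integrable base (U n)" for n
    unfolding U_def using int gi by (intro Bochner_Integration.integrable_sum integrable_abs Bochner_Integration.integrable_diff)
  have "(\<lambda>n. LINT u|base. norm (U n u)) \<longlonglongrightarrow> 0"
  proof (rule tendsto_sandwich[where f = "\<lambda>_. 0" and h = "\<lambda>n. real q * inverse (real (Suc n))"])
    have "(LINT u|base. norm (U n u)) \<le> real q * inverse (real (Suc n))" for n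
    proof -
      have "(LINT u|base. norm (U n u)) = (LINT u|base. U n u)"
        by (intro Bochner_Integration.integral_cong) (auto simp: U_def sum_nonneg)
      also have "\<dots> = (\<Sum>a\<in>{1..q}. LINT u|base. \<bar>\<alpha> a u - g a n u\<bar>)"
        unfolding U_def using int gi
        by (intro Bochner_Integration.integral_sum integrable_abs Bochner_Integration.integrable_diff)
      also have "\<dots> \<le> (\<Sum>a\<in>{1..q}. inverse (real (Suc n)))"
        using g(2) by (intro sum_mono less_imp_le)
      finally show ?thesis by simp
    qed
    then show "\<forall>\<^sub>F n in sequentially. (LINT u|base. norm (U n u)) \<le> real q * inverse (real (Suc n))"
      by (intro always_eventually allI)
    show "(\<lambda>n. real q * inverse (real (Suc n))) \<longlonglongrightarrow> 0"
      using tendsto_mult_left[OF LIMSEQ_inverse_real_of_nat, of "real q"] by simp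
  qed (auto intro!: always_eventually)
  from tendsto_L1_AE_subseq[OF Ui this] obtain s :: "nat \<Rightarrow> nat" where
    s: "AE u in base. (\<lambda>n. U (s n) u) \<longlonglongrightarrow> 0" by blast
  \<comment> \<open>The floor 1/(k+1) is positive for each k and disappears in the limit.\<close>
  define c where "c k a u = max (inverse (real (Suc k))) (g a (s k) u)" for k a u
  have cpos: "0 < c k a u" for k a u by (simp add: c_def less_max_iff_disj)
  have csum: "0 < (\<Sum>a\<in>{1..q}. c k a u)" for k u
    using q cpos by (intro sum_pos) auto
  have csum0: "(\<Sum>a\<in>{1..q}. c k a u) \<noteq> 0" for k u
    using csum[of k u] by linarith
  have ccont: "continuous_on UNIV (c k a)" if "a \<in> {1..q}" for k a
    unfolding c_def using g(1)[OF that] by (intro continuous_intros)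
  define w where "w k z = c k (snd z) (fst z) / (\<Sum>a\<in>{1..q}. c k a (fst z))" for k z
  show ?thesis
  proof (rule that[of w])
    fix k
    have "continuous_on (UNIV \<times> {1..q}) (\<lambda>z. \<Sum>b\<in>{1..q}. of_bool (snd z = b) * c k b (fst z))"
      using ccont by (intro continuous_on_sum continuous_on_mult continuous_on_coloured_compose_snd
          continuous_on_coloured_compose_fst)
    then have "continuous_on (UNIV \<times> {1..q}) (\<lambda>z. c k (snd z) (fst z))"
    proof (rule continuous_on_eq)
      fix z :: "'d torus \<times> nat" assume "z \<in> UNIV \<times> {1..q}"
      then have "snd z \<in> {1..q}" by auto
      then show "(\<Sum>b\<in>{1..q}. of_bool (snd z = b) * c k b (fst z)) = c k (snd z) (fst z)"
        by (subst sum.remove[of _ "snd z"]) (auto intro!: sum.neutral)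
    qed
    moreover have "continuous_on (UNIV \<times> {1..q}) (\<lambda>z :: 'd torus \<times> nat. \<Sum>a\<in>{1..q}. c k a (fst z))"
      using ccont by (intro continuous_on_sum continuous_on_coloured_compose_fst)
    ultimately show "continuous_on (UNIV \<times> {1..q}) (w k)"
      unfolding w_def by (intro continuous_on_divide ballI csum0)
    show "0 < w k z" for z
      unfolding w_def using cpos csum by (intro divide_pos_pos)
    show "(\<Sum>a\<in>{1..q}. w k (u, a)) = 1" for u
      using csum[of k u] by (simp add: w_def flip: sum_divide_distrib)
  next
    show "AE u in base. \<forall>a\<in>{1..q}. (\<lambda>k. w k (u, a)) \<longlonglongrightarrow> \<alpha> a u"
      using s AE_baseI[OF local_profilesD(2)[OF \<alpha>]]
    proof eventually_elim
      case (elim u)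
      have lim: "(\<lambda>k. c k a u) \<longlonglongrightarrow> \<alpha> a u" if a: "a \<in> {1..q}" for a
      proof -
        have "(\<lambda>k. \<bar>\<alpha> a u - g a (s k) u\<bar>) \<longlonglongrightarrow> 0"
        proof (rule tendsto_sandwich[OF _ _ tendsto_const elim(1)])
          show "\<forall>\<^sub>F k in sequentially. \<bar>\<alpha> a u - g a (s k) u\<bar> \<le> U (s k) u"
            unfolding U_def using a by (intro always_eventually allI member_le_sum) auto
        qed simp
        then have "(\<lambda>k. \<alpha> a u - (\<alpha> a u - g a (s k) u)) \<longlonglongrightarrow> \<alpha> a u - 0"
          by (intro tendsto_diff tendsto_const) (simp only: tendsto_rabs_zero_iff)
        then have "(\<lambda>k. c k a u) \<longlonglongrightarrow> max 0 (\<alpha> a u)"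
          unfolding c_def by (intro tendsto_max LIMSEQ_inverse_real_of_nat) simp
        then show ?thesis using elim(2) a by (simp add: max_def)
      qed
      have "(\<lambda>k. \<Sum>a\<in>{1..q}. c k a u) \<longlonglongrightarrow> (\<Sum>a\<in>{1..q}. \<alpha> a u)"
        using lim by (intro tendsto_sum)
      then have "(\<lambda>k. \<Sum>a\<in>{1..q}. c k a u) \<longlonglongrightarrow> 1" using elim(2) by simp
      then have "(\<lambda>k. w k (u, a)) \<longlonglongrightarrow> \<alpha> a u / 1" if "a \<in> {1..q}" for a
        unfolding w_def fst_conv snd_conv using lim[OF that] by (intro tendsto_divide) auto
      then show ?case by simp
    qed
  qed
qed

text \<open>The best test function would be the logarithm of the local profile, which may be
  discontinuous or unbounded. It is replaced by logarithms of continuous approximations mixed with a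
  little of the uniform distribution, and the mixing is paid for in entropy.\<close>

lemma log_likelihood_integral_dense:
  assumes \<nu>: "\<nu> \<in> prob_measures (coloured_torus q)" and rep: "represents q r \<nu> \<alpha>" and e: "e > 0"
  obtains f where "continuous_on (UNIV \<times> {1..q}) f"
    "(LINT u|torus_lebesgue. entropy_eq q (\<lambda>a. \<alpha> a u) * r u) - e < (LINT z|\<nu>. log_likelihood q f z)"
proof -
  interpret B: prob_space base by (rule prob_space_base)
  have \<alpha>: "\<alpha> \<in> local_profiles q" using rep by (simp add: represents_def)
  note AE = AE_baseI[OF local_profilesD(2)[OF \<alpha>]]
  note m [measurable] = local_profilesD(1)[OF \<alpha>]
  obtain w :: "nat \<Rightarrow> 'd torus \<times> nat \<Rightarrow> real" where w: "\<And>k. continuous_on (UNIV \<times> {1..q}) (w k)"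
    "\<And>k z. z \<in> UNIV \<times> {1..q} \<Longrightarrow> 0 < w k z" "\<And>k u. (\<Sum>a\<in>{1..q}. w k (u, a)) = 1"
    "AE u in base. \<forall>a\<in>{1..q}. (\<lambda>k. w k (u, a)) \<longlonglongrightarrow> \<alpha> a u"
    using continuous_profile_approx[OF \<alpha>] by blast
  have w1: "w k (u, a) \<le> 1" if "a \<in> {1..q}" for k u a
  proof -
    have "w k (u, a) \<le> (\<Sum>a\<in>{1..q}. w k (u, a))"
      using that by (intro member_le_sum less_imp_le[OF w(2)]) auto
    then show ?thesis by (simp only: w(3))
  qed
  \<comment> \<open>The proportion \<open>d\<close> of the uniform distribution is chosen so that
    mixing costs exactly \<open>e / 2\<close>, namely - ln (1 - d).\<close>
  define d where "d = 1 - exp (- (e / 2))"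
  have d: "0 < d" "d < 1" "ln (1 - d) = - (e / 2)" using e by (auto simp: d_def)
  \<comment> \<open>The mixture is at least \<open>d / real q\<close>, so its logarithms are bounded
    uniformly in k, as dominated convergence requires.\<close>
  define v where "v k z = (1 - d) * w k z + d / real q" for k z
  have vlow: "d / real q \<le> v k z" if "z \<in> UNIV \<times> {1..q}" for k z
    using w(2)[OF that, of k] d by (simp add: v_def)
  have vpos: "0 < v k z" if "z \<in> UNIV \<times> {1..q}" for k z
    using vlow[OF that, of k] d q by (smt (verit) divide_pos_pos of_nat_0_less_iff One_nat_def Suc_le_lessD)
  have v1: "v k (u, a) \<le> 1" if "a \<in> {1..q}" for k u a
  proof -
    have "v k (u, a) \<le> (1 - d) * 1 + d * 1"
      unfolding v_def divide_inverse using w1[OF that] d q by (intro add_mono mult_left_mono) (auto simp: field_simps)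
    then show ?thesis by simp
  qed
  have vsum: "(\<Sum>a\<in>{1..q}. v k (u, a)) = 1" for k u
    using w(3)[of k u] q by (simp add: v_def sum.distrib flip: sum_distrib_left)
  have vc: "continuous_on (UNIV \<times> {1..q}) (v k)" for k
    unfolding v_def using w(1) by (intro continuous_intros)
  define f where "f k z = ln (v k z)" for k z
  have fc: "continuous_on (UNIV \<times> {1..q}) (f k)" for k
    unfolding f_def using vc vpos by (intro continuous_on_ln) (auto simp: less_imp_neq[OF vpos, symmetric])
  have ll: "log_likelihood q (f k) (u, a) = ln (real q * v k (u, a))" if "a \<in> {1..q}" for k u a
    unfolding f_def using vpos vsum that q by (intro log_likelihood_ln) auto
  have bound: "\<bar>ln (real q * v k (u, a))\<bar> \<le> ln (real q) - ln d" if a: "a \<in> {1..q}" for k u a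
  proof -
    have "d \<le> real q * v k (u, a)" using vlow[of "(u, a)" k] a q by (simp add: field_simps)
    then have "ln d \<le> ln (real q * v k (u, a))" using d by (intro ln_mono) auto
    moreover have "ln (real q * v k (u, a)) \<le> ln (real q)"
      using v1[OF a] vpos[of "(u, a)" k] a q by (intro ln_mono) (auto simp: mult_left_le)
    moreover have "ln (real q) \<ge> 0" "ln d \<le> 0" using q d by (auto simp: ln_le_zero_iff)
    ultimately show ?thesis by linarith
  qed
  let ?g = "\<lambda>k u. \<Sum>a\<in>{1..q}. \<alpha> a u * log_likelihood q (f k) (u, a)"
  let ?h = "\<lambda>u. \<Sum>a\<in>{1..q}. \<alpha> a u * ln (real q * ((1 - d) * \<alpha> a u + d / real q))"
  have fm [measurable]: "(\<lambda>u. log_likelihood q (f k) (u, a)) \<in> borel_measurable borel" if "a \<in> {1..q}" for k a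
    using continuous_on_coloured_slice[OF continuous_on_log_likelihood[OF q fc] that]
    by (rule borel_measurable_continuous_onI)
  have hm: "?h \<in> borel_measurable borel" by measurable
  have hlim: "AE u in base. (\<lambda>k. ?g k u) \<longlonglongrightarrow> ?h u"
    using AE w(4)
  proof eventually_elim
    case (elim u)
    show ?case
    proof (intro tendsto_sum tendsto_mult tendsto_const)
      fix a assume a: "a \<in> {1..q}"
      have "(1 - d) * \<alpha> a u + d / real q > 0"
        using elim(1) a d q by (intro add_nonneg_pos) auto
      then have "(\<lambda>k. ln (real q * v k (u, a))) \<longlonglongrightarrow> ln (real q * ((1 - d) * \<alpha> a u + d / real q))"
        unfolding v_def using elim(2) a q by (intro tendsto_intros) auto
      then show "(\<lambda>k. log_likelihood q (f k) (u, a)) \<longlonglongrightarrow> ln (real q * ((1 - d) * \<alpha> a u + d / real q))"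
        using ll[OF a] by simp
    qed
  qed
  have gb: "AE u in base. \<bar>?g k u\<bar> \<le> real q * (ln (real q) - ln d)" for k
    using AE
  proof eventually_elim
    case (elim u)
    have "\<bar>?g k u\<bar> \<le> (\<Sum>a\<in>{1..q}. \<bar>\<alpha> a u * log_likelihood q (f k) (u, a)\<bar>)" by (rule sum_abs)
    also have "\<dots> \<le> (\<Sum>a\<in>{1..q}. 1 * (ln (real q) - ln d))"
      unfolding abs_mult using elim bound ll by (intro sum_mono mult_mono) auto
    finally show ?case by simp
  qed
  have lim: "(\<lambda>k. LINT u|base. ?g k u) \<longlonglongrightarrow> (LINT u|base. ?h u)"
    by (rule integral_base_tendsto[OF _ hm hlim gb]) measurable
  have "(LINT u|base. entropy_eq q (\<lambda>a. \<alpha> a u) - e / 2) \<le> (LINT u|base. ?h u)"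
  proof (rule integral_mono_AE)
    show "integrable base (\<lambda>u. entropy_eq q (\<lambda>a. \<alpha> a u) - e / 2)"
      using integral_entropy_base(2)[OF \<alpha>] by simp
    show "integrable base ?h"
    proof (rule integrable_base_bounded[OF hm])
      have "AE u in base. \<forall>k. \<bar>?g k u\<bar> \<le> real q * (ln (real q) - ln d)"
        unfolding AE_all_countable using gb by blast
      with hlim show "AE u in base. \<bar>?h u\<bar> \<le> real q * (ln (real q) - ln d)"
      proof eventually_elim
        case (elim u)
        have "(\<lambda>k. \<bar>?g k u\<bar>) \<longlonglongrightarrow> \<bar>?h u\<bar>" using elim(1) by (rule tendsto_rabs)
        then show ?case by (rule LIMSEQ_le_const2) (use elim(2) in auto)
      qed
    qed
    show "AE u in base. entropy_eq q (\<lambda>a. \<alpha> a u) - e / 2 \<le> ?h u"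
      using AE
    proof eventually_elim
      case (elim u)
      have "\<alpha> a u * ln (real q * \<alpha> a u) + \<alpha> a u * ln (1 - d) \<le>
          \<alpha> a u * ln (real q * ((1 - d) * \<alpha> a u + d / real q))" if a: "a \<in> {1..q}" for a
      proof (cases "\<alpha> a u = 0")
        case False
        then have pos: "0 < \<alpha> a u" using elim a by (auto simp: less_le)
        have "ln (real q * \<alpha> a u) + ln (1 - d) = ln (real q * ((1 - d) * \<alpha> a u))"
          using pos d q by (simp add: ln_mult)
        also have "\<dots> \<le> ln (real q * ((1 - d) * \<alpha> a u + d / real q))"
          using pos d q by (intro ln_mono mult_left_mono) auto
        finally show ?thesis using pos unfolding distrib_left[symmetric] by (intro mult_left_mono) auto
      qed simp
      then have "(\<Sum>a\<in>{1..q}. \<alpha> a u * ln (real q * \<alpha> a u) + \<alpha> a u * ln (1 - d)) \<le> ?h u"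
        by (rule sum_mono)
      moreover have "(\<Sum>a\<in>{1..q}. \<alpha> a u * ln (1 - d)) = - (e / 2)"
        unfolding sum_distrib_right[symmetric] using elim d(3) by simp
      ultimately show ?case by (simp add: entropy_eq_def sum.distrib)
    qed
  qed
  then have "(LINT u|base. entropy_eq q (\<lambda>a. \<alpha> a u)) - e < (LINT u|base. ?h u)"
    using integral_entropy_base(2)[OF \<alpha>] e by (simp add: B.prob_space[simplified])
  then have "\<forall>\<^sub>F k in sequentially. (LINT u|base. entropy_eq q (\<lambda>a. \<alpha> a u)) - e < (LINT u|base. ?g k u)"
    using lim by (intro order_tendstoD)
  then obtain k where "(LINT u|base. entropy_eq q (\<lambda>a. \<alpha> a u)) - e < (LINT u|base. ?g k u)"
    using eventually_happens'[OF sequentially_bot] by blast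
  then show ?thesis
    using that[OF fc[of k]]
    by (simp only: represents_integral[OF \<nu> rep continuous_on_log_likelihood[OF q fc]] integral_entropy_base(1)[OF \<alpha>])
qed

text \<open>The measure has density \<open>w\<close> with respect to the product of
  \<open>base\<close> and counting measure on the colours; the normalisation of \<open>w\<close>
  makes it a probability measure.\<close>

lemma coloured_measure_exists:
  assumes w: "continuous_on (UNIV \<times> {1..q}) w" "\<And>z. z \<in> UNIV \<times> {1..q} \<Longrightarrow> 0 \<le> w z"
    "\<And>u. (\<Sum>a\<in>{1..q}. w (u, a)) = (1 :: real)"
  obtains \<nu> where "\<nu> \<in> prob_measures (coloured_torus q)"
    "\<And>f :: 'd torus \<times> nat \<Rightarrow> real. continuous_on (UNIV \<times> {1..q}) f \<Longrightarrow>
      (LINT z|\<nu>. f z) = (LINT u|base. (\<Sum>a\<in>{1..q}. w (u, a) * f (u, a)))"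
proof -
  interpret B: prob_space base by (rule prob_space_base)
  interpret C: finite_measure "count_space {1..q}" by (rule finite_measure_count_space) simp
  interpret BC: pair_sigma_finite base "count_space {1..q}" ..
  let ?N = "base \<Otimes>\<^sub>M count_space {1..q}"
  have spN: "space ?N = UNIV \<times> {1..q}" by (simp add: space_pair_measure)
  have id: "(\<lambda>z. z) \<in> ?N \<rightarrow>\<^sub>M coloured_torus q"
  proof -
    have [measurable]: "fst \<in> ?N \<rightarrow>\<^sub>M borel" "snd \<in> ?N \<rightarrow>\<^sub>M borel"
      using measurable_compose[OF measurable_snd, of "\<lambda>x. x" "count_space {1..q}" borel base]
        measurable_compose[OF measurable_fst, of "\<lambda>x. x" base borel "count_space {1..q}"]
      by (auto simp: measurable_base)
    have "(\<lambda>z. (fst z, snd z)) \<in> ?N \<rightarrow>\<^sub>M borel \<Otimes>\<^sub>M borel" by measurable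
    then show ?thesis
      unfolding coloured_torus_def borel_prod
      by (intro measurable_restrict_space2) (auto simp: space_pair_measure)
  qed
  have meas: "f \<in> borel_measurable ?N" if "continuous_on (UNIV \<times> {1..q}) f" for f :: "'d torus \<times> nat \<Rightarrow> real"
    using measurable_compose[OF id measurable_coloured_continuous[OF that]] .
  have finN: "finite_measure ?N"
  proof
    have "emeasure ?N (UNIV \<times> {1..q}) = emeasure base UNIV * emeasure (count_space {1..q}) {1..q}"
      by (rule C.emeasure_pair_measure_Times) auto
    also have "\<dots> \<noteq> \<infinity>" using B.emeasure_space_1 by simp
    finally show "emeasure ?N (space ?N) \<noteq> \<infinity>" unfolding spN .
  qed
  have int: "integrable ?N f" if f: "continuous_on (UNIV \<times> {1..q}) f" for f :: "'d torus \<times> nat \<Rightarrow> real"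
  proof -
    obtain C where "C > 0" "\<And>z. z \<in> UNIV \<times> {1..q} \<Longrightarrow> \<bar>f z\<bar> \<le> C"
      using bounded_coloured_continuous[OF f] by blast
    then show ?thesis
      using meas[OF f] spN by (intro finite_measure.integrable_const_bound[OF finN, of _ C]) auto
  qed
  have fub: "(LINT z|?N. f z) = (LINT u|base. (\<Sum>a\<in>{1..q}. f (u, a)))"
    if f: "continuous_on (UNIV \<times> {1..q}) f" for f :: "'d torus \<times> nat \<Rightarrow> real"
    using BC.integral_fst'[OF int[OF f]] by (simp add: lebesgue_integral_count_space_finite)
  have wnn: "AE z in ?N. 0 \<le> w z" using w(2) spN by (intro AE_I2) auto
  \<comment> \<open>The image under the identity only changes the sigma-algebra, from the product
    one to that of \<open>coloured_torus q\<close>.\<close>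
  define \<nu> where "\<nu> = distr (density ?N (\<lambda>z. ennreal (w z))) (coloured_torus q) (\<lambda>z. z)"
  have id': "(\<lambda>z. z) \<in> density ?N (\<lambda>z. ennreal (w z)) \<rightarrow>\<^sub>M coloured_torus q"
    using id by simp
  show ?thesis
  proof (rule that[of \<nu>])
    have "emeasure (density ?N (\<lambda>z. ennreal (w z))) (space ?N) =
        (\<integral>\<^sup>+z. ennreal (w z) * indicator (space ?N) z \<partial>?N)"
      by (intro emeasure_density sets.top measurable_compose[OF meas[OF w(1)] measurable_ennreal])
    also have "\<dots> = (\<integral>\<^sup>+z. ennreal (w z) \<partial>?N)"
      by (intro nn_integral_cong) (simp add: indicator_def)
    also have "\<dots> = ennreal (LINT z|?N. w z)"
      using int[OF w(1)] wnn by (rule nn_integral_eq_integral)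
    also have "\<dots> = 1" using fub[OF w(1)] w(3) B.prob_space by simp
    finally have "prob_space (density ?N (\<lambda>z. ennreal (w z)))" by (intro prob_spaceI) simp
    then show "\<nu> \<in> prob_measures (coloured_torus q)"
      unfolding \<nu>_def prob_measures_def using prob_space.prob_space_distr[OF _ id'] by simp
    fix f :: "'d torus \<times> nat \<Rightarrow> real" assume f: "continuous_on (UNIV \<times> {1..q}) f"
    have "(LINT z|\<nu>. f z) = (LINT z|density ?N (\<lambda>z. ennreal (w z)). f z)"
      unfolding \<nu>_def by (intro integral_distr id' measurable_coloured_continuous f)
    also have "\<dots> = (LINT z|?N. w z *\<^sub>R f z)"
      by (intro integral_density meas f w wnn)
    also have "\<dots> = (LINT u|base. (\<Sum>a\<in>{1..q}. w (u, a) * f (u, a)))"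
      using fub[of "\<lambda>z. w z * f z"] w(1) f by (simp add: continuous_on_mult)
    finally show "(LINT z|\<nu>. f z) = (LINT u|base. (\<Sum>a\<in>{1..q}. w (u, a) * f (u, a)))" .
  qed
qed

text \<open>A recovery sequence for the lower bound: positive continuous weights have continuous
  logarithms, as the change of measure demands. The entropies converge as well, because x ln (q x)
  is bounded on [0, 1].\<close>

lemma represented_measure_approx:
  assumes \<nu>: "\<nu> \<in> prob_measures (coloured_torus q)" and rep: "represents q r \<nu> \<alpha>"
  obtains w :: "nat \<Rightarrow> 'd torus \<times> nat \<Rightarrow> real" and N :: "nat \<Rightarrow> ('d torus \<times> nat) measure" where
    "\<And>k. continuous_on (UNIV \<times> {1..q}) (w k)"
    "\<And>k z. z \<in> UNIV \<times> {1..q} \<Longrightarrow> 0 < w k z" "\<And>k u. (\<Sum>a\<in>{1..q}. w k (u, a)) = 1"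
    "\<And>k. N k \<in> prob_measures (coloured_torus q)"
    "\<And>k f. continuous_on (UNIV \<times> {1..q}) f \<Longrightarrow>
      (LINT z|N k. f z) = (LINT u|base. (\<Sum>a\<in>{1..q}. w k (u, a) * f (u, a)) :: real)"
    "limitin (weak_topology q) N \<nu> sequentially"
    "(\<lambda>k. LINT z|N k. log_likelihood q (\<lambda>z. ln (w k z)) z) \<longlonglongrightarrow>
      (LINT u|torus_lebesgue. entropy_eq q (\<lambda>a. \<alpha> a u) * r u)"
proof -
  have \<alpha>: "\<alpha> \<in> local_profiles q" using rep by (simp add: represents_def)
  note AE = AE_baseI[OF local_profilesD(2)[OF \<alpha>]]
  note m [measurable] = local_profilesD(1)[OF \<alpha>]
  obtain w :: "nat \<Rightarrow> 'd torus \<times> nat \<Rightarrow> real" where w: "\<And>k. continuous_on (UNIV \<times> {1..q}) (w k)"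
    "\<And>k z. z \<in> UNIV \<times> {1..q} \<Longrightarrow> 0 < w k z" "\<And>k u. (\<Sum>a\<in>{1..q}. w k (u, a)) = 1"
    "AE u in base. \<forall>a\<in>{1..q}. (\<lambda>k. w k (u, a)) \<longlonglongrightarrow> \<alpha> a u"
    using continuous_profile_approx[OF \<alpha>] by blast
  have w1: "w k (u, a) \<le> 1" if "a \<in> {1..q}" for k u a
  proof -
    have "w k (u, a) \<le> (\<Sum>a\<in>{1..q}. w k (u, a))"
      using that by (intro member_le_sum less_imp_le[OF w(2)]) auto
    then show ?thesis by (simp only: w(3))
  qed
  define P where "P k M \<longleftrightarrow> M \<in> prob_measures (coloured_torus q) \<and>
      (\<forall>f :: 'd torus \<times> nat \<Rightarrow> real. continuous_on (UNIV \<times> {1..q}) f \<longrightarrow>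
        (LINT z|M. f z) = (LINT u|base. (\<Sum>a\<in>{1..q}. w k (u, a) * f (u, a))))" for k M
  have "\<exists>M. P k M" for k
    by (rule coloured_measure_exists[OF w(1) less_imp_le[OF w(2)] w(3)]) (auto simp: P_def)
  then obtain N where "\<And>k. P k (N k)" by metis
  then have N: "N k \<in> prob_measures (coloured_torus q)"
    "continuous_on (UNIV \<times> {1..q}) f \<Longrightarrow>
      (LINT z|N k. f z) = (LINT u|base. (\<Sum>a\<in>{1..q}. w k (u, a) * f (u, a)))"
    for k and f :: "'d torus \<times> nat \<Rightarrow> real"
    unfolding P_def by blast+
  have wm [measurable]: "(\<lambda>u. w k (u, a)) \<in> borel_measurable borel" if "a \<in> {1..q}" for k a
    using continuous_on_coloured_slice[OF w(1) that] by (rule borel_measurable_continuous_onI)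
  have lim: "limitin (weak_topology q) N \<nu> sequentially"
  proof (rule limitin_weak_topology[OF \<nu> N(1)])
    fix f :: "'d torus \<times> nat \<Rightarrow> real" assume f: "continuous_on (UNIV \<times> {1..q}) f"
    have fm [measurable]: "(\<lambda>u. f (u, a)) \<in> borel_measurable borel" if "a \<in> {1..q}" for a
      using continuous_on_coloured_slice[OF f that] by (rule borel_measurable_continuous_onI)
    obtain C where C: "C > 0" "\<And>z. z \<in> UNIV \<times> {1..q} \<Longrightarrow> \<bar>f z\<bar> \<le> C"
      using bounded_coloured_continuous[OF f] by blast
    have "(\<lambda>k. LINT u|base. (\<Sum>a\<in>{1..q}. w k (u, a) * f (u, a))) \<longlonglongrightarrow>
        (LINT u|base. (\<Sum>a\<in>{1..q}. \<alpha> a u * f (u, a)))"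
    proof (rule integral_base_tendsto[where C = "real q * C"])
      show "AE u in base. (\<lambda>k. \<Sum>a\<in>{1..q}. w k (u, a) * f (u, a)) \<longlonglongrightarrow> (\<Sum>a\<in>{1..q}. \<alpha> a u * f (u, a))"
        using w(4)
      proof eventually_elim
        case (elim u)
        show ?case
          by (intro tendsto_sum tendsto_mult_right) (use elim in blast)
      qed
      show "AE u in base. \<bar>\<Sum>a\<in>{1..q}. w k (u, a) * f (u, a)\<bar> \<le> real q * C" for k
      proof (rule AE_I2)
        fix u
        have "\<bar>\<Sum>a\<in>{1..q}. w k (u, a) * f (u, a)\<bar> \<le> (\<Sum>a\<in>{1..q}. \<bar>w k (u, a) * f (u, a)\<bar>)" by (rule sum_abs)
        also have "\<dots> \<le> (\<Sum>a\<in>{1..q}. 1 * C)"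
          unfolding abs_mult using w1 w(2) C by (intro sum_mono mult_mono) (auto simp: abs_of_pos)
        finally show "\<bar>\<Sum>a\<in>{1..q}. w k (u, a) * f (u, a)\<bar> \<le> real q * C" by simp
      qed
    qed measurable
    then show "(\<lambda>k. LINT z|N k. f z) \<longlonglongrightarrow> (LINT z|\<nu>. f z)"
      by (simp only: N(2)[OF f] represents_integral[OF \<nu> rep f])
  qed
  have lnc: "continuous_on (UNIV \<times> {1..q}) (\<lambda>z. ln (w k z))" for k
    using w(1,2) by (intro continuous_on_ln) (auto simp: less_imp_neq[OF w(2), symmetric])
  \<comment> \<open>For \<open>f = ln w\<close> the log-likelihood is the logarithm of q w, so its
    integral under \<open>N k\<close> is the entropy of \<open>N k\<close> itself.\<close>
  have "(LINT z|N k. log_likelihood q (\<lambda>z. ln (w k z)) z) =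
      (LINT u|base. (\<Sum>a\<in>{1..q}. w k (u, a) * ln (real q * w k (u, a))))" for k
    unfolding N(2)[OF continuous_on_log_likelihood[OF q lnc]]
    using w(2,3) q by (intro Bochner_Integration.integral_cong sum.cong refl arg_cong2[where f = times] log_likelihood_ln) auto
  moreover have "(\<lambda>k. LINT u|base. (\<Sum>a\<in>{1..q}. w k (u, a) * ln (real q * w k (u, a)))) \<longlonglongrightarrow>
      (LINT u|base. entropy_eq q (\<lambda>a. \<alpha> a u))"
  proof (rule integral_base_tendsto[where C = "real q * real q"])
    show "AE u in base. (\<lambda>k. \<Sum>a\<in>{1..q}. w k (u, a) * ln (real q * w k (u, a))) \<longlonglongrightarrow> entropy_eq q (\<lambda>a. \<alpha> a u)"
      using w(4)
    proof eventually_elim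
      case (elim u)
      show ?case
        unfolding entropy_eq_def
        by (intro tendsto_sum tendsto_xlogx[OF q]) (use elim w(2) in auto)
    qed
    show "AE u in base. \<bar>\<Sum>a\<in>{1..q}. w k (u, a) * ln (real q * w k (u, a))\<bar> \<le> real q * real q" for k
    proof (rule AE_I2)
      fix u
      have "\<bar>\<Sum>a\<in>{1..q}. w k (u, a) * ln (real q * w k (u, a))\<bar> \<le> (\<Sum>a\<in>{1..q}. real q)"
        using w1 w(2) q by (intro order_trans[OF sum_abs] sum_mono abs_xlogx_le) (auto intro: less_imp_le)
      then show "\<bar>\<Sum>a\<in>{1..q}. w k (u, a) * ln (real q * w k (u, a))\<bar> \<le> real q * real q" by simp
    qed
    show "(\<lambda>u. entropy_eq q (\<lambda>a. \<alpha> a u)) \<in> borel_measurable borel" by (rule integral_entropy_base(3)[OF \<alpha>])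
  qed measurable
  ultimately have "(\<lambda>k. LINT z|N k. log_likelihood q (\<lambda>z. ln (w k z)) z) \<longlonglongrightarrow>
      (LINT u|torus_lebesgue. entropy_eq q (\<lambda>a. \<alpha> a u) * r u)"
    by (simp only: integral_entropy_base(1)[OF \<alpha>])
  then show ?thesis using that[OF w(1-3) N lim] by simp
qed

end

section \<open>Colour profiles and Gibbs weights\<close>

text \<open>As for the colour parts, an image measure supplies the countable additivity behind
  \<open>measure_of\<close>: the profile is the law of site and colour at a uniformly chosen point
  of \<open>L\<close>.\<close>

lemma colour_profile_eq_distr:
  assumes L: "finite L" "L \<noteq> {}" and \<sigma>: "\<sigma> \<in> L \<rightarrow> {1..q}"
  shows "colour_profile q n L \<sigma> =
    distr (uniform_count_measure L) (coloured_torus q) (\<lambda>x. (site n x, \<sigma> x))"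
    and "(\<lambda>x. (site n x, \<sigma> x)) \<in> uniform_count_measure L \<rightarrow>\<^sub>M coloured_torus q"
proof -
  let ?X = "\<lambda>x. (site n x, \<sigma> x)"
  show X: "?X \<in> uniform_count_measure L \<rightarrow>\<^sub>M coloured_torus q"
    using \<sigma> by (intro measurableI) (auto simp: space_uniform_count_measure sets_uniform_count_measure space_coloured_torus)
  have "ennreal ((1 / real (card L)) * (\<Sum>a\<in>{1..q}. \<Sum>x\<in>L. if \<sigma> x = a then indicator A (site n x, a) else 0)) =
      emeasure (uniform_count_measure L) (?X -` A \<inter> L)" for A :: "('a torus \<times> nat) set"
  proof -
    have "(\<Sum>a\<in>{1..q}. \<Sum>x\<in>L. if \<sigma> x = a then indicator A (site n x, a) else 0) =
        (\<Sum>x\<in>L. \<Sum>a\<in>{1..q}. if \<sigma> x = a then indicator A (site n x, a) else 0 :: real)"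
      by (rule sum.swap)
    also have "\<dots> = (\<Sum>x\<in>L. indicator A (?X x))"
    proof (rule sum.cong[OF refl])
      fix x assume "x \<in> L"
      then have "\<sigma> x \<in> {1..q}" using \<sigma> by auto
      then show "(\<Sum>a\<in>{1..q}. if \<sigma> x = a then indicator A (site n x, a) else 0) = (indicator A (?X x) :: real)"
        by (subst sum.delta') auto
    qed
    also have "\<dots> = (\<Sum>x\<in>L. if x \<in> ?X -` A then 1 else 0)"
      by (intro sum.cong) (auto simp: indicator_def)
    also have "\<dots> = (\<Sum>x\<in>L \<inter> ?X -` A. 1)"
      by (rule sum.inter_restrict[OF L(1), symmetric])
    also have "\<dots> = real (card (?X -` A \<inter> L))" by (simp add: Int_commute)
    finally show ?thesis
      using L by (subst emeasure_uniform_count_measure) auto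
  qed
  then show "colour_profile q n L \<sigma> = distr (uniform_count_measure L) (coloured_torus q) ?X"
    unfolding colour_profile_def distr_def space_uniform_count_measure by simp
qed

lemma colour_profile_in_prob_measures:
  assumes L: "finite L" "L \<noteq> {}" and \<sigma>: "\<sigma> \<in> L \<rightarrow> {1..q}"
  shows "colour_profile q n L \<sigma> \<in> prob_measures (coloured_torus q)"
  unfolding colour_profile_eq_distr(1)[OF assms] prob_measures_def
  using prob_space.prob_space_distr[OF prob_space_uniform_count_measure[OF L] colour_profile_eq_distr(2)[OF assms]]
  by simp

lemma integral_colour_profile:
  fixes f :: "'d::finite torus \<times> nat \<Rightarrow> real"
  assumes L: "finite L" "L \<noteq> {}" and \<sigma>: "\<sigma> \<in> L \<rightarrow> {1..q}" and f: "continuous_on (UNIV \<times> {1..q}) f"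
  shows "(LINT z|colour_profile q n L \<sigma>. f z) = (\<Sum>x\<in>L. f (site n x, \<sigma> x)) / real (card L)"
proof -
  have "(LINT z|colour_profile q n L \<sigma>. f z) = (LINT x|uniform_count_measure L. f (site n x, \<sigma> x))"
    unfolding colour_profile_eq_distr(1)[OF L \<sigma>]
    by (intro integral_distr colour_profile_eq_distr(2)[OF L \<sigma>] measurable_coloured_continuous f)
  also have "\<dots> = (\<Sum>x\<in>L. f (site n x, \<sigma> x)) / real (card L)"
    unfolding uniform_count_measure_def using L(1)
    by (subst lebesgue_integral_point_measure_finite) (auto simp: sum_divide_distrib)
  finally show ?thesis .
qed

text \<open>The identity is exact, without an error term, because the Hamiltonian and the double
  integral both contain the diagonal x = y. Of the two averages over \<open>L\<close> in the
  interaction, the Hamiltonian keeps one.\<close>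

lemma potts_hamiltonian_interaction:
  assumes L: "finite L" "L \<noteq> {}" and \<sigma>: "\<sigma> \<in> L \<rightarrow> {1..q}" and J: "continuous_on UNIV J"
  shows "- potts_hamiltonian J n L \<sigma> = real (card L) * interaction J (colour_profile q n L \<sigma>)"
proof -
  have K: "continuous_on (UNIV \<times> {1..q}) (\<lambda>z. colour_kernel J (z, w))" for w
    by (intro continuous_on_compose2[OF continuous_on_colour_kernel[OF J, of UNIV]]) (auto intro!: continuous_intros)
  have "interaction J (colour_profile q n L \<sigma>) =
      (\<Sum>y\<in>L. (\<Sum>x\<in>L. colour_kernel J ((site n x, \<sigma> x), (site n y, \<sigma> y))) / real (card L)) / real (card L)"
    unfolding interaction_def
    using continuous_on_kernel_integral[OF colour_profile_in_prob_measures[OF L \<sigma>] continuous_on_colour_kernel[OF J]]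
    by (subst integral_colour_profile[OF L \<sigma>]) (auto simp: integral_colour_profile[OF L \<sigma> K])
  also have "\<dots> = (\<Sum>y\<in>L. \<Sum>x\<in>L. colour_kernel J ((site n x, \<sigma> x), (site n y, \<sigma> y))) / real (card L) / real (card L)"
    by (simp only: sum_divide_distrib)
  also have "(\<Sum>y\<in>L. \<Sum>x\<in>L. colour_kernel J ((site n x, \<sigma> x), (site n y, \<sigma> y))) =
      (\<Sum>x\<in>L. \<Sum>y\<in>L. J (site n x - site n y) * (if \<sigma> x = \<sigma> y then 1 else 0))"
    by (rule trans[OF sum.swap]) (simp add: colour_kernel_def of_bool_def)
  finally show ?thesis
    using L by (simp add: potts_hamiltonian_def)
qed

text \<open>The exponent is additive over sites, so the sum over configurations factorises into one
  sum over colours per site, each equal to q.\<close>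

lemma sum_exp_log_likelihood_profile:
  assumes L: "finite L" "L \<noteq> {}" and q: "q \<ge> 1" and f: "continuous_on (UNIV \<times> {1..q}) f"
  shows "(\<Sum>\<sigma>\<in>L \<rightarrow>\<^sub>E {1..q}. exp (real (card L) * (LINT z|colour_profile q n L \<sigma>. log_likelihood q f z))) =
    real q ^ card L"
proof -
  have "(\<Sum>\<sigma>\<in>L \<rightarrow>\<^sub>E {1..q}. exp (real (card L) * (LINT z|colour_profile q n L \<sigma>. log_likelihood q f z))) =
      (\<Sum>\<sigma>\<in>L \<rightarrow>\<^sub>E {1..q}. \<Prod>x\<in>L. exp (log_likelihood q f (site n x, \<sigma> x)))"
  proof (rule sum.cong[OF refl])
    fix \<sigma> assume "\<sigma> \<in> L \<rightarrow>\<^sub>E {1..q}"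
    then have "\<sigma> \<in> L \<rightarrow> {1..q}" by auto
    then show "exp (real (card L) * (LINT z|colour_profile q n L \<sigma>. log_likelihood q f z)) =
        (\<Prod>x\<in>L. exp (log_likelihood q f (site n x, \<sigma> x)))"
      using L by (subst integral_colour_profile[OF L _ continuous_on_log_likelihood[OF q f]]) (auto simp: exp_sum)
  qed
  also have "\<dots> = (\<Prod>x\<in>L. \<Sum>a\<in>{1..q}. exp (log_likelihood q f (site n x, a)))"
    using L by (intro prod_sum_PiE[symmetric]) auto
  also have "\<dots> = real q ^ card L" by (simp only: sum_exp_log_likelihood[OF q] prod_constant)
  finally show ?thesis .
qed

text \<open>Kept unnormalised, so that the same estimates serve an event and the partition function,
  which is the weight of the whole space.\<close>

definition gibbs_weight ::
    "('d::finite torus \<Rightarrow> real) \<Rightarrow> real \<Rightarrow> nat \<Rightarrow> nat \<Rightarrow> (int ^ 'd) set \<Rightarrow> ('d torus \<times> nat) measure set \<Rightarrow> real" where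
  "gibbs_weight J \<beta> q n L A = (\<Sum>\<sigma> | \<sigma> \<in> L \<rightarrow>\<^sub>E {1..q} \<and> colour_profile q n L \<sigma> \<in> A.
     exp (real (card L) * (\<beta> * interaction J (colour_profile q n L \<sigma>))))"

lemma finite_configurations: "finite L \<Longrightarrow> finite (L \<rightarrow>\<^sub>E {1..q::nat})"
  by (intro finite_PiE) auto

lemma gibbs_weight_mono:
  assumes "finite L" "A \<subseteq> B"
  shows "gibbs_weight J \<beta> q n L A \<le> gibbs_weight J \<beta> q n L B"
  unfolding gibbs_weight_def
proof (rule sum_mono2)
  show "finite {\<sigma>. \<sigma> \<in> L \<rightarrow>\<^sub>E {1..q} \<and> colour_profile q n L \<sigma> \<in> B}"
    using finite_configurations[OF assms(1)] by (rule rev_finite_subset) auto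
qed (use assms(2) in auto)

lemma gibbs_weight_nonneg: "0 \<le> gibbs_weight J \<beta> q n L A"
  unfolding gibbs_weight_def by (intro sum_nonneg) auto

text \<open>Restricting \<open>A\<close> to open or closed sets makes it measurable at once. The
  profile map is measurable because every set of configurations is.\<close>

lemma measure_profile_law:
  assumes L: "finite L" "L \<noteq> {}" and J: "continuous_on UNIV J"
    and A: "openin (weak_topology q) A \<or> closedin (weak_topology q) A"
  shows "measure (profile_law J \<beta> q n L) A =
    gibbs_weight J \<beta> q n L A / gibbs_weight J \<beta> q n L (prob_measures (coloured_torus q))"
proof -
  let ?P = "prob_measures (coloured_torus q) :: ('a torus \<times> nat) measure set"
  let ?C = "L \<rightarrow>\<^sub>E {1..q}"
  let ?e = "\<lambda>\<sigma>. exp (real (card L) * (\<beta> * interaction J (colour_profile q n L \<sigma>)))"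
  let ?Z = "gibbs_weight J \<beta> q n L ?P"
  have fin: "finite ?C" using L(1) by (rule finite_configurations)
  have prof: "colour_profile q n L \<sigma> \<in> ?P" if "\<sigma> \<in> ?C" for \<sigma>
    using that by (intro colour_profile_in_prob_measures L) auto
  have e: "exp (- \<beta> * potts_hamiltonian J n L \<sigma>) = ?e \<sigma>" if "\<sigma> \<in> ?C" for \<sigma>
  proof -
    have "\<sigma> \<in> L \<rightarrow> {1..q}" using that by auto
    note H = potts_hamiltonian_interaction[OF L this J, of n]
    have "- \<beta> * potts_hamiltonian J n L \<sigma> = \<beta> * (- potts_hamiltonian J n L \<sigma>)" by simp
    also have "\<dots> = real (card L) * (\<beta> * interaction J (colour_profile q n L \<sigma>))"
      unfolding H by (rule mult.left_commute)
    finally show ?thesis by (simp only:)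
  qed
  have Z: "(\<Sum>\<tau>\<in>?C. exp (- \<beta> * potts_hamiltonian J n L \<tau>)) = ?Z"
  proof -
    have "{\<sigma>. \<sigma> \<in> ?C \<and> colour_profile q n L \<sigma> \<in> ?P} = ?C" using prof by auto
    then show ?thesis unfolding gibbs_weight_def by (intro sum.cong e) auto
  qed
  have Znn: "0 \<le> ?Z" by (rule gibbs_weight_nonneg)
  have sub: "{U. openin (weak_topology q) U} \<subseteq> Pow (topspace (weak_topology q))"
    by (auto dest: openin_subset)
  have spB: "space (borel_space_of (weak_topology q)) = ?P"
    unfolding borel_space_of_def by (simp add: space_measure_of_conv topspace_weak_topology)
  have As: "A \<in> sets (borel_space_of (weak_topology q))"
  proof -
    have op: "U \<in> sets (borel_space_of (weak_topology q))" if "openin (weak_topology q) U" for U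
      unfolding borel_space_of_def sets_measure_of[OF sub] using that by (intro sigma_sets.Basic) simp
    show ?thesis
    proof (cases "openin (weak_topology q) A")
      case False
      with A have cl: "closedin (weak_topology q) A" by blast
      then have "openin (weak_topology q) (?P - A)"
        by (simp add: closedin_def topspace_weak_topology)
      from sets.compl_sets[OF op[OF this]] have "?P - (?P - A) \<in> sets (borel_space_of (weak_topology q))"
        unfolding spB .
      moreover have "?P - (?P - A) = A"
        using closedin_subset[OF cl] by (auto simp: topspace_weak_topology)
      ultimately show ?thesis by simp
    qed (rule op)
  qed
  have meas: "colour_profile q n L \<in> kac_potts J \<beta> q n L \<rightarrow>\<^sub>M borel_space_of (weak_topology q)"
  proof (rule measurableI)
    fix \<sigma> assume "\<sigma> \<in> space (kac_potts J \<beta> q n L)"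
    then show "colour_profile q n L \<sigma> \<in> space (borel_space_of (weak_topology q))"
      unfolding spB by (intro prof) (simp add: kac_potts_def space_point_measure)
  qed (simp add: kac_potts_def space_point_measure sets_point_measure)
  let ?S = "{\<sigma>. \<sigma> \<in> ?C \<and> colour_profile q n L \<sigma> \<in> A}"
  have "emeasure (profile_law J \<beta> q n L) A = emeasure (kac_potts J \<beta> q n L) (colour_profile q n L -` A \<inter> ?C)"
    unfolding profile_law_def using emeasure_distr[OF meas As] by (simp add: kac_potts_def space_point_measure)
  also have "colour_profile q n L -` A \<inter> ?C = ?S" by auto
  also have "emeasure (kac_potts J \<beta> q n L) ?S = (\<Sum>\<sigma>\<in>?S. ennreal (exp (- \<beta> * potts_hamiltonian J n L \<sigma>) / ?Z))"
    unfolding kac_potts_def Z using fin by (intro emeasure_point_measure_finite) auto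
  also have "\<dots> = (\<Sum>\<sigma>\<in>?S. ennreal (?e \<sigma> / ?Z))"
    using e by (intro sum.cong) auto
  also have "\<dots> = ennreal (\<Sum>\<sigma>\<in>?S. ?e \<sigma> / ?Z)"
    using Znn by (intro sum_ennreal) auto
  also have "(\<Sum>\<sigma>\<in>?S. ?e \<sigma> / ?Z) = gibbs_weight J \<beta> q n L A / ?Z"
    by (simp add: gibbs_weight_def flip: sum_divide_distrib)
  finally show ?thesis
    by (simp only: measure_def enn2real_ennreal[OF divide_nonneg_nonneg[OF gibbs_weight_nonneg gibbs_weight_nonneg]])
qed

text \<open>The uniform distribution on \<open>L\<close>, pushed to sites and colours, is a pmf with
  the same integrals as the profile, which makes the curve argument applicable.\<close>

lemma profile_subsequence_limit:
  assumes L: "\<And>k. finite (L k)" "\<And>k. L k \<noteq> {}" and \<sigma>: "\<And>k. \<sigma> k \<in> L k \<rightarrow> {1..q}"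
  obtains s :: "nat \<Rightarrow> nat" and \<nu> :: "('d::finite torus \<times> nat) measure" where
    "strict_mono s" "\<nu> \<in> prob_measures (coloured_torus q)"
    "\<And>f :: 'd torus \<times> nat \<Rightarrow> real. continuous_on (UNIV \<times> {1..q}) f \<Longrightarrow>
      (\<lambda>k. LINT z|colour_profile q (m (s k)) (L (s k)) (\<sigma> (s k)). f z) \<longlonglongrightarrow> (LINT z|\<nu>. f z)"
proof -
  obtain K :: "real set" and \<Psi> :: "real \<Rightarrow> 'd torus \<times> nat" where
    K: "compact K" "continuous_on K \<Psi>" "\<Psi> ` K = UNIV \<times> {1..q}"
    using coloured_torus_curve by blast
  define p where "p k = map_pmf (\<lambda>x. (site (m k) x, \<sigma> k x)) (pmf_of_set (L k))" for k
  have p: "set_pmf (p k) \<subseteq> \<Psi> ` K" for k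
    using \<sigma>[of k] L[of k] unfolding K(3) p_def by auto
  have int: "measure_pmf.expectation (p k) f = (LINT z|colour_profile q (m k) (L k) (\<sigma> k). f z)"
    if "continuous_on (UNIV \<times> {1..q}) f" for k and f :: "'d torus \<times> nat \<Rightarrow> real"
    using L[of k] integral_colour_profile[OF L \<sigma> that, of "m k" k] unfolding p_def
    by (simp add: integral_pmf_of_set)
  obtain s \<nu> where s: "strict_mono s" "prob_space \<nu>" "sets \<nu> = sets (restrict_space borel (\<Psi> ` K))"
    "\<And>f :: 'd torus \<times> nat \<Rightarrow> real. continuous_on (\<Psi> ` K) f \<Longrightarrow>
      (\<lambda>k. measure_pmf.expectation (p (s k)) f) \<longlonglongrightarrow> (LINT z|\<nu>. f z)"
    using weak_limit_along_curve[of K \<Psi> p, OF K(1,2) p] by blast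
  show ?thesis
  proof (rule that[OF s(1), of \<nu>])
    show "\<nu> \<in> prob_measures (coloured_torus q)"
      using s(2,3) by (simp add: prob_measures_def coloured_torus_def K(3))
    fix f :: "'d torus \<times> nat \<Rightarrow> real" assume "continuous_on (UNIV \<times> {1..q}) f"
    then show "(\<lambda>k. LINT z|colour_profile q (m (s k)) (L (s k)) (\<sigma> (s k)). f z) \<longlonglongrightarrow> (LINT z|\<nu>. f z)"
      using s(4)[unfolded K(3)] by (simp add: int)
  qed
qed

section \<open>Large deviation bounds\<close>

lemma exp_le_quadratic:
  fixes x :: real
  assumes "\<bar>x\<bar> \<le> 1"
  shows "exp x \<le> 1 + x + x\<^sup>2"
proof (cases "0 \<le> x")
  case True
  then show ?thesis using assms by (intro exp_bound) auto
next
  case False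
  define z where "z = - x"
  have z: "0 \<le> z" using False by (simp add: z_def)
  \<comment> \<open>The product of the claimed bound for \<open>exp (- z)\<close> with the quadratic
    Taylor bound for \<open>exp z\<close> is at least 1, and the latter lies below
    \<open>exp z\<close>.\<close>
  have "1 \<le> 1 + z\<^sup>2 / 2 + z ^ 3 / 2 + z ^ 4 / 2" using z by simp
  also have "\<dots> = (1 - z + z\<^sup>2) * (1 + z + z\<^sup>2 / 2)"
    by (simp add: field_simps power2_eq_square power3_eq_cube power4_eq_xxxx)
  also have "\<dots> \<le> (1 - z + z\<^sup>2) * exp z"
  proof (rule mult_left_mono[OF exp_lower_Taylor_quadratic[OF z]])
    have "1 - z + z\<^sup>2 = (z - 1 / 2)\<^sup>2 + 3 / 4" by (simp add: power2_eq_square field_simps)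
    then show "0 \<le> 1 - z + z\<^sup>2" by simp
  qed
  finally have "1 * exp (- z) \<le> ((1 - z + z\<^sup>2) * exp z) * exp (- z)"
    by (intro mult_right_mono) auto
  then show ?thesis by (simp add: z_def mult.assoc flip: exp_add)
qed

text \<open>Chernoff's bound for the variables \<open>Y x\<close>, which are independent and centred under the product
  weights \<open>w\<close>.\<close>

lemma product_weight_deviation:
  fixes w Y :: "'a \<Rightarrow> 'b \<Rightarrow> real"
  assumes L: "finite L" and A: "finite A"
    and w: "\<And>x a. x \<in> L \<Longrightarrow> a \<in> A \<Longrightarrow> 0 \<le> w x a" "\<And>x. x \<in> L \<Longrightarrow> (\<Sum>a\<in>A. w x a) = 1"
    and Y: "\<And>x a. x \<in> L \<Longrightarrow> a \<in> A \<Longrightarrow> \<bar>Y x a\<bar> \<le> B" "\<And>x. x \<in> L \<Longrightarrow> (\<Sum>a\<in>A. w x a * Y x a) = 0"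
    and t: "0 \<le> t" "t * B \<le> 1"
  shows "(\<Sum>\<sigma> | \<sigma> \<in> L \<rightarrow>\<^sub>E A \<and> real (card L) * \<delta> \<le> (\<Sum>x\<in>L. Y x (\<sigma> x)). \<Prod>x\<in>L. w x (\<sigma> x)) \<le>
    exp (real (card L) * (t\<^sup>2 * B\<^sup>2 - t * \<delta>))"
proof -
  have fin: "finite (L \<rightarrow>\<^sub>E A)" using L A by (intro finite_PiE) auto
  have wp: "0 \<le> (\<Prod>x\<in>L. w x (\<sigma> x))" if "\<sigma> \<in> L \<rightarrow>\<^sub>E A" for \<sigma>
    using that w(1) by (intro prod_nonneg) auto
  have "(\<Sum>\<sigma> | \<sigma> \<in> L \<rightarrow>\<^sub>E A \<and> real (card L) * \<delta> \<le> (\<Sum>x\<in>L. Y x (\<sigma> x)). \<Prod>x\<in>L. w x (\<sigma> x)) \<le>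
      (\<Sum>\<sigma> | \<sigma> \<in> L \<rightarrow>\<^sub>E A \<and> real (card L) * \<delta> \<le> (\<Sum>x\<in>L. Y x (\<sigma> x)).
        (\<Prod>x\<in>L. w x (\<sigma> x)) * exp (t * ((\<Sum>x\<in>L. Y x (\<sigma> x)) - real (card L) * \<delta>)))"
  proof (rule sum_mono)
    fix \<sigma> assume "\<sigma> \<in> {\<sigma>. \<sigma> \<in> L \<rightarrow>\<^sub>E A \<and> real (card L) * \<delta> \<le> (\<Sum>x\<in>L. Y x (\<sigma> x))}"
    then have \<sigma>: "\<sigma> \<in> L \<rightarrow>\<^sub>E A" "real (card L) * \<delta> \<le> (\<Sum>x\<in>L. Y x (\<sigma> x))" by auto
    have "1 \<le> exp (t * ((\<Sum>x\<in>L. Y x (\<sigma> x)) - real (card L) * \<delta>))"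
      using \<sigma>(2) t(1) by simp
    then show "(\<Prod>x\<in>L. w x (\<sigma> x)) \<le>
        (\<Prod>x\<in>L. w x (\<sigma> x)) * exp (t * ((\<Sum>x\<in>L. Y x (\<sigma> x)) - real (card L) * \<delta>))"
      using mult_left_mono[OF _ wp[OF \<sigma>(1)]] by fastforce
  qed
  also have "\<dots> \<le> (\<Sum>\<sigma>\<in>L \<rightarrow>\<^sub>E A.
      (\<Prod>x\<in>L. w x (\<sigma> x)) * exp (t * ((\<Sum>x\<in>L. Y x (\<sigma> x)) - real (card L) * \<delta>)))"
    using wp by (intro sum_mono2[OF fin]) auto
  also have "\<dots> = (\<Sum>\<sigma>\<in>L \<rightarrow>\<^sub>E A. \<Prod>x\<in>L. w x (\<sigma> x) * exp (t * Y x (\<sigma> x) - t * \<delta>))"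
    using L by (simp add: prod.distrib right_diff_distrib sum_subtractf sum_distrib_left mult.left_commute flip: exp_sum)
  also have "\<dots> = (\<Prod>x\<in>L. \<Sum>a\<in>A. w x a * exp (t * Y x a - t * \<delta>))"
    using L A by (intro prod_sum_PiE[symmetric]) auto
  also have "\<dots> \<le> (\<Prod>x\<in>L. exp (t\<^sup>2 * B\<^sup>2 - t * \<delta>))"
  proof (rule prod_mono)
    fix x assume x: "x \<in> L"
    have "(\<Sum>a\<in>A. w x a * exp (t * Y x a - t * \<delta>)) = (\<Sum>a\<in>A. w x a * exp (t * Y x a)) * exp (- (t * \<delta>))"
      by (simp add: exp_diff exp_minus divide_inverse sum_distrib_right mult.assoc)
    also have "\<dots> \<le> exp (t\<^sup>2 * B\<^sup>2) * exp (- (t * \<delta>))"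
    proof (rule mult_right_mono)
      \<comment> \<open>\<open>t * B \<le> 1\<close> keeps the exponent in the range of the
        quadratic bound; centring then removes the linear term on average.\<close>
      have "(\<Sum>a\<in>A. w x a * exp (t * Y x a)) \<le> (\<Sum>a\<in>A. w x a * (1 + t * Y x a + t\<^sup>2 * B\<^sup>2))"
      proof (rule sum_mono)
        fix a assume a: "a \<in> A"
        have b: "\<bar>t * Y x a\<bar> \<le> t * B"
          using mult_left_mono[OF Y(1)[OF x a] t(1)] t(1) by (simp add: abs_mult)
        have "(t * Y x a)\<^sup>2 \<le> (t * B)\<^sup>2" using power_mono[OF b, of 2] by simp
        moreover have "exp (t * Y x a) \<le> 1 + t * Y x a + (t * Y x a)\<^sup>2"
          using b t(2) by (intro exp_le_quadratic) linarith
        ultimately have "exp (t * Y x a) \<le> 1 + t * Y x a + t\<^sup>2 * B\<^sup>2" by (simp add: power_mult_distrib)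
        then show "w x a * exp (t * Y x a) \<le> w x a * (1 + t * Y x a + t\<^sup>2 * B\<^sup>2)"
          using w(1)[OF x a] by (rule mult_left_mono)
      qed
      also have "\<dots> = (\<Sum>a\<in>A. w x a) + t * (\<Sum>a\<in>A. w x a * Y x a) + t\<^sup>2 * B\<^sup>2 * (\<Sum>a\<in>A. w x a)"
        by (simp add: sum_distrib_left sum_distrib_right distrib_left sum.distrib mult_ac)
      also have "\<dots> = 1 + t\<^sup>2 * B\<^sup>2" using w(2)[OF x] Y(2)[OF x] by simp
      also have "\<dots> \<le> exp (t\<^sup>2 * B\<^sup>2)" by (rule exp_ge_add_one_self)
      finally show "(\<Sum>a\<in>A. w x a * exp (t * Y x a)) \<le> exp (t\<^sup>2 * B\<^sup>2)" .
    qed simp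
    also have "\<dots> = exp (t\<^sup>2 * B\<^sup>2 - t * \<delta>)" by (simp add: exp_diff exp_minus divide_inverse)
    finally show "0 \<le> (\<Sum>a\<in>A. w x a * exp (t * Y x a - t * \<delta>)) \<and>
        (\<Sum>a\<in>A. w x a * exp (t * Y x a - t * \<delta>)) \<le> exp (t\<^sup>2 * B\<^sup>2 - t * \<delta>)"
      using w(1)[OF x] by (auto intro!: sum_nonneg)
  qed
  also have "\<dots> = exp (real (card L) * (t\<^sup>2 * B\<^sup>2 - t * \<delta>))" by (simp flip: exp_of_nat_mult)
  finally show ?thesis .
qed

lemma finite_discrete_torus: "finite (discrete_torus n :: (int ^ 'd::finite) set)"
proof -
  have "discrete_torus n \<subseteq> vec_lambda ` (UNIV \<rightarrow>\<^sub>E {0..<int n} :: ('d \<Rightarrow> int) set)"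
  proof
    fix x :: "int ^ 'd" assume "x \<in> discrete_torus n"
    then have "vec_nth x \<in> UNIV \<rightarrow>\<^sub>E {0..<int n}" by (auto simp: discrete_torus_def)
    then have "vec_lambda (vec_nth x) \<in> vec_lambda ` (UNIV \<rightarrow>\<^sub>E {0..<int n})" by (rule imageI)
    then show "x \<in> vec_lambda ` (UNIV \<rightarrow>\<^sub>E {0..<int n})" by simp
  qed
  then show ?thesis by (rule finite_subset) (intro finite_imageI finite_PiE, auto)
qed

lemma log_ext_div_le:
  assumes "0 \<le> p" "p \<le> exp (- c * v)" "0 < v"
  shows "log_ext p / ereal v \<le> ereal (- c)"
proof (cases "p = 0")
  case False
  then have "ln p \<le> ln (exp (- c * v))" using assms by (subst ln_le_cancel_iff) auto
  then have "ln p \<le> - c * v" by simp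
  then have "ln p / v \<le> - c" using assms(3) by (simp add: divide_le_eq)
  then show ?thesis using False assms(3) by (simp add: log_ext_def)
qed (use assms(3) in \<open>simp add: log_ext_def\<close>)

lemma log_ext_div_ge:
  assumes "exp (- c * v) \<le> p" "0 < v"
  shows "ereal (- c) \<le> log_ext p / ereal v"
proof -
  have p: "0 < p" using assms(1) exp_gt_zero[of "- c * v"] by linarith
  then have "- c * v \<le> ln p" using assms(1) by (simp add: ln_ge_iff)
  then have "- c \<le> ln p / v" using assms(2) by (simp add: le_divide_eq)
  then show ?thesis using p assms(2) by (simp add: log_ext_def)
qed

section \<open>Convergence of the sites and the rate function along a sequence of models\<close>

locale kac_potts_sequence =
  fixes J :: "'d::finite torus \<Rightarrow> real" and \<beta> :: real and q :: nat
    and \<Lambda> :: "nat \<Rightarrow> (int ^ 'd) set" and \<rho> :: "'d torus \<Rightarrow> real"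
  assumes J_cont: "continuous_on UNIV J" and q_pos: "q \<ge> 1"
    and \<Lambda>_sub: "\<And>n. n \<ge> 1 \<Longrightarrow> \<Lambda> n \<subseteq> discrete_torus n"
    and \<rho>_int: "integrable torus_lebesgue \<rho>" and \<rho>_nn: "AE u in torus_lebesgue. 0 \<le> \<rho> u"
    and conv: "sites_converge \<Lambda> \<rho>"
    and \<rho>_pos: "(LINT u|torus_lebesgue. \<rho> u) > 0"
begin

abbreviation "r \<equiv> normalized_density \<rho>"
abbreviation "P \<equiv> prob_measures (coloured_torus q) :: ('d torus \<times> nat) measure set"
abbreviation "X \<equiv> weak_topology q :: ('d torus \<times> nat) measure topology"
abbreviation "rate \<equiv> rate_function J \<beta> q r"
abbreviation "F \<nu> \<equiv> \<beta> * interaction J \<nu>"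
abbreviation "W n \<equiv> gibbs_weight J \<beta> q n (\<Lambda> n)"

sublocale torus_density r q
proof
  show "integrable torus_lebesgue r"
    unfolding normalized_density_def using \<rho>_int by simp
  show "AE u in torus_lebesgue. 0 \<le> r u"
    using \<rho>_nn by eventually_elim (use \<rho>_pos in \<open>simp add: normalized_density_def\<close>)
  show "(LINT u|torus_lebesgue. r u) = 1"
    unfolding normalized_density_def using \<rho>_pos by simp
qed (rule q_pos)

lemma finite_\<Lambda>: "n \<ge> 1 \<Longrightarrow> finite (\<Lambda> n)"
  using \<Lambda>_sub finite_discrete_torus by (rule finite_subset)

lemma scaled_sum_tendsto:
  assumes "continuous_on UNIV f"
  shows "(\<lambda>n. (1 / real n ^ CARD('d)) * (\<Sum>x\<in>\<Lambda> n. f (site n x))) \<longlonglongrightarrow> (LINT u|torus_lebesgue. \<rho> u * f u)"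
  using conv assms by (simp add: sites_converge_def)

lemma scaled_card_tendsto:
  "(\<lambda>n. (1 / real n ^ CARD('d)) * real (card (\<Lambda> n))) \<longlonglongrightarrow> (LINT u|torus_lebesgue. \<rho> u)"
  using scaled_sum_tendsto[of "\<lambda>_. 1"] by simp

lemma card_at_top: "filterlim (\<lambda>n. real (card (\<Lambda> n))) at_top sequentially"
proof -
  have "filterlim (\<lambda>n. real n ^ CARD('d)) at_top sequentially"
    by (intro filterlim_pow_at_top filterlim_real_sequentially) simp
  note lim = filterlim_tendsto_pos_mult_at_top[OF scaled_card_tendsto \<rho>_pos this]
  have ev: "\<forall>\<^sub>F n in sequentially. (1 / real n ^ CARD('d)) * real (card (\<Lambda> n)) * real n ^ CARD('d) =
      real (card (\<Lambda> n))"
    using eventually_gt_at_top[of 0] by eventually_elim simp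
  show ?thesis using lim unfolding filterlim_cong[OF refl refl ev] .
qed

text \<open>\<open>\<Lambda> 0\<close> is unrestricted and finitely many \<open>\<Lambda> n\<close>
  may be empty, so the asymptotic estimates hold for large n only.\<close>

lemma eventually_\<Lambda>: "\<forall>\<^sub>F n in sequentially. finite (\<Lambda> n) \<and> \<Lambda> n \<noteq> {}"
proof -
  have "\<forall>\<^sub>F n in sequentially. 1 \<le> real (card (\<Lambda> n))"
    using card_at_top unfolding filterlim_at_top by blast
  then show ?thesis
    using eventually_ge_at_top[of 1] by eventually_elim (use finite_\<Lambda> in auto)
qed

lemma empirical_tendsto:
  assumes f: "continuous_on UNIV f"
  shows "(\<lambda>n. (\<Sum>x\<in>\<Lambda> n. f (site n x)) / real (card (\<Lambda> n))) \<longlonglongrightarrow> (LINT u|base. f u)"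
proof -
  have lim: "(\<lambda>n. ((1 / real n ^ CARD('d)) * (\<Sum>x\<in>\<Lambda> n. f (site n x))) / ((1 / real n ^ CARD('d)) * real (card (\<Lambda> n))))
      \<longlonglongrightarrow> (LINT u|torus_lebesgue. \<rho> u * f u) / (LINT u|torus_lebesgue. \<rho> u)"
    using \<rho>_pos by (intro tendsto_divide scaled_sum_tendsto[OF f] scaled_card_tendsto) auto
  have eq: "(LINT u|torus_lebesgue. \<rho> u * f u) / (LINT u|torus_lebesgue. \<rho> u) = (LINT u|base. f u)"
    using f by (simp add: integral_base borel_measurable_continuous_onI normalized_density_def)
  have ev: "\<forall>\<^sub>F n in sequentially. ((1 / real n ^ CARD('d)) * (\<Sum>x\<in>\<Lambda> n. f (site n x))) /
      ((1 / real n ^ CARD('d)) * real (card (\<Lambda> n))) = (\<Sum>x\<in>\<Lambda> n. f (site n x)) / real (card (\<Lambda> n))"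
    using eventually_gt_at_top[of 0] by eventually_elim simp
  show ?thesis using lim unfolding eq tendsto_cong[OF ev] .
qed

lemma continuous_map_F: "continuous_map X euclideanreal F"
  by (intro continuous_map_real_mult_left continuous_map_interaction J_cont)

text \<open>The rate is defined through a choice of \<open>\<alpha>\<close>. Rewriting the kernel
  pairings as the interaction of \<open>\<nu>\<close> leaves \<open>\<alpha>\<close> in the entropy
  alone, and some representing \<open>\<alpha>\<close> is all that later arguments ask for.\<close>

lemma rate_represented:
  assumes \<nu>: "\<nu> \<in> P" and ex: "\<exists>\<alpha>. represents q r \<nu> \<alpha>"
  obtains \<alpha> where "represents q r \<nu> \<alpha>"
    "rate \<nu> = ereal ((LINT u|torus_lebesgue. entropy_eq q (\<lambda>a. \<alpha> a u) * r u) - F \<nu>)"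
proof -
  define \<alpha> where "\<alpha> = (SOME \<alpha>. represents q r \<nu> \<alpha>)"
  have rep: "represents q r \<nu> \<alpha>" unfolding \<alpha>_def using ex by (rule someI_ex)
  then have \<alpha>: "\<alpha> \<in> local_profiles q" by (simp add: represents_def)
  note m [measurable] = local_profilesD(1)[OF \<alpha>]
  have pair: "(LINT v|colour_part \<nu> a. LINT u|colour_part \<nu> a. J (u - v)) =
      kernel_pairing J (\<lambda>u. r u * \<alpha> a u) (\<lambda>u. r u * \<alpha> a u)" if a: "a \<in> {1..q}" for a
  proof -
    have cp: "colour_part \<nu> a = density torus_lebesgue (\<lambda>u. ennreal (r u * \<alpha> a u))"
      using rep a by (simp add: represents_def)
    have nn: "AE u in torus_lebesgue. 0 \<le> r u * \<alpha> a u"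
      using r_nn local_profilesD(2)[OF \<alpha>] by eventually_elim (use a in auto)
    have int: "(LINT u|colour_part \<nu> a. g u) = (LINT u|torus_lebesgue. (r u * \<alpha> a u) * g u)"
      if "g \<in> borel_measurable borel" for g :: "'d torus \<Rightarrow> real"
      unfolding cp using nn m[OF a] that by (subst integral_density) (auto simp: measurable_torus_lebesgue)
    note Jm = borel_measurable_torus_translate[OF J_cont]
    have "continuous_on UNIV (\<lambda>v. LINT z|\<nu>. colour_kernel J (z, (v, a)))"
      by (rule continuous_on_coloured_slice[OF continuous_on_kernel_integral[OF \<nu> continuous_on_colour_kernel[OF J_cont]] a])
    then have "(\<lambda>v. LINT u|colour_part \<nu> a. J (u - v)) \<in> borel_measurable borel"
      unfolding integral_colour_kernel[OF J_cont \<nu> a] by (rule borel_measurable_continuous_onI)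
    from int[OF this] show ?thesis
      unfolding kernel_pairing_def int[OF Jm]
      by (simp add: mult_ac flip: integral_mult_right_zero integral_mult_left_zero)
  qed
  have "(\<Sum>a\<in>{1..q}. kernel_pairing J (\<lambda>u. r u * \<alpha> a u) (\<lambda>u. r u * \<alpha> a u)) = interaction J \<nu>"
    unfolding interaction_colour_part[OF J_cont \<nu>] using pair by (intro sum.cong) auto
  then have "rate \<nu> = ereal ((LINT u|torus_lebesgue. entropy_eq q (\<lambda>a. \<alpha> a u) * r u) - F \<nu>)"
    using ex unfolding rate_function_def Let_def \<alpha>_def[symmetric] by simp
  with rep that show ?thesis by blast
qed

lemma rate_unrepresented: "\<not> (\<exists>\<alpha>. represents q r \<nu> \<alpha>) \<Longrightarrow> rate \<nu> = \<infinity>"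
  by (simp add: rate_function_def)

lemma log_likelihood_le_rate:
  assumes \<nu>: "\<nu> \<in> P" and f: "continuous_on (UNIV \<times> {1..q}) f"
  shows "ereal ((LINT z|\<nu>. log_likelihood q f z) - F \<nu>) \<le> rate \<nu>"
proof (cases "\<exists>\<alpha>. represents q r \<nu> \<alpha>")
  case True
  then obtain \<alpha> where "represents q r \<nu> \<alpha>"
    "rate \<nu> = ereal ((LINT u|torus_lebesgue. entropy_eq q (\<lambda>a. \<alpha> a u) * r u) - F \<nu>)"
    by (rule rate_represented[OF \<nu>])
  then show ?thesis using log_likelihood_integral_le[OF \<nu> _ f] by simp
qed (simp add: rate_unrepresented)

text \<open>Representability is essential: elsewhere the rate is infinite, while log-likelihoods
  stay below \<open>ln (real q)\<close>.\<close>

lemma log_likelihood_near_rate: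
  assumes \<nu>: "\<nu> \<in> P" and ex: "\<exists>\<alpha>. represents q r \<nu> \<alpha>" and c: "ereal c < rate \<nu>"
  obtains f where "continuous_on (UNIV \<times> {1..q}) f" "c < (LINT z|\<nu>. log_likelihood q f z) - F \<nu>"
proof -
  obtain \<alpha> where rep: "represents q r \<nu> \<alpha>"
    and rate: "rate \<nu> = ereal ((LINT u|torus_lebesgue. entropy_eq q (\<lambda>a. \<alpha> a u) * r u) - F \<nu>)"
    using \<nu> ex by (rule rate_represented)
  let ?h = "LINT u|torus_lebesgue. entropy_eq q (\<lambda>a. \<alpha> a u) * r u"
  have "0 < ?h - F \<nu> - c" using c by (simp add: rate)
  then obtain f where f: "continuous_on (UNIV \<times> {1..q}) f"
    "?h - (?h - F \<nu> - c) < (LINT z|\<nu>. log_likelihood q f z)"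
    by (rule log_likelihood_integral_dense[OF \<nu> rep])
  then show ?thesis by (intro that) auto
qed

lemma openin_log_likelihood_gt:
  assumes "continuous_on (UNIV \<times> {1..q}) f"
  shows "openin X {\<nu> \<in> P. c < (LINT z|\<nu>. log_likelihood q f z) - F \<nu>}"
proof -
  have "continuous_map X euclideanreal (\<lambda>\<nu>. (LINT z|\<nu>. log_likelihood q f z) - F \<nu>)"
    by (intro continuous_map_diff continuous_map_F
        continuous_map_weak_integral[OF continuous_on_log_likelihood[OF q_pos assms]])
  then have "openin X {\<nu> \<in> topspace X. (LINT z|\<nu>. log_likelihood q f z) - F \<nu> \<in> {c<..}}"
    by (rule openin_continuous_map_preimage) simp
  then show ?thesis by (simp add: topspace_weak_topology)
qed

lemma openin_log_likelihood_lt: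
  assumes "continuous_on (UNIV \<times> {1..q}) f"
  shows "openin X {\<nu> \<in> P. (LINT z|\<nu>. log_likelihood q f z) - F \<nu> < c}"
proof -
  have "continuous_map X euclideanreal (\<lambda>\<nu>. (LINT z|\<nu>. log_likelihood q f z) - F \<nu>)"
    by (intro continuous_map_diff continuous_map_F
        continuous_map_weak_integral[OF continuous_on_log_likelihood[OF q_pos assms]])
  then have "openin X {\<nu> \<in> topspace X. (LINT z|\<nu>. log_likelihood q f z) - F \<nu> \<in> {..<c}}"
    by (rule openin_continuous_map_preimage) simp
  then show ?thesis by (simp add: topspace_weak_topology)
qed

text \<open>A rate above \<open>c\<close> has one of two causes, a large log-likelihood or a wrong
  first marginal, and each of them persists on a weakly open set.\<close>

lemma closedin_rate_le: "closedin X {\<nu> \<in> topspace X. rate \<nu> \<le> ereal c}"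
proof -
  have "\<exists>T. openin X T \<and> \<nu> \<in> T \<and> T \<subseteq> {\<nu> \<in> P. ereal c < rate \<nu>}" if \<nu>: "\<nu> \<in> P" "ereal c < rate \<nu>" for \<nu>
  proof (cases "\<exists>\<alpha>. represents q r \<nu> \<alpha>")
    case True
    then obtain f where f: "continuous_on (UNIV \<times> {1..q}) f" "c < (LINT z|\<nu>. log_likelihood q f z) - F \<nu>"
      using log_likelihood_near_rate \<nu> by blast
    let ?T = "{\<nu> \<in> P. c < (LINT z|\<nu>. log_likelihood q f z) - F \<nu>}"
    have "ereal c < rate \<nu>'" if "\<nu>' \<in> ?T" for \<nu>'
    proof -
      have "ereal c < ereal ((LINT z|\<nu>'. log_likelihood q f z) - F \<nu>')" using that by simp
      also have "\<dots> \<le> rate \<nu>'" using that by (intro log_likelihood_le_rate f) auto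
      finally show ?thesis .
    qed
    then show ?thesis
      using openin_log_likelihood_gt[OF f(1), of c] f(2) \<nu>(1) by (intro exI[of _ ?T]) auto
  next
    \<comment> \<open>Some continuous \<open>g\<close> detects the wrong marginal, and all measures
      with a wrong integral of \<open>g\<close> have infinite rate.\<close>
    case False
    then obtain g :: "'d torus \<Rightarrow> real" where g: "continuous_on UNIV g"
      "(LINT z|\<nu>. g (fst z)) \<noteq> (LINT u|base. g u)"
      using represents_if_marginal[OF \<nu>(1)] by metis
    let ?T = "{\<nu> \<in> topspace X. (LINT z|\<nu>. g (fst z)) \<in> - {LINT u|base. g u}}"
    have "openin X ?T"
      by (rule openin_continuous_map_preimage[OF continuous_map_weak_integral])
        (auto intro: continuous_on_coloured_compose_fst g)
    moreover have "ereal c < rate \<nu>'" if "\<nu>' \<in> ?T" for \<nu>'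
    proof -
      have "\<not> (\<exists>\<alpha>. represents q r \<nu>' \<alpha>)"
        using that represents_marginal[OF _ _ g(1)] by (auto simp: topspace_weak_topology)
      then show ?thesis by (simp add: rate_unrepresented)
    qed
    ultimately show ?thesis
      using g(2) \<nu>(1) by (intro exI[of _ ?T]) (auto simp: topspace_weak_topology)
  qed
  then have "openin X {\<nu> \<in> P. ereal c < rate \<nu>}"
    by (subst openin_subopen) blast
  moreover have "topspace X - {\<nu> \<in> topspace X. rate \<nu> \<le> ereal c} = {\<nu> \<in> P. ereal c < rate \<nu>}"
    by (auto simp: topspace_weak_topology)
  ultimately show ?thesis by (auto simp: closedin_def)
qed

section \<open>Upper bound for closed sets\<close>

lemma profile_limit_represented:
  assumes n: "filterlim n sequentially sequentially"
    and L: "\<And>k. finite (\<Lambda> (n k))" "\<And>k. \<Lambda> (n k) \<noteq> {}" and \<sigma>: "\<And>k. \<sigma> k \<in> \<Lambda> (n k) \<rightarrow> {1..q}"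
    and \<nu>: "\<nu> \<in> P" and lim: "\<And>f :: 'd torus \<times> nat \<Rightarrow> real. continuous_on (UNIV \<times> {1..q}) f \<Longrightarrow>
      (\<lambda>k. LINT z|colour_profile q (n k) (\<Lambda> (n k)) (\<sigma> k). f z) \<longlonglongrightarrow> (LINT z|\<nu>. f z)"
  shows "\<exists>\<alpha>. represents q r \<nu> \<alpha>"
proof -
  have "(LINT z|\<nu>. g (fst z)) = (LINT u|base. g u)" if g: "continuous_on UNIV g" for g :: "'d torus \<Rightarrow> real"
  proof (rule LIMSEQ_unique)
    note gc = continuous_on_coloured_compose_fst[OF g, of "UNIV \<times> {1..q}"]
    show "(\<lambda>k. LINT z|colour_profile q (n k) (\<Lambda> (n k)) (\<sigma> k). g (fst z)) \<longlonglongrightarrow> (LINT z|\<nu>. g (fst z))"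
      by (rule lim[OF gc])
    \<comment> \<open>A function of the site alone does not see the colours, so its integral is an
      empirical mean over the sites.\<close>
    show "(\<lambda>k. LINT z|colour_profile q (n k) (\<Lambda> (n k)) (\<sigma> k). g (fst z)) \<longlonglongrightarrow> (LINT u|base. g u)"
      unfolding integral_colour_profile[OF L \<sigma> gc] fst_conv
      by (rule filterlim_compose[OF empirical_tendsto[OF g] n])
  qed
  then show ?thesis using represents_if_marginal[OF \<nu>] by blast
qed

text \<open>On the event, \<open>F\<close> lies below the log-likelihood minus \<open>c\<close>. The
  Gibbs factor is then at most \<open>exp (- c * N)\<close> times the tilt, N being the number of
  sites, and the tilt has a known total sum.\<close>

lemma gibbs_weight_log_likelihood_le:
  assumes L: "finite (\<Lambda> n)" "\<Lambda> n \<noteq> {}" and f: "continuous_on (UNIV \<times> {1..q}) f"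
  shows "W n {\<nu> \<in> P. c < (LINT z|\<nu>. log_likelihood q f z) - F \<nu>} \<le>
    real q ^ card (\<Lambda> n) * exp (- c * real (card (\<Lambda> n)))"
proof -
  let ?N = "real (card (\<Lambda> n))" and ?C = "\<Lambda> n \<rightarrow>\<^sub>E {1..q}"
  let ?\<pi> = "colour_profile q n (\<Lambda> n)"
  let ?U = "{\<nu> \<in> P. c < (LINT z|\<nu>. log_likelihood q f z) - F \<nu>}"
  have "W n ?U \<le> (\<Sum>\<sigma> | \<sigma> \<in> ?C \<and> ?\<pi> \<sigma> \<in> ?U. exp (?N * (LINT z|?\<pi> \<sigma>. log_likelihood q f z)) * exp (- c * ?N))"
    unfolding gibbs_weight_def
  proof (rule sum_mono)
    fix \<sigma> assume "\<sigma> \<in> {\<sigma>. \<sigma> \<in> ?C \<and> ?\<pi> \<sigma> \<in> ?U}"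
    then have "F (?\<pi> \<sigma>) \<le> (LINT z|?\<pi> \<sigma>. log_likelihood q f z) - c" by auto
    then have "?N * F (?\<pi> \<sigma>) \<le> ?N * ((LINT z|?\<pi> \<sigma>. log_likelihood q f z) - c)"
      by (intro mult_left_mono) auto
    then show "exp (?N * F (?\<pi> \<sigma>)) \<le> exp (?N * (LINT z|?\<pi> \<sigma>. log_likelihood q f z)) * exp (- c * ?N)"
      by (simp add: algebra_simps flip: exp_add)
  qed
  also have "\<dots> \<le> (\<Sum>\<sigma>\<in>?C. exp (?N * (LINT z|?\<pi> \<sigma>. log_likelihood q f z)) * exp (- c * ?N))"
    by (intro sum_mono2 finite_configurations L) auto
  also have "\<dots> = real q ^ card (\<Lambda> n) * exp (- c * ?N)"
    by (simp only: sum_distrib_right[symmetric] sum_exp_log_likelihood_profile[OF L q_pos f])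
  finally show ?thesis .
qed

text \<open>A union bound in which only the profiles on \<open>\<Lambda> n\<close> have to be
  covered, not all of \<open>A\<close>; compactness of profile sequences provides no more than
  that.\<close>

lemma gibbs_weight_Union_le:
  assumes L: "finite (\<Lambda> n)"
    and A: "\<And>\<sigma>. \<sigma> \<in> \<Lambda> n \<rightarrow>\<^sub>E {1..q} \<Longrightarrow> colour_profile q n (\<Lambda> n) \<sigma> \<in> A \<Longrightarrow>
      \<exists>i<k::nat. colour_profile q n (\<Lambda> n) \<sigma> \<in> U i"
  shows "W n A \<le> (\<Sum>i<k. W n (U i))"
proof -
  let ?S = "\<lambda>A. {\<sigma>. \<sigma> \<in> \<Lambda> n \<rightarrow>\<^sub>E {1..q} \<and> colour_profile q n (\<Lambda> n) \<sigma> \<in> A}"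
  let ?e = "\<lambda>\<sigma>. exp (real (card (\<Lambda> n)) * F (colour_profile q n (\<Lambda> n) \<sigma>))"
  have fin: "finite (?S A)" for A
    using finite_configurations[OF L] by (rule rev_finite_subset) auto
  have "W n A \<le> sum ?e (\<Union>i<k. ?S (U i))"
    unfolding gibbs_weight_def using A fin by (intro sum_mono2) (blast, blast, simp)
  also have "\<dots> \<le> (\<Sum>i<k. sum ?e (?S (U i)))"
  proof (induction k)
    case (Suc k)
    let ?B = "\<Union>i<k. ?S (U i)"
    have "finite ?B" using fin by blast
    then have "sum ?e (?B \<union> ?S (U k)) \<le> sum ?e ?B + sum ?e (?S (U k))"
      using sum.union_inter[of ?B "?S (U k)" ?e] fin[of "U k"] sum_nonneg[of "?B \<inter> ?S (U k)" ?e] by simp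
    with Suc show ?case by (simp add: lessThan_Suc Un_commute)
  qed simp
  finally show ?thesis by (simp add: gibbs_weight_def)
qed

text \<open>If no finite number of the sets \<open>U i\<close> sufficed for large n, there would be
  profiles in \<open>C\<close> escaping more and more of them. A limit of such profiles is
  represented and lies in \<open>C\<close>, hence in some open \<open>U i\<close>, which then
  contains late profiles: a contradiction.\<close>

lemma gibbs_weight_upper_bound:
  assumes C: "closedin X C" and c: "\<And>\<nu>. \<nu> \<in> C \<Longrightarrow> ereal c < rate \<nu>"
  obtains M :: real where "M > 0"
    "\<forall>\<^sub>F n in sequentially. W n C \<le> M * (real q ^ card (\<Lambda> n) * exp (- c * real (card (\<Lambda> n))))"
proof -
  obtain D :: "('d torus \<times> nat \<Rightarrow> real) set" where D: "countable D"
    "\<And>g. g \<in> D \<Longrightarrow> continuous_on (UNIV \<times> {1..q}) g"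
    "\<And>f e. continuous_on (UNIV \<times> {1..q}) f \<Longrightarrow> e > 0 \<Longrightarrow> \<exists>g\<in>D. \<forall>z\<in>UNIV \<times> {1..q}. \<bar>f z - g z\<bar> \<le> e"
    using countable_dense_continuous_functions[OF compact_coloured[of q]] by blast
  have "D \<noteq> {}" using D(3)[of "\<lambda>_. 0" 1] by auto
  define f where "f = from_nat_into D"
  have fD: "f i \<in> D" for i unfolding f_def using \<open>D \<noteq> {}\<close> by (rule from_nat_into)
  note fc = D(2)[OF fD]
  define U where "U i = {\<nu> \<in> P. c < (LINT z|\<nu>. log_likelihood q (f i) z) - F \<nu>}" for i
  have Uop: "openin X (U i)" for i
    unfolding U_def by (rule openin_log_likelihood_gt[OF fc])
  have cover: "\<exists>i. \<nu> \<in> U i" if \<nu>: "\<nu> \<in> C" "\<exists>\<alpha>. represents q r \<nu> \<alpha>" for \<nu>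
  proof -
    have \<nu>P: "\<nu> \<in> P" using \<nu>(1) closedin_subset[OF C] by (auto simp: topspace_weak_topology)
    obtain g where g: "continuous_on (UNIV \<times> {1..q}) g" "c < (LINT z|\<nu>. log_likelihood q g z) - F \<nu>"
      using log_likelihood_near_rate[OF \<nu>P \<nu>(2) c[OF \<nu>(1)]] by blast
    \<comment> \<open>A quarter of the gap: an \<open>e\<close>-close function changes the
      log-likelihood integral by at most \<open>2 * e\<close>, and half of the gap survives.\<close>
    define e where "e = ((LINT z|\<nu>. log_likelihood q g z) - F \<nu> - c) / 4"
    have e: "e > 0" using g(2) by (simp add: e_def)
    obtain h where h: "h \<in> D" "\<forall>z\<in>UNIV \<times> {1..q}. \<bar>g z - h z\<bar> \<le> e"
      using D(3)[OF g(1) e] by blast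
    have "\<bar>(LINT z|\<nu>. log_likelihood q g z) - (LINT z|\<nu>. log_likelihood q h z)\<bar> \<le> 2 * e"
      using h(2) by (intro integral_prob_measures_close[OF \<nu>P] continuous_on_log_likelihood q_pos g(1) D(2)[OF h(1)]
          log_likelihood_close[OF q_pos]) auto
    moreover have "(LINT z|\<nu>. log_likelihood q g z) - F \<nu> - c = 4 * e" by (simp add: e_def)
    ultimately have "c < (LINT z|\<nu>. log_likelihood q h z) - F \<nu>"
      using e by linarith
    moreover obtain i where "h = f i"
      using from_nat_into_surj[OF D(1) h(1)] by (auto simp: f_def)
    ultimately show ?thesis using \<nu>P by (auto simp: U_def)
  qed
  \<comment> \<open>Configurations whose profile lies in \<open>C\<close> but in none of the first k
    sets of the cover.\<close>
  define bad where "bad k n \<sigma> \<longleftrightarrow> \<sigma> \<in> \<Lambda> n \<rightarrow>\<^sub>E {1..q} \<and> colour_profile q n (\<Lambda> n) \<sigma> \<in> C \<and>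
      (\<forall>i<k. colour_profile q n (\<Lambda> n) \<sigma> \<notin> U i)" for k n \<sigma>
  have "\<exists>k. \<forall>\<^sub>F n in sequentially. \<forall>\<sigma>. \<not> bad k n \<sigma>"
  proof (rule ccontr)
    assume "\<not> ?thesis"
    then have fr: "\<exists>\<^sub>F n in sequentially. \<exists>\<sigma>. bad k n \<sigma>" for k
      by (auto simp: frequently_def)
    have "\<exists>n. k \<le> n \<and> finite (\<Lambda> n) \<and> \<Lambda> n \<noteq> {} \<and> (\<exists>\<sigma>. bad k n \<sigma>)" for k
    proof (rule frequently_ex[OF frequently_rev_mp[OF fr[of k]]])
      show "\<forall>\<^sub>F n in sequentially. (\<exists>\<sigma>. bad k n \<sigma>) \<longrightarrow>
          k \<le> n \<and> finite (\<Lambda> n) \<and> \<Lambda> n \<noteq> {} \<and> (\<exists>\<sigma>. bad k n \<sigma>)"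
        using eventually_ge_at_top[of k] eventually_\<Lambda> by eventually_elim blast
    qed
    then obtain n \<sigma> where n: "\<And>k. k \<le> n k" "\<And>k. finite (\<Lambda> (n k))" "\<And>k. \<Lambda> (n k) \<noteq> {}"
      and bad: "\<And>k. bad k (n k) (\<sigma> k)"
      by metis
    have \<sigma>: "\<sigma> k \<in> \<Lambda> (n k) \<rightarrow> {1..q}" for k using bad[of k] by (auto simp: bad_def)
    obtain s \<nu> where s: "strict_mono s" and \<nu>: "\<nu> \<in> P"
      and lim: "\<And>f :: 'd torus \<times> nat \<Rightarrow> real. continuous_on (UNIV \<times> {1..q}) f \<Longrightarrow>
        (\<lambda>k. LINT z|colour_profile q (n (s k)) (\<Lambda> (n (s k))) (\<sigma> (s k)). f z) \<longlonglongrightarrow> (LINT z|\<nu>. f z)"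
      using profile_subsequence_limit[where L = "\<lambda>k. \<Lambda> (n k)" and \<sigma> = \<sigma> and m = n and q = q, OF n(2,3) \<sigma>] by blast
    have pP: "colour_profile q (n k) (\<Lambda> (n k)) (\<sigma> k) \<in> P" for k
      by (rule colour_profile_in_prob_measures[OF n(2,3) \<sigma>])
    have limin: "limitin X (\<lambda>k. colour_profile q (n (s k)) (\<Lambda> (n (s k))) (\<sigma> (s k))) \<nu> sequentially"
      by (rule limitin_weak_topology[OF \<nu> pP lim])
    have "\<nu> \<in> C"
      using limin C by (rule limitin_closedin) (use bad in \<open>auto simp: bad_def\<close>)
    moreover have "filterlim (\<lambda>k. n (s k)) sequentially sequentially"
      using n(1) s seq_suble[OF s]
      by (intro filterlim_at_top_mono[OF filterlim_ident] always_eventually allI) (blast intro: order_trans)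
    then have "\<exists>\<alpha>. represents q r \<nu> \<alpha>"
      by (rule profile_limit_represented[OF _ n(2,3) \<sigma> \<nu> lim])
    ultimately obtain i where "\<nu> \<in> U i" using cover by blast
    with limin Uop have "\<forall>\<^sub>F k in sequentially. colour_profile q (n (s k)) (\<Lambda> (n (s k))) (\<sigma> (s k)) \<in> U i"
      by (intro limitinD)
    with eventually_gt_at_top[of i]
    have "\<forall>\<^sub>F k in sequentially. False"
    proof eventually_elim
      case (elim k)
      then have "i < s k" using seq_suble[OF s, of k] by simp
      then show ?case using bad[of "s k"] elim by (auto simp: bad_def)
    qed
    then show False by simp
  qed
  then obtain k where k: "\<forall>\<^sub>F n in sequentially. \<forall>\<sigma>. \<not> bad k n \<sigma>" by blast
  show ?thesis
  \<comment> \<open>The summand 1 keeps the constant positive when k is 0, for instance when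
    \<open>C\<close> is empty.\<close>
  proof (rule that[of "real k + 1"])
    show "\<forall>\<^sub>F n in sequentially. W n C \<le> (real k + 1) * (real q ^ card (\<Lambda> n) * exp (- c * real (card (\<Lambda> n))))"
      using k eventually_\<Lambda>
    proof eventually_elim
      case (elim n)
      have "W n C \<le> (\<Sum>i<k. W n (U i))"
        using elim by (intro gibbs_weight_Union_le) (auto simp: bad_def)
      also have "\<dots> \<le> (\<Sum>i<k. real q ^ card (\<Lambda> n) * exp (- c * real (card (\<Lambda> n))))"
        unfolding U_def using elim by (intro sum_mono gibbs_weight_log_likelihood_le fc) auto
      also have "\<dots> \<le> (real k + 1) * (real q ^ card (\<Lambda> n) * exp (- c * real (card (\<Lambda> n))))"
        by (simp add: mult_right_mono)
      finally show ?case .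
    qed
  qed simp
qed

section \<open>Lower bound for open sets by tilted colours\<close>

text \<open>Since \<open>exp (log_likelihood q f (u, \<cdot>)) / q\<close> is a probability vector, this is the probability that the
  profile misses \<open>A\<close> when the colours are independent with these site-dependent distributions.\<close>

definition tilted_tail :: "('d torus \<times> nat \<Rightarrow> real) \<Rightarrow> nat \<Rightarrow> ('d torus \<times> nat) measure set \<Rightarrow> real" where
  "tilted_tail f n A = (\<Sum>\<sigma> | \<sigma> \<in> \<Lambda> n \<rightarrow>\<^sub>E {1..q} \<and> colour_profile q n (\<Lambda> n) \<sigma> \<notin> A.
    exp (real (card (\<Lambda> n)) * (LINT z|colour_profile q n (\<Lambda> n) \<sigma>. log_likelihood q f z))) / real q ^ card (\<Lambda> n)"

lemma finite_tail_set: "finite (\<Lambda> n) \<Longrightarrow> finite {\<sigma>. \<sigma> \<in> \<Lambda> n \<rightarrow>\<^sub>E {1..q} \<and> Q \<sigma>}"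
  by (rule finite_subset[OF _ finite_configurations[of "\<Lambda> n" q]]) auto

lemma tilted_tail_nonneg: "0 \<le> tilted_tail f n A"
  unfolding tilted_tail_def by (intro divide_nonneg_nonneg sum_nonneg) auto

lemma tilted_tail_antimono: "finite (\<Lambda> n) \<Longrightarrow> A \<subseteq> B \<Longrightarrow> tilted_tail f n B \<le> tilted_tail f n A"
  unfolding tilted_tail_def
  by (intro divide_right_mono sum_mono2 finite_tail_set) auto

lemma tilted_tail_Int: "finite (\<Lambda> n) \<Longrightarrow> tilted_tail f n (A \<inter> B) \<le> tilted_tail f n A + tilted_tail f n B"
proof -
  assume L: "finite (\<Lambda> n)"
  let ?S = "\<lambda>A. {\<sigma>. \<sigma> \<in> \<Lambda> n \<rightarrow>\<^sub>E {1..q} \<and> colour_profile q n (\<Lambda> n) \<sigma> \<notin> A}"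
  let ?e = "\<lambda>\<sigma>. exp (real (card (\<Lambda> n)) * (LINT z|colour_profile q n (\<Lambda> n) \<sigma>. log_likelihood q f z))"
  have "?S (A \<inter> B) = ?S A \<union> ?S B" by auto
  then have "sum ?e (?S (A \<inter> B)) \<le> sum ?e (?S A) + sum ?e (?S B)"
    using sum.union_inter[of "?S A" "?S B" ?e] finite_tail_set[OF L] sum_nonneg[of "?S A \<inter> ?S B" ?e] by simp
  then show ?thesis
    unfolding tilted_tail_def add_divide_distrib[symmetric] by (intro divide_right_mono) auto
qed

text \<open>The mean \<open>m\<close> of \<open>g\<close> at a site, averaged over the sites,
  converges to the integral under \<open>N\<close>. This takes one half of \<open>e\<close>; the
  other half is a deviation of independent centred variables.\<close>

lemma tilted_tail_half_space:
  assumes w: "continuous_on (UNIV \<times> {1..q}) w" "\<And>z. z \<in> UNIV \<times> {1..q} \<Longrightarrow> 0 < w z"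
      "\<And>u. (\<Sum>a\<in>{1..q}. w (u, a)) = 1"
    and N: "N \<in> P" "\<And>f :: 'd torus \<times> nat \<Rightarrow> real. continuous_on (UNIV \<times> {1..q}) f \<Longrightarrow>
      (LINT z|N. f z) = (LINT u|base. (\<Sum>a\<in>{1..q}. w (u, a) * f (u, a)))"
    and g: "continuous_on (UNIV \<times> {1..q}) (g :: 'd torus \<times> nat \<Rightarrow> real)" and e: "e > 0"
  shows "(\<lambda>n. tilted_tail (\<lambda>z. ln (w z)) n {\<nu>. (LINT z|\<nu>. g z) < (LINT z|N. g z) + e}) \<longlonglongrightarrow> 0"
proof -
  let ?A = "{\<nu>. (LINT z|\<nu>. g z) < (LINT z|N. g z) + e}"
  obtain C where C: "C > 0" "\<And>z. z \<in> UNIV \<times> {1..q} \<Longrightarrow> \<bar>g z\<bar> \<le> C"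
    using bounded_coloured_continuous[OF g] by blast
  have lnc: "continuous_on (UNIV \<times> {1..q}) (\<lambda>z. ln (w z))"
    using w(1,2) by (intro continuous_on_ln) (auto simp: less_imp_neq[OF w(2), symmetric])
  define m where "m u = (\<Sum>a\<in>{1..q}. w (u, a) * g (u, a))" for u
  have mc: "continuous_on UNIV m"
    unfolding m_def by (intro continuous_on_sum continuous_on_mult continuous_on_coloured_slice[OF w(1)]
        continuous_on_coloured_slice[OF g])
  have mb: "\<bar>m u\<bar> \<le> C" for u
  proof -
    have "\<bar>m u\<bar> \<le> (\<Sum>a\<in>{1..q}. \<bar>w (u, a) * g (u, a)\<bar>)" unfolding m_def by (rule sum_abs)
    also have "\<dots> \<le> (\<Sum>a\<in>{1..q}. w (u, a) * C)"
    proof (rule sum_mono)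
      fix a assume "a \<in> {1..q}"
      then have "0 < w (u, a)" "\<bar>g (u, a)\<bar> \<le> C" using w(2) C(2) by auto
      then show "\<bar>w (u, a) * g (u, a)\<bar> \<le> w (u, a) * C" by (simp add: abs_mult)
    qed
    also have "\<dots> = C" unfolding sum_distrib_right[symmetric] w(3) by simp
    finally show ?thesis .
  qed
  have "(\<lambda>n. (\<Sum>x\<in>\<Lambda> n. m (site n x)) / real (card (\<Lambda> n))) \<longlonglongrightarrow> (LINT z|N. g z)"
    using empirical_tendsto[OF mc] unfolding N(2)[OF g] m_def .
  then have ev: "\<forall>\<^sub>F n in sequentially. (\<Sum>x\<in>\<Lambda> n. m (site n x)) / real (card (\<Lambda> n)) < (LINT z|N. g z) + e / 2"
    using e by (intro order_tendstoD) auto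
  \<comment> \<open>Chernoff's bound is applied with range \<open>2 * C\<close>. The first entry
    gives \<open>t * (2 * C) \<le> 1\<close>; the second makes the quadratic term at most
    \<open>t * e / 4\<close>, half of the gain \<open>t * (e / 2)\<close>.\<close>
  define t where "t = min (1 / (2 * C)) (e / (16 * C\<^sup>2))"
  have t: "0 < t" "t * (2 * C) \<le> 1" "t * (16 * C\<^sup>2) \<le> e"
    using C(1) e by (auto simp: t_def min_def field_simps split: if_splits)
  have bound: "\<forall>\<^sub>F n in sequentially. tilted_tail (\<lambda>z. ln (w z)) n ?A \<le> exp (- (t * e / 4) * real (card (\<Lambda> n)))"
    using ev eventually_\<Lambda>
  proof eventually_elim
    case (elim n)
    then have L: "finite (\<Lambda> n)" "\<Lambda> n \<noteq> {}" by auto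
    let ?N = "real (card (\<Lambda> n))" and ?C = "\<Lambda> n \<rightarrow>\<^sub>E {1..q}"
    let ?\<pi> = "colour_profile q n (\<Lambda> n)"
    have Npos: "?N > 0" using L by (simp add: card_gt_0_iff)
    define w' where "w' x a = w (site n x, a)" for x a
    define Y where "Y x a = g (site n x, a) - m (site n x)" for x a
    \<comment> \<open>For \<open>f = ln w\<close> the tilt is the product of the weights
      \<open>w\<close> up to a power of q, which the normalisation of \<open>tilted_tail\<close>
      cancels.\<close>
    have "(\<Sum>\<sigma> | \<sigma> \<in> ?C \<and> ?\<pi> \<sigma> \<notin> ?A. exp (?N * (LINT z|?\<pi> \<sigma>. log_likelihood q (\<lambda>z. ln (w z)) z))) =
        (\<Sum>\<sigma> | \<sigma> \<in> ?C \<and> ?\<pi> \<sigma> \<notin> ?A. (\<Prod>x\<in>\<Lambda> n. w' x (\<sigma> x)) * real q ^ card (\<Lambda> n))"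
    proof (rule sum.cong[OF refl])
      fix \<sigma> assume "\<sigma> \<in> {\<sigma>. \<sigma> \<in> ?C \<and> ?\<pi> \<sigma> \<notin> ?A}"
      then have \<sigma>: "\<sigma> \<in> \<Lambda> n \<rightarrow> {1..q}" by auto
      have "?N * (LINT z|?\<pi> \<sigma>. log_likelihood q (\<lambda>z. ln (w z)) z) =
          (\<Sum>x\<in>\<Lambda> n. log_likelihood q (\<lambda>z. ln (w z)) (site n x, \<sigma> x))"
        using Npos by (subst integral_colour_profile[OF L \<sigma> continuous_on_log_likelihood[OF q_pos lnc]]) simp
      also have "\<dots> = (\<Sum>x\<in>\<Lambda> n. ln (real q * w (site n x, \<sigma> x)))"
        using \<sigma> w(2,3) q_pos by (intro sum.cong refl log_likelihood_ln) auto
      also have "exp \<dots> = (\<Prod>x\<in>\<Lambda> n. real q * w (site n x, \<sigma> x))"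
        unfolding exp_sum[OF L(1)]
      proof (rule prod.cong[OF refl])
        fix x assume "x \<in> \<Lambda> n"
        then have "0 < w (site n x, \<sigma> x)" using \<sigma> by (intro w(2)) auto
        then show "exp (ln (real q * w (site n x, \<sigma> x))) = real q * w (site n x, \<sigma> x)"
          using q_pos by simp
      qed
      finally show "exp (?N * (LINT z|?\<pi> \<sigma>. log_likelihood q (\<lambda>z. ln (w z)) z)) =
          (\<Prod>x\<in>\<Lambda> n. w' x (\<sigma> x)) * real q ^ card (\<Lambda> n)"
        by (simp add: prod.distrib w'_def)
    qed
    then have "tilted_tail (\<lambda>z. ln (w z)) n ?A = (\<Sum>\<sigma> | \<sigma> \<in> ?C \<and> ?\<pi> \<sigma> \<notin> ?A. \<Prod>x\<in>\<Lambda> n. w' x (\<sigma> x))"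
      using q_pos by (simp add: tilted_tail_def flip: sum_distrib_right)
    also have "\<dots> \<le> (\<Sum>\<sigma> | \<sigma> \<in> ?C \<and> ?N * (e / 2) \<le> (\<Sum>x\<in>\<Lambda> n. Y x (\<sigma> x)). \<Prod>x\<in>\<Lambda> n. w' x (\<sigma> x))"
    proof (rule sum_mono2[OF finite_tail_set[OF L(1)]])
      show "{\<sigma>. \<sigma> \<in> ?C \<and> ?\<pi> \<sigma> \<notin> ?A} \<subseteq> {\<sigma>. \<sigma> \<in> ?C \<and> ?N * (e / 2) \<le> (\<Sum>x\<in>\<Lambda> n. Y x (\<sigma> x))}"
      proof
        fix \<sigma> assume "\<sigma> \<in> {\<sigma>. \<sigma> \<in> ?C \<and> ?\<pi> \<sigma> \<notin> ?A}"
        then have \<sigma>: "\<sigma> \<in> ?C" "\<sigma> \<in> \<Lambda> n \<rightarrow> {1..q}" and ge: "(LINT z|N. g z) + e \<le> (LINT z|?\<pi> \<sigma>. g z)" by auto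
        have "e / 2 \<le> (\<Sum>x\<in>\<Lambda> n. g (site n x, \<sigma> x)) / ?N - (\<Sum>x\<in>\<Lambda> n. m (site n x)) / ?N"
          using ge elim(1) unfolding integral_colour_profile[OF L \<sigma>(2) g] by linarith
        also have "\<dots> = (\<Sum>x\<in>\<Lambda> n. Y x (\<sigma> x)) / ?N"
          by (simp add: Y_def sum_subtractf diff_divide_distrib)
        finally have "?N * (e / 2) \<le> (\<Sum>x\<in>\<Lambda> n. Y x (\<sigma> x))"
          using Npos by (simp add: field_simps)
        with \<sigma> show "\<sigma> \<in> {\<sigma>. \<sigma> \<in> ?C \<and> ?N * (e / 2) \<le> (\<Sum>x\<in>\<Lambda> n. Y x (\<sigma> x))}" by simp
      qed
      show "0 \<le> (\<Prod>x\<in>\<Lambda> n. w' x (\<sigma> x))"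
        if "\<sigma> \<in> {\<sigma>. \<sigma> \<in> ?C \<and> ?N * (e / 2) \<le> (\<Sum>x\<in>\<Lambda> n. Y x (\<sigma> x))} - {\<sigma>. \<sigma> \<in> ?C \<and> ?\<pi> \<sigma> \<notin> ?A}" for \<sigma>
        unfolding w'_def using that by (intro prod_nonneg less_imp_le[OF w(2)]) auto
    qed
    also have "\<dots> \<le> exp (?N * (t\<^sup>2 * (2 * C)\<^sup>2 - t * (e / 2)))"
    proof (rule product_weight_deviation[OF L(1)])
      show "0 \<le> w' x a" if "a \<in> {1..q}" for x a
        unfolding w'_def using that by (intro less_imp_le[OF w(2)]) auto
      show "(\<Sum>a\<in>{1..q}. w' x a) = 1" for x unfolding w'_def by (rule w(3))
      show "\<bar>Y x a\<bar> \<le> 2 * C" if "a \<in> {1..q}" for x a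
      proof -
        have "\<bar>g (site n x, a)\<bar> \<le> C" using that by (intro C(2)) auto
        then show ?thesis using mb[of "site n x"] unfolding Y_def by linarith
      qed
      show "(\<Sum>a\<in>{1..q}. w' x a * Y x a) = 0" for x
        using w(3)[of "site n x"]
        by (simp add: w'_def Y_def right_diff_distrib sum_subtractf m_def flip: sum_distrib_right)
    qed (use t in auto)
    also have "\<dots> \<le> exp (- (t * e / 4) * ?N)"
    proof -
      have "t\<^sup>2 * (2 * C)\<^sup>2 = (t * (t * (16 * C\<^sup>2))) / 4" by (simp add: power2_eq_square)
      also have "\<dots> \<le> (t * e) / 4" using t by (intro divide_right_mono mult_left_mono) auto
      finally have "t\<^sup>2 * (2 * C)\<^sup>2 - t * (e / 2) \<le> - (t * e / 4)" by simp
      then have "?N * (t\<^sup>2 * (2 * C)\<^sup>2 - t * (e / 2)) \<le> ?N * (- (t * e / 4))"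
        by (intro mult_left_mono) auto
      then show ?thesis by (simp add: mult.commute)
    qed
    finally show ?case .
  qed
  have lim: "(\<lambda>n. exp (- (t * e / 4) * real (card (\<Lambda> n)))) \<longlonglongrightarrow> 0"
  proof (rule filterlim_compose[OF exp_at_bot])
    show "filterlim (\<lambda>n. - (t * e / 4) * real (card (\<Lambda> n))) at_bot sequentially"
      using t e by (intro filterlim_tendsto_neg_mult_at_bot[OF tendsto_const _ card_at_top]) auto
  qed
  show ?thesis
    by (rule tendsto_sandwich[OF _ bound tendsto_const lim]) (simp add: tilted_tail_nonneg)
qed

text \<open>A law of large numbers, by induction over the generated topology: tails are subadditive
  under intersection and decrease when the set grows, so only half-spaces need a probabilistic
  estimate.\<close>

lemma tilted_tail_tendsto:
  assumes w: "continuous_on (UNIV \<times> {1..q}) w" "\<And>z. z \<in> UNIV \<times> {1..q} \<Longrightarrow> 0 < w z"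
      "\<And>u. (\<Sum>a\<in>{1..q}. w (u, a)) = 1"
    and N: "N \<in> P" "\<And>f :: 'd torus \<times> nat \<Rightarrow> real. continuous_on (UNIV \<times> {1..q}) f \<Longrightarrow>
      (LINT z|N. f z) = (LINT u|base. (\<Sum>a\<in>{1..q}. w (u, a) * f (u, a)))"
    and G: "openin X G" "N \<in> G"
  shows "(\<lambda>n. tilted_tail (\<lambda>z. ln (w z)) n G) \<longlonglongrightarrow> 0"
  using G
proof (induction rule: weak_topology_generated_induct)
  case (inter A B)
  let ?T = "tilted_tail (\<lambda>z. ln (w z))"
  have "(\<lambda>n. ?T n A + ?T n B) \<longlonglongrightarrow> 0 + 0" using inter by (intro tendsto_add) auto
  then have lim: "(\<lambda>n. ?T n A + ?T n B) \<longlonglongrightarrow> 0" by simp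
  have "\<forall>\<^sub>F n in sequentially. ?T n (A \<inter> B) \<le> ?T n A + ?T n B"
    using eventually_\<Lambda> by eventually_elim (simp add: tilted_tail_Int)
  then show ?case
    by (rule tendsto_sandwich[OF _ _ tendsto_const lim, rotated]) (simp add: tilted_tail_nonneg)
next
  case (union \<A>)
  let ?T = "tilted_tail (\<lambda>z. ln (w z))"
  obtain A where A: "A \<in> \<A>" "N \<in> A" using union(2) by blast
  have lim: "(\<lambda>n. ?T n A) \<longlonglongrightarrow> 0" using union(1)[OF A] .
  have "\<forall>\<^sub>F n in sequentially. ?T n (\<Union>\<A>) \<le> ?T n A"
    using eventually_\<Lambda> by eventually_elim (use A in \<open>auto intro!: tilted_tail_antimono\<close>)
  then show ?case
    by (rule tendsto_sandwich[OF _ _ tendsto_const lim, rotated]) (simp add: tilted_tail_nonneg)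
next
  case (basic g U)
  let ?T = "tilted_tail (\<lambda>z. ln (w z))"
  have "(LINT z|N. g z) \<in> U" using basic(3) by simp
  then obtain e where e: "e > 0" "\<And>y. dist y (LINT z|N. g z) < e \<Longrightarrow> y \<in> U"
    using basic(2) unfolding open_dist by blast
  \<comment> \<open>An interval around the limit is the intersection of two half-spaces; the lower
    one is an upper one for \<open>- g\<close>.\<close>
  let ?A1 = "{\<nu>. (LINT z|\<nu>. g z) < (LINT z|N. g z) + e}"
  let ?A2 = "{\<nu>. (LINT z|\<nu>. - g z) < (LINT z|N. - g z) + e}"
  have "(\<lambda>n. ?T n ?A1 + ?T n ?A2) \<longlonglongrightarrow> 0 + 0"
    by (intro tendsto_add tilted_tail_half_space[OF w N basic(1) e(1)]
        tilted_tail_half_space[OF w N continuous_on_minus[OF basic(1)] e(1)])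
  then have lim: "(\<lambda>n. ?T n ?A1 + ?T n ?A2) \<longlonglongrightarrow> 0" by simp
  have "\<forall>\<^sub>F n in sequentially. ?T n {\<nu> \<in> P. (LINT z|\<nu>. g z) \<in> U} \<le> ?T n ?A1 + ?T n ?A2"
    using eventually_\<Lambda>
  proof eventually_elim
    case (elim n)
    then have L: "finite (\<Lambda> n)" "\<Lambda> n \<noteq> {}" by auto
    let ?\<pi> = "colour_profile q n (\<Lambda> n)"
    have "?T n {\<nu> \<in> P. (LINT z|\<nu>. g z) \<in> U} \<le> ?T n (?A1 \<inter> ?A2)"
      unfolding tilted_tail_def
    proof (intro divide_right_mono sum_mono2 finite_tail_set[OF L(1)])
      show "{\<sigma>. \<sigma> \<in> \<Lambda> n \<rightarrow>\<^sub>E {1..q} \<and> ?\<pi> \<sigma> \<notin> {\<nu> \<in> P. (LINT z|\<nu>. g z) \<in> U}} \<subseteq>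
          {\<sigma>. \<sigma> \<in> \<Lambda> n \<rightarrow>\<^sub>E {1..q} \<and> ?\<pi> \<sigma> \<notin> ?A1 \<inter> ?A2}"
      proof
        fix \<sigma> assume "\<sigma> \<in> {\<sigma>. \<sigma> \<in> \<Lambda> n \<rightarrow>\<^sub>E {1..q} \<and> ?\<pi> \<sigma> \<notin> {\<nu> \<in> P. (LINT z|\<nu>. g z) \<in> U}}"
        then have \<sigma>: "\<sigma> \<in> \<Lambda> n \<rightarrow>\<^sub>E {1..q}" "?\<pi> \<sigma> \<notin> {\<nu> \<in> P. (LINT z|\<nu>. g z) \<in> U}" by auto
        have "\<sigma> \<in> \<Lambda> n \<rightarrow> {1..q}" using \<sigma>(1) by auto
        from colour_profile_in_prob_measures[OF L this] have "?\<pi> \<sigma> \<in> P" .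
        with \<sigma>(2) e(2) have "e \<le> \<bar>(LINT z|?\<pi> \<sigma>. g z) - (LINT z|N. g z)\<bar>"
          by (fastforce simp: dist_real_def not_less[symmetric])
        then have "?\<pi> \<sigma> \<notin> ?A1 \<inter> ?A2" by auto
        with \<sigma>(1) show "\<sigma> \<in> {\<sigma>. \<sigma> \<in> \<Lambda> n \<rightarrow>\<^sub>E {1..q} \<and> ?\<pi> \<sigma> \<notin> ?A1 \<inter> ?A2}" by simp
      qed
    qed auto
    also have "\<dots> \<le> ?T n ?A1 + ?T n ?A2" by (rule tilted_tail_Int[OF L(1)])
    finally show ?case .
  qed
  then show ?case
    by (rule tendsto_sandwich[OF _ _ tendsto_const lim, rotated]) (simp add: tilted_tail_nonneg)
qed simp

text \<open>A change of measure: tilted colours concentrate in an open set on which the Gibbs factor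
  is at least a known exponential times the tilted weight. The densities of \<open>\<nu>\<close> may
  vanish or be discontinuous, so the tilt is built from a nearby \<open>N k\<close> of almost the
  same cost.\<close>

lemma gibbs_weight_lower_bound:
  assumes G: "openin X G" and \<nu>: "\<nu> \<in> G" "rate \<nu> < ereal c"
  shows "\<forall>\<^sub>F n in sequentially. real q ^ card (\<Lambda> n) * exp (- c * real (card (\<Lambda> n))) \<le> W n G"
proof -
  have \<nu>P: "\<nu> \<in> P" using \<nu>(1) openin_subset[OF G] by (auto simp: topspace_weak_topology)
  have "\<exists>\<alpha>. represents q r \<nu> \<alpha>" using \<nu>(2) rate_unrepresented[of \<nu>] by force
  then obtain \<alpha> where rep: "represents q r \<nu> \<alpha>"
    and rate: "rate \<nu> = ereal ((LINT u|torus_lebesgue. entropy_eq q (\<lambda>a. \<alpha> a u) * r u) - F \<nu>)"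
    by (rule rate_represented[OF \<nu>P])
  obtain w :: "nat \<Rightarrow> 'd torus \<times> nat \<Rightarrow> real" and N :: "nat \<Rightarrow> ('d torus \<times> nat) measure" where
    w: "\<And>k. continuous_on (UNIV \<times> {1..q}) (w k)"
    "\<And>k z. z \<in> UNIV \<times> {1..q} \<Longrightarrow> 0 < w k z" "\<And>k u. (\<Sum>a\<in>{1..q}. w k (u, a)) = 1" and
    N: "\<And>k. N k \<in> P"
    "\<And>k f. continuous_on (UNIV \<times> {1..q}) f \<Longrightarrow>
      (LINT z|N k. f z) = (LINT u|base. (\<Sum>a\<in>{1..q}. w k (u, a) * f (u, a)) :: real)" and
    lim: "limitin X N \<nu> sequentially" and
    hlim: "(\<lambda>k. LINT z|N k. log_likelihood q (\<lambda>z. ln (w k z)) z) \<longlonglongrightarrow>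
      (LINT u|torus_lebesgue. entropy_eq q (\<lambda>a. \<alpha> a u) * r u)"
    using represented_measure_approx[OF \<nu>P rep] by blast
  have "limitin euclideanreal (F \<circ> N) (F \<nu>) sequentially"
    by (rule continuous_map_limit[OF continuous_map_F lim])
  then have "(\<lambda>k. F (N k)) \<longlonglongrightarrow> F \<nu>" by (simp add: o_def)
  with hlim have "(\<lambda>k. (LINT z|N k. log_likelihood q (\<lambda>z. ln (w k z)) z) - F (N k)) \<longlonglongrightarrow>
      (LINT u|torus_lebesgue. entropy_eq q (\<lambda>a. \<alpha> a u) * r u) - F \<nu>"
    by (rule tendsto_diff)
  then have "\<forall>\<^sub>F k in sequentially. (LINT z|N k. log_likelihood q (\<lambda>z. ln (w k z)) z) - F (N k) < c"
    using \<nu>(2) unfolding rate by (intro order_tendstoD) auto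
  with limitinD[OF lim G \<nu>(1)] have "\<forall>\<^sub>F k in sequentially. N k \<in> G \<and>
      (LINT z|N k. log_likelihood q (\<lambda>z. ln (w k z)) z) - F (N k) < c"
    by eventually_elim auto
  then obtain k where k: "N k \<in> G" "(LINT z|N k. log_likelihood q (\<lambda>z. ln (w k z)) z) - F (N k) < c"
    using eventually_happens'[OF sequentially_bot] by blast
  let ?f = "\<lambda>z. ln (w k z)"
  have fc: "continuous_on (UNIV \<times> {1..q}) ?f"
    using w(1,2) by (intro continuous_on_ln) (auto simp: less_imp_neq[OF w(2), symmetric])
  \<comment> \<open>A slack in the exponent, spent below on a factor 2.\<close>
  obtain e where e: "e > 0" "(LINT z|N k. log_likelihood q ?f z) - F (N k) < c - e"
    using k(2) by (metis add.commute diff_gt_0_iff_gt dense less_diff_eq)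
  \<comment> \<open>Within \<open>G\<close>, the additional open condition bounds the cost of the
    change of measure for each single profile, not only in the limit.\<close>
  define G' where "G' = G \<inter> {\<nu> \<in> P. (LINT z|\<nu>. log_likelihood q ?f z) - F \<nu> < c - e}"
  have "openin X G'" unfolding G'_def by (intro openin_Int G openin_log_likelihood_lt fc)
  moreover have "N k \<in> G'" using k N e by (simp add: G'_def)
  ultimately have tail: "(\<lambda>n. tilted_tail ?f n G') \<longlonglongrightarrow> 0"
    by (intro tilted_tail_tendsto[OF w N])
  have "\<forall>\<^sub>F n in sequentially. tilted_tail ?f n G' < 1 / 2"
    using tail by (intro order_tendstoD) auto
  moreover have "\<forall>\<^sub>F n in sequentially. 1 / e \<le> real (card (\<Lambda> n))"
    using card_at_top unfolding filterlim_at_top by blast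
  ultimately show ?thesis using eventually_\<Lambda>
  proof eventually_elim
    case (elim n)
    then have L: "finite (\<Lambda> n)" "\<Lambda> n \<noteq> {}" by auto
    let ?N = "real (card (\<Lambda> n))" and ?C = "\<Lambda> n \<rightarrow>\<^sub>E {1..q}"
    let ?\<pi> = "colour_profile q n (\<Lambda> n)"
    let ?e = "\<lambda>\<sigma>. exp (?N * (LINT z|?\<pi> \<sigma>. log_likelihood q ?f z))"
    let ?Q = "real q ^ card (\<Lambda> n)"
    have Q: "?Q > 0" using q_pos by simp
    have "sum ?e ?C = sum ?e {\<sigma>. \<sigma> \<in> ?C \<and> ?\<pi> \<sigma> \<in> G'} + sum ?e {\<sigma>. \<sigma> \<in> ?C \<and> ?\<pi> \<sigma> \<notin> G'}"
    proof -
      have "?C = {\<sigma>. \<sigma> \<in> ?C \<and> ?\<pi> \<sigma> \<in> G'} \<union> {\<sigma>. \<sigma> \<in> ?C \<and> ?\<pi> \<sigma> \<notin> G'}" by blast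
      then have "sum ?e ?C = sum ?e ({\<sigma>. \<sigma> \<in> ?C \<and> ?\<pi> \<sigma> \<in> G'} \<union> {\<sigma>. \<sigma> \<in> ?C \<and> ?\<pi> \<sigma> \<notin> G'})"
        by (rule arg_cong)
      also have "\<dots> = sum ?e {\<sigma>. \<sigma> \<in> ?C \<and> ?\<pi> \<sigma> \<in> G'} + sum ?e {\<sigma>. \<sigma> \<in> ?C \<and> ?\<pi> \<sigma> \<notin> G'}"
        by (intro sum.union_disjoint finite_tail_set[OF L(1)]) blast
      finally show ?thesis .
    qed
    then have "?Q = sum ?e {\<sigma>. \<sigma> \<in> ?C \<and> ?\<pi> \<sigma> \<in> G'} + ?Q * tilted_tail ?f n G'"
      unfolding sum_exp_log_likelihood_profile[OF L q_pos fc] tilted_tail_def using Q by simp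
    moreover have "?Q * tilted_tail ?f n G' \<le> ?Q * (1 / 2)"
      using Q elim(1) by (intro mult_left_mono) auto
    ultimately have half: "?Q / 2 \<le> sum ?e {\<sigma>. \<sigma> \<in> ?C \<and> ?\<pi> \<sigma> \<in> G'}" by simp
    have "?Q * exp (- c * ?N) = ?Q / 2 * (2 * exp (- c * ?N))" by simp
    also have "\<dots> \<le> ?Q / 2 * exp (- (c - e) * ?N)"
    proof (rule mult_left_mono)
      \<comment> \<open>The factor 2 compensates for keeping only half of the tilted mass; for large
        n the slack \<open>e\<close> covers it.\<close>
      have "1 \<le> e * ?N" using elim(2) e(1) by (simp add: field_simps)
      then have "2 \<le> exp (e * ?N)" using exp_ge_add_one_self[of "e * ?N"] by linarith
      then have "2 * exp (- c * ?N) \<le> exp (e * ?N) * exp (- c * ?N)" by (rule mult_right_mono) simp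
      then show "2 * exp (- c * ?N) \<le> exp (- (c - e) * ?N)" by (simp add: algebra_simps flip: exp_add)
    qed (use Q in simp)
    also have "\<dots> \<le> sum ?e {\<sigma>. \<sigma> \<in> ?C \<and> ?\<pi> \<sigma> \<in> G'} * exp (- (c - e) * ?N)"
      using half by (intro mult_right_mono) auto
    also have "\<dots> \<le> W n G'"
      unfolding gibbs_weight_def sum_distrib_right
    proof (rule sum_mono)
      fix \<sigma> assume "\<sigma> \<in> {\<sigma>. \<sigma> \<in> ?C \<and> ?\<pi> \<sigma> \<in> G'}"
      then have "(LINT z|?\<pi> \<sigma>. log_likelihood q ?f z) - (c - e) \<le> F (?\<pi> \<sigma>)" by (simp add: G'_def)
      then have "?N * ((LINT z|?\<pi> \<sigma>. log_likelihood q ?f z) - (c - e)) \<le> ?N * F (?\<pi> \<sigma>)"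
        by (intro mult_left_mono) auto
      then show "?e \<sigma> * exp (- (c - e) * ?N) \<le> exp (?N * F (?\<pi> \<sigma>))"
        by (simp add: algebra_simps flip: exp_add)
    qed
    also have "\<dots> \<le> W n G" by (rule gibbs_weight_mono[OF L(1)]) (simp add: G'_def)
    finally show ?case .
  qed
qed

section \<open>Normalisation and the large deviation principle\<close>

lemma uniform_profile_exists:
  obtains \<nu> where "\<nu> \<in> P" "\<exists>\<alpha>. represents q r \<nu> \<alpha>"
proof -
  obtain \<nu> where \<nu>: "\<nu> \<in> P" "\<And>f :: 'd torus \<times> nat \<Rightarrow> real. continuous_on (UNIV \<times> {1..q}) f \<Longrightarrow>
      (LINT z|\<nu>. f z) = (LINT u|base. (\<Sum>a\<in>{1..q}. 1 / real q * f (u, a)))"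
    using coloured_measure_exists[of "\<lambda>_. 1 / real q"] q_pos by auto
  have "(LINT z|\<nu>. g (fst z)) = (LINT u|base. g u)" if "continuous_on UNIV g" for g :: "'d torus \<Rightarrow> real"
    using \<nu>(2)[OF continuous_on_coloured_compose_fst[OF that]] q_pos by simp
  then show ?thesis using represents_if_marginal[OF \<nu>(1)] that[OF \<nu>(1)] by blast
qed

lemma interaction_bounded:
  obtains C where "\<And>\<nu>. \<nu> \<in> P \<Longrightarrow> \<bar>interaction J \<nu>\<bar> \<le> C"
proof -
  have "bounded (range J)"
    using J_cont by (intro compact_imp_bounded compact_continuous_image compact_UNIV_torus)
  then obtain C where C: "C > 0" "\<And>v. \<bar>J v\<bar> \<le> C" by (auto simp: bounded_pos)
  have K: "\<bar>colour_kernel J p\<bar> \<le> C" for p using C by (auto simp: colour_kernel_def)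
  have Kc: "continuous_on S (\<lambda>z. colour_kernel J (z, w))" for w and S :: "('d torus \<times> nat) set"
    by (intro continuous_on_compose2[OF continuous_on_colour_kernel[OF J_cont, of UNIV]]) (auto intro!: continuous_intros)
  show ?thesis
  proof (rule that[of C])
    fix \<nu> assume \<nu>: "\<nu> \<in> P"
    then interpret prob_space \<nu> by (rule prob_measuresD)
    have "\<bar>(LINT z|\<nu>. colour_kernel J (z, w)) - (LINT z|\<nu>. 0)\<bar> \<le> C" for w
      using K by (intro integral_prob_measures_close[OF \<nu> Kc]) auto
    then have "\<bar>interaction J \<nu> - (LINT z|\<nu>. 0)\<bar> \<le> C"
      unfolding interaction_def
      by (intro integral_prob_measures_close[OF \<nu> continuous_on_kernel_integral[OF \<nu> continuous_on_colour_kernel[OF J_cont]]]) auto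
    then show "\<bar>interaction J \<nu>\<bar> \<le> C" by simp
  qed
qed

text \<open>Finiteness makes the subtraction of the infimum meaningful. From below,
  \<open>f = 0\<close> has log-likelihood 0, which leaves the bounded interaction; from above, the
  uniform profile has finite rate.\<close>

lemma rate_infimum_finite:
  obtains i where "(INF \<nu>\<in>P. rate \<nu>) = ereal i"
proof -
  obtain C where C: "\<And>\<nu>. \<nu> \<in> P \<Longrightarrow> \<bar>interaction J \<nu>\<bar> \<le> C" using interaction_bounded by blast
  have "ereal (- (\<bar>\<beta>\<bar> * C)) \<le> rate \<nu>" if \<nu>: "\<nu> \<in> P" for \<nu>
  proof -
    have "(LINT z|\<nu>. log_likelihood q (\<lambda>_. 0) z) = 0"
      using q_pos by (simp add: log_likelihood_def)
    then have "ereal (- F \<nu>) \<le> rate \<nu>" using log_likelihood_le_rate[OF \<nu>, of "\<lambda>_. 0"] by simp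
    moreover have "\<bar>F \<nu>\<bar> \<le> \<bar>\<beta>\<bar> * C" unfolding abs_mult using C[OF \<nu>] by (intro mult_left_mono) auto
    then have "ereal (- (\<bar>\<beta>\<bar> * C)) \<le> ereal (- F \<nu>)" by simp
    ultimately show ?thesis by (rule order_trans[rotated])
  qed
  then have "ereal (- (\<bar>\<beta>\<bar> * C)) \<le> (INF \<nu>\<in>P. rate \<nu>)" by (rule INF_greatest)
  moreover obtain \<nu> where \<nu>: "\<nu> \<in> P" "\<exists>\<alpha>. represents q r \<nu> \<alpha>" by (rule uniform_profile_exists)
  have "(INF \<nu>\<in>P. rate \<nu>) \<le> rate \<nu>" using \<nu>(1) by (rule INF_lower)
  moreover have "rate \<nu> \<noteq> \<infinity>" by (rule rate_represented[OF \<nu>]) simp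
  ultimately show ?thesis using that by (cases "INF \<nu>\<in>P. rate \<nu>") auto
qed

text \<open>The whole space is both open and closed, so both bounds apply to it; any level above or
  below the infimum of the rate is admissible.\<close>

lemma partition_function_bounds:
  assumes i: "(INF \<nu>\<in>P. rate \<nu>) = ereal i" and e: "e > 0"
  shows "\<forall>\<^sub>F n in sequentially. real q ^ card (\<Lambda> n) * exp (- (i + e) * real (card (\<Lambda> n))) \<le> W n P"
    and "\<exists>M>0. \<forall>\<^sub>F n in sequentially. W n P \<le> M * (real q ^ card (\<Lambda> n) * exp (- (i - e) * real (card (\<Lambda> n))))"
proof -
  have "(INF \<nu>\<in>P. rate \<nu>) < ereal (i + e)" using i e by simp
  then obtain \<nu> where \<nu>: "\<nu> \<in> P" "rate \<nu> < ereal (i + e)" by (auto simp: INF_less_iff)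
  have "openin X P" "closedin X P"
    using openin_topspace[of X] closedin_topspace[of X] by (simp_all add: topspace_weak_topology)
  from gibbs_weight_lower_bound[OF this(1) \<nu>]
  show "\<forall>\<^sub>F n in sequentially. real q ^ card (\<Lambda> n) * exp (- (i + e) * real (card (\<Lambda> n))) \<le> W n P" .
  have "ereal (i - e) < rate \<nu>" if "\<nu> \<in> P" for \<nu>
  proof -
    have "ereal (i - e) < ereal i" using e by simp
    also have "\<dots> \<le> rate \<nu>" using INF_lower[OF that, of rate] by (simp add: i)
    finally show ?thesis .
  qed
  from gibbs_weight_upper_bound[OF \<open>closedin X P\<close> this]
  show "\<exists>M>0. \<forall>\<^sub>F n in sequentially. W n P \<le> M * (real q ^ card (\<Lambda> n) * exp (- (i - e) * real (card (\<Lambda> n))))"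
    by blast
qed

lemma eventually_const_le_exp:
  assumes e: "e > 0"
  shows "\<forall>\<^sub>F n in sequentially. M \<le> exp (e * real (card (\<Lambda> n)))"
proof -
  have "filterlim (\<lambda>n. exp (e * real (card (\<Lambda> n)))) at_top sequentially"
    using e by (intro filterlim_compose[OF exp_at_top] filterlim_tendsto_pos_mult_at_top[OF tendsto_const _ card_at_top])
  then show ?thesis unfolding filterlim_at_top by blast
qed

lemma upper_bound:
  assumes i: "(INF \<nu>\<in>P. rate \<nu>) = ereal i" and C: "closedin X C"
    and c: "ereal c < (INF \<nu>\<in>C. rate \<nu> - ereal i)"
  shows "\<forall>\<^sub>F n in sequentially.
    log_ext (measure (profile_law J \<beta> q n (\<Lambda> n)) C) / ereal (real (card (\<Lambda> n))) \<le> ereal (- c)"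
proof -
  obtain d where d: "ereal c < ereal d" "ereal d < (INF \<nu>\<in>C. rate \<nu> - ereal i)"
    using ereal_dense2[OF c] by (metis ereal_less_eq(1) ereal_less_ereal_Ex less_ereal.simps(2) not_less)
  \<comment> \<open>Of the gap \<open>2 * e\<close> between c and d, one \<open>e\<close> absorbs
    the constant \<open>M\<close> and the other the lower bound on the partition function.\<close>
  define e where "e = (d - c) / 2"
  have e: "e > 0" using d(1) by (simp add: e_def)
  have "ereal (d + i) < rate \<nu>" if "\<nu> \<in> C" for \<nu>
  proof -
    have "ereal d < rate \<nu> - ereal i" using less_le_trans[OF d(2) INF_lower[OF that]] .
    then show ?thesis by (cases "rate \<nu>") auto
  qed
  then obtain M where M: "M > 0"
    "\<forall>\<^sub>F n in sequentially. W n C \<le> M * (real q ^ card (\<Lambda> n) * exp (- (d + i) * real (card (\<Lambda> n))))"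
    by (rule gibbs_weight_upper_bound[OF C])
  from M(2) partition_function_bounds(1)[OF i e] eventually_\<Lambda> eventually_const_le_exp[OF e, of M]
  show ?thesis
  proof eventually_elim
    case (elim n)
    then have L: "finite (\<Lambda> n)" "\<Lambda> n \<noteq> {}" by auto
    let ?N = "real (card (\<Lambda> n))" and ?Q = "real q ^ card (\<Lambda> n)"
    have pos: "?N > 0" "?Q > 0" using L q_pos by (auto simp: card_gt_0_iff)
    have "W n C \<le> exp (e * ?N) * (?Q * exp (- (d + i) * ?N))"
      using elim(1,4) pos by (auto intro: order_trans mult_right_mono)
    also have "\<dots> = exp (- c * ?N) * (?Q * exp (- (i + e) * ?N))"
    proof -
      have "d = c + 2 * e" by (simp add: e_def field_simps)
      then have "e * ?N + - (d + i) * ?N = - c * ?N + - (i + e) * ?N" by (simp add: algebra_simps)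
      then have "exp (e * ?N) * exp (- (d + i) * ?N) = exp (- c * ?N) * exp (- (i + e) * ?N)"
        by (simp only: exp_add[symmetric])
      then show ?thesis by (simp only: mult.left_commute)
    qed
    also have "\<dots> \<le> exp (- c * ?N) * W n P" using elim(2) by (intro mult_left_mono) auto
    finally have "W n C \<le> exp (- c * ?N) * W n P" .
    moreover have "0 < W n P" using elim(2) pos by (intro less_le_trans[OF _ elim(2)]) auto
    ultimately have "measure (profile_law J \<beta> q n (\<Lambda> n)) C \<le> exp (- c * ?N)"
      using C by (simp add: measure_profile_law[OF L J_cont] divide_le_eq)
    then show ?case using pos by (intro log_ext_div_le) auto
  qed
qed

lemma lower_bound:
  assumes i: "(INF \<nu>\<in>P. rate \<nu>) = ereal i" and G: "openin X G" and \<nu>: "\<nu> \<in> G"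
    and c: "rate \<nu> - ereal i < ereal c"
  shows "\<forall>\<^sub>F n in sequentially.
    ereal (- c) \<le> log_ext (measure (profile_law J \<beta> q n (\<Lambda> n)) G) / ereal (real (card (\<Lambda> n)))"
proof -
  obtain d where d: "rate \<nu> - ereal i < ereal d" "ereal d < ereal c"
  proof -
    have "rate \<nu> - ereal i \<noteq> - \<infinity>"
      using INF_lower[of \<nu> P rate] i \<nu> openin_subset[OF G] by (cases "rate \<nu>") (auto simp: topspace_weak_topology)
    then show ?thesis using ereal_dense2[OF c] that by blast
  qed
  \<comment> \<open>Again one \<open>e\<close> is for the constant \<open>M\<close> and one for the
    partition function, this time for its upper bound.\<close>
  define e where "e = (c - d) / 2"
  have e: "e > 0" using d(2) by (simp add: e_def)
  have "rate \<nu> < ereal (d + i)" using d(1) by (cases "rate \<nu>") auto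
  note low = gibbs_weight_lower_bound[OF G \<nu> this]
  obtain M where M: "M > 0"
    "\<forall>\<^sub>F n in sequentially. W n P \<le> M * (real q ^ card (\<Lambda> n) * exp (- (i - e) * real (card (\<Lambda> n))))"
    using partition_function_bounds(2)[OF i e] by blast
  from low M(2) eventually_\<Lambda> eventually_const_le_exp[OF e, of M]
  show ?thesis
  proof eventually_elim
    case (elim n)
    then have L: "finite (\<Lambda> n)" "\<Lambda> n \<noteq> {}" by auto
    let ?N = "real (card (\<Lambda> n))" and ?Q = "real q ^ card (\<Lambda> n)"
    have pos: "?N > 0" "?Q > 0" using L q_pos by (auto simp: card_gt_0_iff)
    have "W n P \<le> exp (e * ?N) * (?Q * exp (- (i - e) * ?N))"
      using elim(2,4) pos by (auto intro: order_trans mult_right_mono)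
    then have "exp (- c * ?N) * W n P \<le> exp (- c * ?N) * (exp (e * ?N) * (?Q * exp (- (i - e) * ?N)))"
      by (intro mult_left_mono) auto
    also have "\<dots> = ?Q * exp (- (d + i) * ?N)"
    proof -
      have "c = d + 2 * e" by (simp add: e_def field_simps)
      then have "- c * ?N + (e * ?N + - (i - e) * ?N) = - (d + i) * ?N" by (simp add: algebra_simps)
      then have "exp (- c * ?N) * (exp (e * ?N) * exp (- (i - e) * ?N)) = exp (- (d + i) * ?N)"
        by (simp only: exp_add[symmetric])
      then show ?thesis by (simp only: mult.left_commute)
    qed
    also have "\<dots> \<le> W n G" by (rule elim(1))
    finally have "exp (- c * ?N) * W n P \<le> W n G" .
    moreover have "0 < W n P"
    proof -
      have "0 < ?Q * exp (- (d + i) * ?N)" using pos by simp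
      also have "\<dots> \<le> W n G" by (rule elim(1))
      also have "\<dots> \<le> W n P"
        using openin_subset[OF G] by (intro gibbs_weight_mono L(1)) (simp add: topspace_weak_topology)
      finally show ?thesis .
    qed
    ultimately have "exp (- c * ?N) \<le> measure (profile_law J \<beta> q n (\<Lambda> n)) G"
      using G by (simp add: measure_profile_law[OF L J_cont] le_divide_eq)
    then show ?case using pos by (intro log_ext_div_ge) auto
  qed
qed

lemma large_deviation:
  "large_deviation_principle X (\<lambda>n. profile_law J \<beta> q n (\<Lambda> n)) (\<lambda>n. real (card (\<Lambda> n)))
    (\<lambda>\<nu>. rate \<nu> - (INF \<nu>'\<in>P. rate \<nu>'))"
proof -
  obtain i where i: "(INF \<nu>\<in>P. rate \<nu>) = ereal i" by (rule rate_infimum_finite)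
  show ?thesis
    unfolding large_deviation_principle_def i
  proof (intro conjI ballI allI impI)
    show "filterlim (\<lambda>n. real (card (\<Lambda> n))) at_top sequentially" by (rule card_at_top)
  next
    fix \<nu> assume "\<nu> \<in> topspace X"
    then have "(INF \<nu>\<in>P. rate \<nu>) \<le> rate \<nu>" by (intro INF_lower) (simp add: topspace_weak_topology)
    then show "0 \<le> rate \<nu> - ereal i" unfolding i by (cases "rate \<nu>") auto
  next
    have "{\<nu> \<in> topspace X. rate \<nu> - ereal i \<le> ereal c} = {\<nu> \<in> topspace X. rate \<nu> \<le> ereal (c + i)}" for c
    proof (rule Collect_cong, rule conj_cong[OF refl])
      fix \<nu> show "rate \<nu> - ereal i \<le> ereal c \<longleftrightarrow> rate \<nu> \<le> ereal (c + i)" by (cases "rate \<nu>") auto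
    qed
    then show "lower_semicontinuous_in X (\<lambda>\<nu>. rate \<nu> - ereal i)"
      unfolding lower_semicontinuous_in_def using closedin_rate_le by simp
  next
    fix C assume C: "closedin X C"
    show "limsup (\<lambda>n. log_ext (measure (profile_law J \<beta> q n (\<Lambda> n)) C) / ereal (real (card (\<Lambda> n)))) \<le>
        - (INF \<nu>\<in>C. rate \<nu> - ereal i)"
      (is "?l \<le> - ?I")
    \<comment> \<open>A real number strictly between the two sides reduces the claim to a finite
      level and covers infinite values, such as the infimum over an empty set.\<close>
    proof (rule ccontr)
      assume "\<not> ?l \<le> - ?I"
      then have "- ?l < ?I" by (simp add: ereal_uminus_less_reorder not_le)
      then obtain c where c: "- ?l < ereal c" "ereal c < ?I" using ereal_dense2 by blast
      have "?l \<le> ereal (- c)"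
        by (rule Limsup_bounded[OF upper_bound[OF i C c(2)]])
      also have "\<dots> < ?l" using c(1) by (simp add: ereal_uminus_less_reorder)
      finally show False by simp
    qed
  next
    fix G assume G: "openin X G"
    show "- (INF \<nu>\<in>G. rate \<nu> - ereal i) \<le>
        liminf (\<lambda>n. log_ext (measure (profile_law J \<beta> q n (\<Lambda> n)) G) / ereal (real (card (\<Lambda> n))))"
      (is "- ?I \<le> ?l")
    proof (rule ccontr)
      assume "\<not> - ?I \<le> ?l"
      then have "?I < - ?l" by (simp add: ereal_less_uminus_reorder not_le)
      then obtain c where c: "?I < ereal c" "ereal c < - ?l" using ereal_dense2 by blast
      from c(1) obtain \<nu> where \<nu>: "\<nu> \<in> G" "rate \<nu> - ereal i < ereal c" by (auto simp: INF_less_iff)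
      have "?l < ereal (- c)" using c(2) by (subst (asm) ereal_less_uminus_reorder) simp
      also have "\<dots> \<le> ?l"
        by (rule Liminf_bounded[OF lower_bound[OF i G \<nu>]])
      finally show False by simp
    qed
  qed
qed

end

theorem proposition2p5:
  fixes J :: "'d::finite torus \<Rightarrow> real" and \<beta> :: real and q :: nat
    and \<Lambda> :: "nat \<Rightarrow> (int ^ 'd) set" and \<rho> :: "'d torus \<Rightarrow> real"
  assumes "continuous_on UNIV J" and "\<And>v. 0 \<le> J v" and "\<And>v. J (- v) = J v"
    and "(LINT v|torus_lebesgue. J v) = 1"
    and "\<beta> \<ge> 0" and "q \<ge> 1"
    and "\<And>n. n \<ge> 1 \<Longrightarrow> \<Lambda> n \<subseteq> discrete_torus n"
    and "integrable torus_lebesgue \<rho>" and "AE u in torus_lebesgue. 0 \<le> \<rho> u"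
    and "sites_converge \<Lambda> \<rho>"
    and "(LINT u|torus_lebesgue. \<rho> u) > 0"
  shows "large_deviation_principle (weak_topology q)
    (\<lambda>n. profile_law J \<beta> q n (\<Lambda> n))
    (\<lambda>n. real (card (\<Lambda> n)))
    (\<lambda>\<nu>. rate_function J \<beta> q (normalized_density \<rho>) \<nu> -
       (INF \<nu>'\<in>prob_measures (coloured_torus q). rate_function J \<beta> q (normalized_density \<rho>) \<nu>'))"
proof -
  interpret kac_potts_sequence J \<beta> q \<Lambda> \<rho>
    by (rule kac_potts_sequence.intro) (use assms in auto)
  show ?thesis by (rule large_deviation)
qed

end
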